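(* For every fixed vertex $v$, $$\mathrm{Var}\bigl(\deg_{M_n}(v)\bigr)\xrightarrow{n\to\infty} 6-4\zeta(3)\approx 1.1917723\ldots,$$ where $\zeta$ is the Riemann zeta function.
   Context: $K_n$ is the complete graph on $[n]=\{1,\ldots,n\}$, with i.i.d. uniform $[0,1]$ edge weights $(w_e)_{e\in E(K_n)}$, and $M_n$ is the minimum spanning tree: the almost surely unique spanning tree of $K_n$ minimizing the total weight. $\deg_{M_n}(v)$ is the degree of $v$ in $M_n$, and the variance is with respect to the random edge weights. *)

theory Defs
  imports "HOL-Probability.Probability"
begin

text \<open>A graph on \<open>[n] = {1..n}\<close> is identified with its set of edges, an edge being a
  two-element set of vertices.  The notions of tree and spanning tree in the AFP entry
  Graph-Theory are not used: they are about directed graphs, where acyclicity only excludes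
  directed cycles (and excludes every pair of opposite arcs).\<close>

definition complete_edges :: "nat \<Rightarrow> nat set set" where
  "complete_edges n = {{u, v} | u v. u \<in> {1..n} \<and> v \<in> {1..n} \<and> u \<noteq> v}"

definition adj :: "nat set set \<Rightarrow> (nat \<times> nat) set" where
  "adj F = {(u, v). {u, v} \<in> F}"

definition connected_on :: "nat set \<Rightarrow> nat set set \<Rightarrow> bool" where
  "connected_on V F \<longleftrightarrow> (\<forall>u\<in>V. \<forall>v\<in>V. (u, v) \<in> (adj F)\<^sup>*)"

text \<open>The list of the distinct vertices of a cycle, in cyclic order.\<close>

definition is_cycle :: "nat set set \<Rightarrow> nat list \<Rightarrow> bool" where
  "is_cycle F p \<longleftrightarrow> 3 \<le> length p \<and> distinct p \<and>
     (\<forall>i<length p. {p ! i, p ! (Suc i mod length p)} \<in> F)"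

definition spanning_tree :: "nat \<Rightarrow> nat set set \<Rightarrow> bool" where
  "spanning_tree n T \<longleftrightarrow>
     T \<subseteq> complete_edges n \<and> connected_on {1..n} T \<and> (\<nexists>p. is_cycle T p)"

definition is_mst :: "nat \<Rightarrow> (nat set \<Rightarrow> real) \<Rightarrow> nat set set \<Rightarrow> bool" where
  "is_mst n x T \<longleftrightarrow> spanning_tree n T \<and> (\<forall>T'. spanning_tree n T' \<longrightarrow> sum x T \<le> sum x T')"

text \<open>The minimum spanning tree.  It is unique for almost all weights; on the exceptional null
  set a minimizer is chosen arbitrarily.  The choice depends on the weights only through the
  set of minimizers, of which there are finitely many possibilities, so that \<open>mst\<close> is
  measurable as a function of the weights.\<close>

definition mst :: "nat \<Rightarrow> (nat set \<Rightarrow> real) \<Rightarrow> nat set set" where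
  "mst n x = (SOME T. is_mst n x T)"

definition degree_in :: "nat set set \<Rightarrow> nat \<Rightarrow> nat" where
  "degree_in F v = card {e \<in> F. v \<in> e}"

definition iid_uniform_weights :: "nat \<Rightarrow> 'a measure \<Rightarrow> (nat set \<Rightarrow> 'a \<Rightarrow> real) \<Rightarrow> bool" where
  "iid_uniform_weights n P w \<longleftrightarrow>
     prob_space P \<and>
     prob_space.indep_vars P (\<lambda>_. borel) w (complete_edges n) \<and>
     (\<forall>e\<in>complete_edges n. distr P borel (w e) = uniform_measure lborel {0..1})"

lemma iid_uniform_weights_PiM:
  "iid_uniform_weights n (PiM (complete_edges n) (\<lambda>_. uniform_measure lborel {0..1}))
     (\<lambda>e x. x e)"
proof -
  let ?U = "uniform_measure lborel {0..1::real}"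
  interpret U: prob_space ?U by (rule prob_space_uniform_measure) auto
  interpret product_prob_space "\<lambda>_. ?U" "complete_edges n" by unfold_locales
  have d: "distr (PiM (complete_edges n) (\<lambda>_. ?U)) ?U (\<lambda>x. x e) = ?U" if "e \<in> complete_edges n" for e
    using PiM_component[OF that] .
  have d': "distr (PiM (complete_edges n) (\<lambda>_. ?U)) borel (\<lambda>x. x e) = ?U" if "e \<in> complete_edges n" for e
    using d[OF that] by (metis distr_cong sets_lborel sets_uniform_measure)
  have i: "indep_vars (\<lambda>_. borel) (\<lambda>e x. x e) (complete_edges n)"
  proof (cases "complete_edges n = {}")
    case True then show ?thesis unfolding indep_vars_def indep_sets_def by auto
  next
    case False
    have "indep_vars (\<lambda>_. ?U) (\<lambda>e x. x e) (complete_edges n)"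
      by (subst indep_vars_iff_distr_eq_PiM'[OF False])
         (auto simp: d space_PiM PiE_restrict cong: PiM_cong intro!: trans[OF distr_cong distr_id2])
    then show ?thesis by (simp add: indep_vars_def measurable_def)
  qed
  show ?thesis unfolding iid_uniform_weights_def
    using d' i prob_space_axioms by auto
qed

text \<open>The Riemann zeta function by its Dirichlet series, hence meaningful only for real
  \<open>s > 1\<close>.\<close>

definition riemann_zeta :: "real \<Rightarrow> real" where
  "riemann_zeta s = (\<Sum>k. 1 / real (Suc k) powr s)"

end

theory Submission
  imports Defs
begin

text \<open>Write \<open>G\<^sub>t\<close> for the graph of the edges of weight less than \<open>t\<close> and \<open>\<kappa>\<^sub>t\<close> for its number of
  components.  By Kruskal's rule \<open>{u, v}\<close> belongs to
  the minimum spanning tree if and only if \<open>u\<close> and \<open>v\<close> lie in different components of \<open>G\<^sub>t\<close> at the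
  time \<open>t\<close> when the edge arrives, and absent edges arrive at rate \<open>1 / (1 - t)\<close>.  Counting pairs of
  incident tree edges at the arrival of the later one, and using that the tree edges present at time
  \<open>t\<close> form a spanning forest of \<open>G\<^sub>t\<close>, the sum over \<open>v\<close> of the squared degrees has the exact
  expectation \<open>10 (n - 1) - 4 n J\<close> with \<open>J = \<integral> E (\<kappa>\<^sub>t - 1) / (1 - t) dt\<close>.  Exchangeability turns this
  into the second moment of one degree.

  It remains to see that \<open>J\<close> tends to \<open>\<zeta>(3)\<close> (Frieze's theorem).  By Cayley's formula the components
  of order \<open>k\<close>, asymptotically all trees, contribute \<open>1 / k\<^sup>3\<close>.  Late times contribute little because
  the number of edges joining different components is at least \<open>n (\<kappa>\<^sub>t - 1) / 2\<close>, which bounds the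
  integral over \<open>t \<ge> s\<close> by \<open>4 / (n s)\<close>.\<close>

section \<open>Components of a graph\<close>

text \<open>The exact formula exists because the shape of the tree drops out. Summing, over all
  edges between different components, the degrees of their two endpoints gives every vertex the
  weight \<open>n - k\<close>, where \<open>k\<close> is the order of its component. This weight is
  constant on components, and a tree on \<open>k\<close> vertices has total degree
  \<open>2 (k - 1)\<close> whatever it looks like, so the sum is \<open>4\<close> times the number
  of such edges minus \<open>2 n (\<kappa> - 1)\<close>. Integrated against the hazard rate, the
  expected number of such edges gives the \<open>n - 1\<close> tree edges; hence
  \<open>10 = 2 + 2 * 4\<close>, the \<open>2\<close> coming from the diagonal pairs. In the limit
  the squared mean \<open>4\<close> is subtracted. The obstacle is the singularity of
  \<open>1 / (1 - t)\<close> at \<open>t = 1\<close>: integrals are taken in \<open>ennreal\<close>,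
  identities are stated as sums without subtraction, and finiteness of \<open>J\<close> follows from
  the same lower bound on the number of joining edges that controls late times.\<close>

definition edges :: "nat set \<Rightarrow> nat set set" where
  "edges V = {{u, v} | u v. u \<in> V \<and> v \<in> V \<and> u \<noteq> v}"

definition component :: "nat set set \<Rightarrow> nat \<Rightarrow> nat set" where
  "component F v = (adj F)\<^sup>* `` {v}"

definition conn_components :: "nat set \<Rightarrow> nat set set \<Rightarrow> nat set set" where
  "conn_components V F = component F ` V"

lemma complete_edges_eq: "complete_edges n = edges {1..n}"
  by (simp add: complete_edges_def edges_def)

lemma edgesE:
  assumes "e \<in> edges V"
  obtains u v where "e = {u, v}" "u \<in> V" "v \<in> V" "u \<noteq> v"
  using assms unfolding edges_def by blast

lemma doubleton_in_edges [simp]: "{u, v} \<in> edges V \<longleftrightarrow> u \<in> V \<and> v \<in> V \<and> u \<noteq> v"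
  by (auto simp: edges_def doubleton_eq_iff)

lemma edges_subset_Pow: "edges V \<subseteq> Pow V"
  by (auto simp: edges_def)

lemma finite_edges [simp]: "finite V \<Longrightarrow> finite (edges V)"
  by (meson edges_subset_Pow finite_Pow_iff finite_subset)

lemma edges_mono: "A \<subseteq> V \<Longrightarrow> edges A \<subseteq> edges V"
  by (auto simp: edges_def)

lemma in_adj [simp]: "(u, v) \<in> adj F \<longleftrightarrow> {u, v} \<in> F"
  by (simp add: adj_def)

lemma sym_adj_rtrancl: "sym ((adj F)\<^sup>*)"
  by (rule sym_rtrancl) (auto simp: sym_def insert_commute)

lemma equiv_component: "equiv UNIV ((adj F)\<^sup>*)"
  by (simp add: equiv_def refl_rtrancl sym_adj_rtrancl trans_rtrancl)

lemma in_component: "u \<in> component F v \<longleftrightarrow> (v, u) \<in> (adj F)\<^sup>*"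
  by (simp add: component_def)

lemma component_refl [simp]: "v \<in> component F v"
  by (simp add: in_component)

lemma component_eq_iff: "component F u = component F v \<longleftrightarrow> u \<in> component F v"
  using eq_equiv_class_iff[OF equiv_component, of v u F]
  by (auto simp: component_def)

lemma in_component_sym: "u \<in> component F v \<longleftrightarrow> v \<in> component F u"
  by (metis component_eq_iff)

lemma component_mono: "F \<subseteq> G \<Longrightarrow> component F v \<subseteq> component G v"
  unfolding component_def by (intro Image_mono rtrancl_mono) (auto simp: adj_def)

lemma edge_component: "{u, v} \<in> F \<Longrightarrow> component F u = component F v"
  by (simp add: component_eq_iff in_component insert_commute r_into_rtrancl)

lemma in_component_trans: "u \<in> component F v \<Longrightarrow> w \<in> component F u \<Longrightarrow> w \<in> component F v"
  by (metis component_eq_iff)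

lemma component_subset:
  assumes "F \<subseteq> edges V" "v \<in> V"
  shows "component F v \<subseteq> V"
proof
  fix u assume "u \<in> component F v"
  then have "(v, u) \<in> (adj F)\<^sup>*" by (simp add: in_component)
  then show "u \<in> V"
    by induction (use assms in auto)
qed

text \<open>Induction along a walk. Upper bounds on components are obtained from this by exhibiting
  a set closed under adjacency, without handling paths.\<close>

lemma closed_component_subset:
  assumes "v \<in> A" "\<And>a b. {a, b} \<in> F \<Longrightarrow> a \<in> A \<Longrightarrow> b \<in> A"
  shows "component F v \<subseteq> A"
proof
  fix u assume "u \<in> component F v"
  then have "(v, u) \<in> (adj F)\<^sup>*" by (simp add: in_component)
  then show "u \<in> A"
    by induction (use assms in auto)
qed

lemma component_complete:
  assumes "u \<in> V"
  shows "component (edges V) u = V"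
proof
  show "component (edges V) u \<subseteq> V" using component_subset assms by blast
  show "V \<subseteq> component (edges V) u"
  proof
    fix v assume "v \<in> V"
    show "v \<in> component (edges V) u"
    proof (cases "u = v")
      case False
      then have "component (edges V) u = component (edges V) v"
        using assms \<open>v \<in> V\<close> by (intro edge_component) simp
      then show ?thesis by simp
    qed simp
  qed
qed

text \<open>The union of the two components is closed under the enlarged edge set, and any other
  component never meets the new edge. Inductions that add one edge at a time rest on this.\<close>

lemma component_insert:
  "component (insert {a, b} F) v =
     (if v \<in> component F a \<union> component F b then component F a \<union> component F b else component F v)"
proof (cases "v \<in> component F a \<union> component F b")
  case True
  let ?G = "insert {a, b} F"
  have ab: "component ?G a = component ?G b" by (rule edge_component) simp
  have "component F a \<subseteq> component ?G a" "component F b \<subseteq> component ?G b"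
    by (simp_all add: component_mono subset_insertI)
  with ab have sub: "component F a \<union> component F b \<subseteq> component ?G a" by simp
  with True have "component ?G v = component ?G a" by (subst component_eq_iff) auto
  moreover have "component ?G v \<subseteq> component F a \<union> component F b"
  proof (rule closed_component_subset[OF True])
    fix c d assume "{c, d} \<in> ?G" and c: "c \<in> component F a \<union> component F b"
    then consider "{c, d} = {a, b}" | "{c, d} \<in> F" by auto
    then show "d \<in> component F a \<union> component F b"
    proof cases
      case 1 then show ?thesis by (auto simp: doubleton_eq_iff)
    next
      case 2
      then have "component F c = component F d" by (rule edge_component)
      then show ?thesis using c by (metis Un_iff component_eq_iff)
    qed
  qed
  ultimately show ?thesis using True sub by (metis subset_antisym)
next
  case False
  let ?G = "insert {a, b} F"
  have "component ?G v \<subseteq> component F v"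
  proof (rule closed_component_subset)
    fix c d assume "{c, d} \<in> ?G" and c: "c \<in> component F v"
    moreover from False c have "a \<notin> component F v" "b \<notin> component F v"
      using in_component_sym by auto
    ultimately have "{c, d} \<in> F" by (auto simp: doubleton_eq_iff)
    then show "d \<in> component F v" using c edge_component by (metis component_eq_iff)
  qed simp
  then show ?thesis using False component_mono[of F ?G v] by auto
qed

lemma component_insert_same:
  assumes "b \<in> component F a"
  shows "component (insert {a, b} F) = component F"
proof
  fix v
  show "component (insert {a, b} F) v = component F v"
    using component_insert[of a b F v] assms component_eq_iff by (metis Un_absorb)
qed

lemma components_insert:
  assumes "a \<in> V" "b \<in> V" "b \<notin> component F a"
  shows "conn_components V (insert {a, b} F)
     = insert (component F a \<union> component F b) (conn_components V F - {component F a, component F b})"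
    (is "?L = insert ?U ?R")
proof
  have iff: "v \<in> ?U \<longleftrightarrow> component F v = component F a \<or> component F v = component F b" for v
    using component_eq_iff[of F v a] component_eq_iff[of F v b] by simp
  show "?L \<subseteq> insert ?U ?R"
  proof
    fix A assume "A \<in> ?L"
    then obtain v where v: "v \<in> V" "A = component (insert {a, b} F) v"
      unfolding conn_components_def by auto
    show "A \<in> insert ?U ?R"
    proof (cases "v \<in> ?U")
      case False
      then have "A = component F v" using v component_insert by simp
      with False iff v show ?thesis unfolding conn_components_def by blast
    qed (simp add: v component_insert)
  qed
  have "?U \<in> ?L"
    using assms(1) unfolding conn_components_def by (intro image_eqI[of _ _ a]) (simp_all add: component_insert)
  moreover have "A \<in> ?L" if A: "A \<in> ?R" for A
  proof -
    from A obtain v where v: "v \<in> V" "A = component F v" unfolding conn_components_def by auto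
    with A iff have "v \<notin> ?U" by simp
    with v show ?thesis
      unfolding conn_components_def by (intro image_eqI[of _ _ v]) (simp_all add: component_insert)
  qed
  ultimately show "insert ?U ?R \<subseteq> ?L" by blast
qed

lemma finite_components [simp]: "finite V \<Longrightarrow> finite (conn_components V F)"
  by (simp add: conn_components_def)

lemma component_in_components [simp]: "v \<in> V \<Longrightarrow> component F v \<in> conn_components V F"
  by (simp add: conn_components_def)

lemma components_disjoint: "A \<in> conn_components V F \<Longrightarrow> B \<in> conn_components V F \<Longrightarrow> A \<noteq> B \<Longrightarrow> A \<inter> B = {}"
  unfolding conn_components_def using in_component_trans in_component_sym component_eq_iff by blast

lemma components_Union:
  assumes "F \<subseteq> edges V"
  shows "\<Union> (conn_components V F) = V"
  using component_subset[OF assms] unfolding conn_components_def by fastforce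

lemma components_nonempty: "A \<in> conn_components V F \<Longrightarrow> A \<noteq> {}"
  unfolding conn_components_def using component_refl by blast

lemma components_subset: "F \<subseteq> edges V \<Longrightarrow> A \<in> conn_components V F \<Longrightarrow> A \<subseteq> V"
  using components_Union by blast

lemma component_of_mem: "A \<in> conn_components V F \<Longrightarrow> v \<in> A \<Longrightarrow> component F v = A"
  unfolding conn_components_def by (metis component_eq_iff imageE)

lemma sum_components:
  assumes "finite V" "F \<subseteq> edges V"
  shows "sum f V = (\<Sum>A\<in>conn_components V F. sum f A)"
proof -
  have "sum f (\<Union> (conn_components V F)) = (\<Sum>A\<in>conn_components V F. sum f A)"
    using assms components_subset[OF assms(2)] finite_subset[OF _ assms(1)] components_disjoint
    by (subst sum.Union_disjoint) auto
  then show ?thesis using components_Union[OF assms(2)] by simp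
qed

text \<open>Every vertex of a component \<open>A\<close> carries the share
  \<open>1 / card A\<close>, and the shares add up to one. This converts vertex sums into component
  sums.\<close>

lemma sum_inverse_card_component:
  fixes g :: "nat set \<Rightarrow> real"
  assumes "finite V" "F \<subseteq> edges V"
  shows "(\<Sum>v\<in>V. g (component F v) / card (component F v)) = (\<Sum>A\<in>conn_components V F. g A)"
proof -
  have "(\<Sum>v\<in>A. g (component F v) / card (component F v)) = g A" if "A \<in> conn_components V F" for A
  proof -
    have "finite A" "A \<noteq> {}"
      using that components_subset[OF assms(2)] finite_subset[OF _ assms(1)] components_nonempty by auto
    then show ?thesis using component_of_mem[OF that] by simp
  qed
  then show ?thesis by (subst sum_components[OF assms]) simp
qed

lemma sum_card_components:
  assumes "finite V" "F \<subseteq> edges V"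
  shows "(\<Sum>A\<in>conn_components V F. card A) = card V"
  using sum_components[OF assms, of "\<lambda>_. 1 :: nat"] by simp

lemma card_component:
  assumes "finite V" "F \<subseteq> edges V" "v \<in> V"
  shows "0 < card (component F v)" "card (component F v) \<le> card V"
proof -
  have "finite (component F v)" using component_subset[OF assms(2,3)] assms(1) finite_subset by blast
  then show "0 < card (component F v)" using component_refl card_gt_0_iff by blast
  show "card (component F v) \<le> card V" by (simp add: assms card_mono component_subset)
qed

text \<open>The merged set is not an old component, since it would have to be the component of
  \<open>a\<close>; so a joining edge replaces two components by a genuinely new one.\<close>

lemma card_components_insert:
  assumes "finite V" "a \<in> V" "b \<in> V"
  shows "card (conn_components V F) = card (conn_components V (insert {a, b} F)) + of_bool (b \<notin> component F a)"
proof (cases "b \<in> component F a")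
  case True
  then show ?thesis by (simp add: component_insert_same conn_components_def)
next
  case False
  let ?A = "component F a" and ?B = "component F b"
  have ne: "?A \<noteq> ?B" using False component_eq_iff by metis
  have "?A \<union> ?B \<notin> conn_components V F - {?A, ?B}"
  proof
    assume *: "?A \<union> ?B \<in> conn_components V F - {?A, ?B}"
    then have "component F a = ?A \<union> ?B" by (intro component_of_mem) auto
    with * show False by auto
  qed
  then have "card (conn_components V (insert {a, b} F)) = Suc (card (conn_components V F - {?A, ?B}))"
    using assms False by (simp add: components_insert)
  also have "card (conn_components V F - {?A, ?B}) = card (conn_components V F) - 2"
    using assms ne by (subst card_Diff_subset) auto
  also have "card (conn_components V F) \<ge> 2"
    using card_mono[of "conn_components V F" "{?A, ?B}"] assms ne by auto
  ultimately show ?thesis using False by simp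
qed

lemma component_empty [simp]: "component {} v = {v}"
  using closed_component_subset[of v "{v}" "{}"] by auto

lemma components_empty: "conn_components V {} = (\<lambda>v. {v}) ` V"
  by (simp add: conn_components_def)

lemma card_components_empty [simp]: "card (conn_components V {}) = card V"
  by (simp add: components_empty card_image)

text \<open>Components of \<open>G\<close> are unions of components of \<open>F\<close>, so sending
  a component of \<open>F\<close> to the union of the \<open>G\<close>-components of its vertices is
  onto.\<close>

lemma card_components_anti_mono:
  assumes "finite V" "F \<subseteq> G"
  shows "card (conn_components V G) \<le> card (conn_components V F)"
proof -
  have "component G v = \<Union> (component G ` component F v)" for v
    using component_mono[OF assms(2), of v] using component_refl[of v F] in_component_trans by blast
  then have "conn_components V G = (\<lambda>A. \<Union> (component G ` A)) ` conn_components V F"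
    unfolding conn_components_def image_image by (rule image_cong[OF refl])
  then show ?thesis using assms by (simp add: card_image_le)
qed

lemma card_le_card_components:
  assumes "finite V" "F \<subseteq> edges V"
  shows "card V \<le> card F + card (conn_components V F)"
proof -
  have "finite F" using assms finite_edges finite_subset by blast
  then show ?thesis using assms(2)
  proof induction
    case (insert e F)
    then obtain a b where e: "e = {a, b}" "a \<in> V" "b \<in> V" by (auto elim: edgesE)
    show ?case
      using insert card_components_insert[OF assms(1) e(2,3), of F] unfolding e(1)
      by (cases "b \<in> component F a") auto
  qed simp
qed


lemma components_eq_singleton_iff:
  assumes "finite V" "V \<noteq> {}" "F \<subseteq> edges V"
  shows "conn_components V F = {V} \<longleftrightarrow> card (conn_components V F) = 1"
  using components_Union[OF assms(3)] by (auto simp: card_1_singleton_iff)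

section \<open>Kruskal's characterisation of the minimum spanning tree\<close>

text \<open>The edge is unordered, hence the quantification over both ways of writing it; symmetry
  of components makes either one sufficient.\<close>

definition crosses :: "nat set set \<Rightarrow> nat set \<Rightarrow> bool" where
  "crosses F e \<longleftrightarrow> (\<forall>u v. e = {u, v} \<longrightarrow> v \<notin> component F u)"

text \<open>The output of Kruskal's algorithm without the algorithm. The test for an edge refers
  only to strictly lighter edges, so it can be evaluated at the arrival time of that edge, as the
  arrival formula requires.\<close>

definition kruskal :: "(nat set \<Rightarrow> real) \<Rightarrow> nat set set \<Rightarrow> nat set set" where
  "kruskal x F = {e \<in> F. crosses {f \<in> F. x f < x e} e}"

lemma crosses_doubleton: "crosses F {u, v} \<longleftrightarrow> v \<notin> component F u"
  unfolding crosses_def using in_component_sym by (fastforce simp: doubleton_eq_iff)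

lemma doubleton_in_kruskal:
  "{u, v} \<in> kruskal x F \<longleftrightarrow> {u, v} \<in> F \<and> v \<notin> component {f \<in> F. x f < x {u, v}} u"
  by (simp add: kruskal_def crosses_doubleton)

lemma kruskal_subset: "kruskal x F \<subseteq> F"
  by (auto simp: kruskal_def)

text \<open>The test for an edge never looks at heavier edges, so it does not matter whether the
  weights are cut at \<open>t\<close> before or after. Thus the tree edges present at time
  \<open>t\<close> depend only on the graph at time \<open>t\<close> and its weights.\<close>

lemma kruskal_below: "kruskal x {f \<in> F. x f < t} = {e \<in> kruskal x F. x e < t}"
proof -
  have "{f \<in> {f \<in> F. x f < t}. x f < x e} = {f \<in> F. x f < x e}" if "x e < t" for e
    using that by auto
  then show ?thesis unfolding kruskal_def by (auto simp del: mem_Collect_eq)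
qed

text \<open>The recursive step of the algorithm: a new heaviest edge leaves all earlier decisions
  untouched.\<close>

lemma kruskal_insert_max:
  assumes "\<And>f. f \<in> F \<Longrightarrow> x f < x {a, b}"
  shows "kruskal x (insert {a, b} F)
     = (if b \<in> component F a then kruskal x F else insert {a, b} (kruskal x F))"
proof -
  have less: "{g \<in> insert {a, b} F. x g < x f} = {g \<in> F. x g < x f}" if "f \<in> F" for f
    using assms[OF that] by auto
  have F: "{g \<in> insert {a, b} F. x g < x {a, b}} = F"
    using assms by auto
  have "kruskal x (insert {a, b} F) = {f. f = {a, b} \<and> crosses F f} \<union> {f \<in> F. crosses {g \<in> F. x g < x f} f}"
  proof (rule set_eqI)
    fix f
    show "f \<in> kruskal x (insert {a, b} F)
       \<longleftrightarrow> f \<in> {f. f = {a, b} \<and> crosses F f} \<union> {f \<in> F. crosses {g \<in> F. x g < x f} f}"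
    proof (cases "f \<in> F")
      case True
      then have "f \<noteq> {a, b}" using assms by blast
      with True show ?thesis unfolding kruskal_def using less[OF True] by simp
    next
      case False
      then show ?thesis unfolding kruskal_def using F by auto
    qed
  qed
  then show ?thesis unfolding kruskal_def by (auto simp: crosses_doubleton)
qed

lemma degree_in_insert:
  assumes "finite F" "e \<notin> F"
  shows "degree_in (insert e F) v = degree_in F v + of_bool (v \<in> e)"
proof -
  have "{f \<in> insert e F. v \<in> f} = (if v \<in> e then insert e {f \<in> F. v \<in> f} else {f \<in> F. v \<in> f})"
    by auto
  then show ?thesis using assms by (simp add: degree_in_def)
qed

lemma component_invariant:
  assumes "\<And>u v. {u, v} \<in> F \<Longrightarrow> g u = g v" "v \<in> component F u"
  shows "g v = g u"
proof -
  have "component F u \<subseteq> {w. g w = g u}"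
    by (rule closed_component_subset) (use assms(1) in auto)
  then show ?thesis using assms(2) by blast
qed

text \<open>Adding the heaviest edge either closes a cycle, and then nothing changes, or merges two
  components \<open>A\<close>, \<open>B\<close>, and then \<open>\<Sum>v\<in>V. g v / card (component F v)\<close>, which counts components with
  weight \<open>g\<close>, drops by the common value of \<open>g\<close> on \<open>A \<union> B\<close>.\<close>

lemma sum_degree_kruskal:
  fixes g :: "nat \<Rightarrow> real"
  assumes "finite V" "F \<subseteq> edges V" "inj_on x F" "\<And>u v. {u, v} \<in> F \<Longrightarrow> g u = g v"
  shows "(\<Sum>v\<in>V. g v * degree_in (kruskal x F) v) = 2 * (\<Sum>v\<in>V. g v * (1 - 1 / card (component F v)))"
proof -
  have "finite F" using assms(1,2) finite_edges finite_subset by blast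
  then show ?thesis using assms(2-)
  \<comment> \<open>Edges enter in increasing order of weight. The induction rule does not exclude
    that the new edge is already present, hence the trivial case.\<close>
  proof (induction F rule: finite_ranking_induct[where f = x])
    case empty
    then show ?case by (simp add: kruskal_def degree_in_def)
  next
    case (insert e F)
    show ?case
    proof (cases "e \<in> F")
      case True
      then show ?thesis using insert.IH insert.prems by (simp add: insert_absorb)
    next
      case notin: False
    have sub: "F \<subseteq> edges V" using insert by auto
    from insert obtain a b where e: "e = {a, b}" "a \<in> V" "b \<in> V" "a \<noteq> b" by (auto elim: edgesE)
    have IH: "(\<Sum>v\<in>V. g v * degree_in (kruskal x F) v) = 2 * (\<Sum>v\<in>V. g v * (1 - 1 / card (component F v)))"
      using insert.IH[OF sub] insert.prems(2,3) by (simp add: inj_on_insert)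
    have less: "x f < x {a, b}" if "f \<in> F" for f
    proof -
      have "x f \<le> x e" "f \<noteq> e" using insert.hyps(2) notin that by auto
      moreover from this have "x f \<noteq> x e" using insert.prems(2) that by (auto simp: inj_on_def)
      ultimately show ?thesis using e(1) by simp
    qed
    have kr: "kruskal x (insert {a, b} F)
        = (if b \<in> component F a then kruskal x F else insert {a, b} (kruskal x F))"
      by (rule kruskal_insert_max) (rule less)
    show ?thesis
    proof (cases "b \<in> component F a")
      case True
      then show ?thesis
        using IH kr component_insert_same[OF True] by (simp add: e)
    next
      case False
      let ?A = "component F a" and ?B = "component F b" and ?G = "insert {a, b} F"
      have disj: "?A \<inter> ?B = {}"
        using False by (metis Int_emptyI in_component_trans in_component_sym)
      have AB: "?A \<subseteq> V" "?B \<subseteq> V" using component_subset sub e by auto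
      then have fin: "finite ?A" "finite ?B" using assms(1) finite_subset by auto
      have pos: "card ?A > 0" "card ?B > 0" using card_component[OF assms(1) sub] e by auto
      \<comment> \<open>\<open>g\<close> is constant along the edges of the enlarged graph, the new
        one included, so it has a single value on the merged component.\<close>
      have gab: "g v = g a" if "v \<in> ?A \<union> ?B" for v
      proof -
        have "v \<in> component ?G a" using that by (simp add: component_insert)
        then show ?thesis using insert.prems(3) e(1) component_invariant by blast
      qed
      have fin_k: "finite (kruskal x F)" "{a, b} \<notin> kruskal x F"
        using insert.hyps(1) notin kruskal_subset[of x F] finite_subset e by auto
      have deg: "real (degree_in (kruskal x ?G) v) = real (degree_in (kruskal x F) v) + ((of_bool (v = a) :: real) + of_bool (v = b))" for v
        using kr False degree_in_insert[OF fin_k] e(4) by auto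
      have "(\<Sum>v\<in>V. g v * degree_in (kruskal x ?G) v)
          = (\<Sum>v\<in>V. g v * degree_in (kruskal x F) v) + ((\<Sum>v\<in>V. g v * of_bool (v = a)) + (\<Sum>v\<in>V. g v * of_bool (v = b)))"
        by (simp only: deg distrib_left sum.distrib)
      also have "\<dots> = (\<Sum>v\<in>V. g v * degree_in (kruskal x F) v) + 2 * g a"
        using e assms(1) gab[of b] by simp
      finally have lhs: "(\<Sum>v\<in>V. g v * degree_in (kruskal x ?G) v)
          = (\<Sum>v\<in>V. g v * degree_in (kruskal x F) v) + 2 * g a" .
      have split: "sum f V = sum f ?A + sum f ?B + sum f (V - (?A \<union> ?B))" for f :: "nat \<Rightarrow> real"
        using sum.subset_diff[of "?A \<union> ?B" V f] sum.union_disjoint[OF fin disj, of f] AB assms(1) by auto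
      let ?h = "\<lambda>F v. g v * (1 - 1 / card (component F v))"
      have rest: "sum (?h ?G) (V - (?A \<union> ?B)) = sum (?h F) (V - (?A \<union> ?B))"
        by (rule sum.cong) (auto simp: component_insert)
      have hF: "sum (?h F) ?A = g a * (real (card ?A) - 1)" "sum (?h F) ?B = g a * (real (card ?B) - 1)"
      proof -
        have "sum (?h F) ?A = (\<Sum>v\<in>?A. g a * (1 - 1 / card ?A))"
        proof (rule sum.cong[OF refl])
          fix v assume v: "v \<in> ?A"
          then have "component F v = ?A" by (simp only: component_eq_iff)
          then show "?h F v = g a * (1 - 1 / card ?A)" using gab[of v] v by simp
        qed
        also have "\<dots> = g a * (real (card ?A) - 1)" using pos by (simp add: field_simps)
        finally show "sum (?h F) ?A = g a * (real (card ?A) - 1)" .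
        have "sum (?h F) ?B = (\<Sum>v\<in>?B. g a * (1 - 1 / card ?B))"
        proof (rule sum.cong[OF refl])
          fix v assume v: "v \<in> ?B"
          then have "component F v = ?B" by (simp only: component_eq_iff)
          then show "?h F v = g a * (1 - 1 / card ?B)" using gab[of v] v by simp
        qed
        also have "\<dots> = g a * (real (card ?B) - 1)" using pos by (simp add: field_simps)
        finally show "sum (?h F) ?B = g a * (real (card ?B) - 1)" .
      qed
      have cAB: "card (?A \<union> ?B) = card ?A + card ?B" using fin disj by (simp add: card_Un_disjoint)
      have "sum (?h ?G) (?A \<union> ?B) = (\<Sum>v\<in>?A \<union> ?B. g a * (1 - 1 / (real (card ?A) + card ?B)))"
      proof (rule sum.cong[OF refl])
        fix v assume v: "v \<in> ?A \<union> ?B"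
        then have "component ?G v = ?A \<union> ?B" by (simp only: component_insert if_True)
        then show "?h ?G v = g a * (1 - 1 / (real (card ?A) + card ?B))" using gab[OF v] cAB by simp
      qed
      also have "\<dots> = (real (card ?A) + card ?B) * (g a * (1 - 1 / (real (card ?A) + card ?B)))"
        by (simp add: cAB)
      also have "\<dots> = g a * (real (card ?A) + card ?B - 1)" using pos by (simp add: field_simps)
      finally have hG: "sum (?h ?G) ?A + sum (?h ?G) ?B = g a * (real (card ?A) + card ?B - 1)"
        using fin disj by (simp add: sum.union_disjoint)
      have "sum (?h ?G) V = sum (?h F) V + g a"
        unfolding split rest hF hG by (simp add: algebra_simps)
      then show ?thesis using lhs IH by (simp add: e)
    qed
  qed
  qed
qed

section \<open>Spanning trees and exchange arguments\<close>

lemma connected_on_iff: "connected_on V F \<longleftrightarrow> (\<forall>u\<in>V. \<forall>v\<in>V. v \<in> component F u)"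
  by (simp add: connected_on_def in_component)

lemma connected_on_mono: "connected_on V F \<Longrightarrow> F \<subseteq> G \<Longrightarrow> connected_on V G"
  unfolding connected_on_iff using component_mono by blast

lemma connected_on_insert_same:
  assumes "connected_on V (insert {a, b} F)" "b \<in> component F a"
  shows "connected_on V F"
  using assms by (simp add: connected_on_iff component_insert_same)

text \<open>The closing edge of the cycle works: the remaining edges form a path between its
  ends.\<close>

lemma is_cycle_edge:
  assumes "is_cycle F p"
  obtains u v where "{u, v} \<in> F" "v \<in> component (F - {{u, v}}) u"
proof -
  let ?k = "length p - 1"
  let ?e = "{p ! 0, p ! ?k}"
  have p: "3 \<le> length p" "distinct p" "\<And>i. i < length p \<Longrightarrow> {p ! i, p ! (Suc i mod length p)} \<in> F"
    using assms unfolding is_cycle_def by auto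
  have "Suc ?k = length p" using p(1) by simp
  with p(3)[of ?k] p(1) have e: "?e \<in> F" by (simp add: insert_commute)
  have "i \<le> ?k \<Longrightarrow> p ! i \<in> component (F - {?e}) (p ! 0)" for i
  proof (induction i)
    case (Suc i)
    then have "{p ! i, p ! Suc i} \<in> F" using p(3)[of i] p(1) by simp
    \<comment> \<open>With at least three distinct vertices, no step of the path is the closing
      edge.\<close>
    moreover have "{p ! i, p ! Suc i} \<noteq> ?e"
    proof
      assume "{p ! i, p ! Suc i} = ?e"
      then have "(p ! i = p ! 0 \<and> p ! Suc i = p ! ?k) \<or> (p ! i = p ! ?k \<and> p ! Suc i = p ! 0)"
        by (auto simp: doubleton_eq_iff)
      moreover have "i < length p" "Suc i < length p" "?k < length p" "0 < length p" using Suc.prems p(1) by linarith+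
      ultimately have "(i = 0 \<and> Suc i = ?k) \<or> Suc i = 0" using p(2) nth_eq_iff_index_eq by blast
      then show False using p(1) by auto
    qed
    ultimately have "component (F - {?e}) (p ! i) = component (F - {?e}) (p ! Suc i)"
      by (intro edge_component) auto
    then show ?case using Suc by (metis Suc_leD component_eq_iff)
  qed simp
  then show ?thesis using e that[of "p ! 0" "p ! ?k"] by simp
qed

text \<open>Delete cycle edges one at a time; each deletion preserves connectedness.\<close>

lemma connected_on_imp_spanning_tree:
  assumes "finite F" "F \<subseteq> complete_edges n" "connected_on {1..n} F"
  shows "\<exists>T\<subseteq>F. spanning_tree n T"
  using assms
proof (induction F rule: finite_psubset_induct)
  case (psubset F)
  show ?case
  proof (cases "\<exists>p. is_cycle F p")
    case False
    then show ?thesis using psubset.prems unfolding spanning_tree_def by blast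
  next
    case True
    then obtain u v where uv: "{u, v} \<in> F" "v \<in> component (F - {{u, v}}) u"
      using is_cycle_edge by blast
    then have "insert {u, v} (F - {{u, v}}) = F" by auto
    then have "connected_on {1..n} (F - {{u, v}})"
      using connected_on_insert_same[OF _ uv(2)] psubset.prems by simp
    then obtain T where "T \<subseteq> F - {{u, v}}" "spanning_tree n T"
      using psubset.IH[of "F - {{u, v}}"] psubset.prems uv(1) by blast
    then show ?thesis by blast
  qed
qed

lemma finite_complete_edges [simp]: "finite (complete_edges n)"
  by (simp add: complete_edges_eq)

lemma finite_spanning_trees: "finite {T. spanning_tree n T}"
  by (rule finite_subset[of _ "Pow (complete_edges n)"]) (auto simp: spanning_tree_def)


lemma complete_edges_connected: "connected_on {1..n} (complete_edges n)"
  unfolding connected_on_iff complete_edges_eq by (simp add: component_complete)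

lemma is_mst_mst: "is_mst n x (mst n x)"
proof -
  obtain T0 where "spanning_tree n T0"
    using connected_on_imp_spanning_tree[OF finite_complete_edges order_refl complete_edges_connected] by blast
  then obtain T where "is_arg_min (sum x) (\<lambda>T. T \<in> {T. spanning_tree n T}) T"
    using ex_is_arg_min_if_finite[OF finite_spanning_trees, of n "sum x"] by blast
  then have "is_mst n x T" unfolding is_mst_def is_arg_min_linorder by auto
  then show ?thesis unfolding mst_def by (rule someI)
qed

text \<open>Positive weights let a connected set be thinned to a spanning tree without raising its
  total. The exchange arguments therefore only have to check connectedness of the modified set,
  never acyclicity.\<close>

lemma is_mst_le_connected:
  assumes "is_mst n x T" "F \<subseteq> complete_edges n" "connected_on {1..n} F"
    and "\<And>e. e \<in> complete_edges n \<Longrightarrow> 0 < x e"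
  shows "sum x T \<le> sum x F"
proof -
  have fin: "finite F" using assms(2) finite_complete_edges finite_subset by blast
  obtain T' where T': "T' \<subseteq> F" "spanning_tree n T'"
    using connected_on_imp_spanning_tree[OF fin assms(2,3)] by blast
  have "sum x T \<le> sum x T'" using assms(1) T'(2) unfolding is_mst_def by blast
  also have "\<dots> \<le> sum x F" using T'(1) fin assms(2,4) by (intro sum_mono2) (auto intro: less_imp_le)
  finally show ?thesis .
qed

text \<open>Exchange along the tree path: if \<open>e\<close> were missing from \<open>T\<close>,
  the path in \<open>T\<close> between its ends would contain an edge \<open>f\<close> not lighter
  than \<open>e\<close>. By minimality, swapping \<open>f\<close> for \<open>e\<close> cannot lower
  the total, so the two weights are equal, against distinctness.\<close>

lemma kruskal_subset_mst:
  assumes "inj_on x (complete_edges n)" "\<And>e. e \<in> complete_edges n \<Longrightarrow> 0 < x e" "is_mst n x T"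
  shows "kruskal x (complete_edges n) \<subseteq> T"
proof
  fix e assume e: "e \<in> kruskal x (complete_edges n)"
  have E: "e \<in> complete_edges n" using e kruskal_subset by auto
  then obtain u v where uv: "e = {u, v}" "u \<in> {1..n}" "v \<in> {1..n}" unfolding complete_edges_eq by (auto elim: edgesE)
  let ?H = "{f \<in> complete_edges n. x f < x e}"
  have nc: "v \<notin> component ?H u" using e unfolding uv(1) by (simp add: doubleton_in_kruskal)
  have T: "T \<subseteq> complete_edges n" "connected_on {1..n} T"
    using assms(3) unfolding is_mst_def spanning_tree_def by auto
  have finT: "finite T" using T(1) finite_complete_edges finite_subset by blast
  show "e \<in> T"
  proof (rule ccontr)
    assume "e \<notin> T"
    \<comment> \<open>An inclusion-minimal subset of \<open>T\<close> joining \<open>u\<close> and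
      \<open>v\<close> plays the role of the tree path.\<close>
    let ?S = "{F. F \<subseteq> T \<and> v \<in> component F u}"
    have "T \<in> ?S" using T(2) uv unfolding connected_on_iff by auto
    moreover have "finite ?S" using finT by simp
    ultimately obtain F where F: "F \<in> ?S" "\<And>F'. F' \<in> ?S \<Longrightarrow> F' \<subseteq> F \<Longrightarrow> F = F'"
      using finite_has_minimal[of ?S] by (metis (no_types, lifting) empty_iff)
    \<comment> \<open>Edges lighter than \<open>e\<close> do not join \<open>u\<close> and
      \<open>v\<close>, so the path contains some edge at least as heavy as
      \<open>e\<close>.\<close>
    have "\<not> F \<subseteq> ?H" using F(1) nc component_mono by blast
    then obtain f where f: "f \<in> F" "f \<notin> ?H" by blast
    then have "f \<in> T" "f \<in> complete_edges n" using F(1) T(1) by auto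
    then obtain a b where ab: "f = {a, b}" unfolding complete_edges_eq by (auto elim: edgesE)
    let ?F = "F - {f}" and ?G = "insert e (T - {f})"
    have F': "insert {a, b} ?F = F" using f ab by auto
    have "v \<notin> component ?F u" using F(1) F(2)[of ?F] f(1) by auto
    with F(1) F' have uvab: "u \<in> component ?F a \<union> component ?F b" "v \<in> component ?F a \<union> component ?F b"
      using component_insert[of a b ?F u] by (auto split: if_splits)
    have sub: "component ?F w \<subseteq> component ?G w" for w
      by (rule component_mono) (use F(1) in auto)
    have GG: "component ?G u = component ?G v" by (rule edge_component) (simp add: uv)
    have "b \<in> component ?G a"
    proof -
      have "\<not> (u \<in> component ?F a \<and> v \<in> component ?F a)" "\<not> (u \<in> component ?F b \<and> v \<in> component ?F b)"
        using \<open>v \<notin> component ?F u\<close> component_eq_iff by metis+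
      with uvab consider "u \<in> component ?F a" "v \<in> component ?F b" | "v \<in> component ?F a" "u \<in> component ?F b"
        by blast
      then show ?thesis using sub GG by cases (metis component_eq_iff subsetD)+
    qed
    moreover have "connected_on {1..n} (insert {a, b} ?G)"
      by (rule connected_on_mono[OF T(2)]) (use ab in auto)
    ultimately have "connected_on {1..n} ?G" using connected_on_insert_same by blast
    moreover have "?G \<subseteq> complete_edges n" using T(1) E by auto
    ultimately have "sum x T \<le> sum x ?G" using is_mst_le_connected assms(2,3) by blast
    also have "\<dots> = x e + (sum x T - x f)"
      using finT \<open>e \<notin> T\<close> \<open>f \<in> T\<close> by (simp add: sum_diff1)
    finally have "x f \<le> x e" by simp
    moreover have "x e \<le> x f" using f(2) \<open>f \<in> complete_edges n\<close> by auto
    ultimately have "e = f" using assms(1) E \<open>f \<in> complete_edges n\<close> by (simp add: inj_on_eq_iff)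
    then show False using \<open>e \<notin> T\<close> \<open>f \<in> T\<close> by simp
  qed
qed

text \<open>Cut argument: removing \<open>e\<close> splits \<open>T\<close>, since a connected
  remainder would be cheaper. If lighter edges joined the ends of \<open>e\<close>, one of them
  would leave the side of \<open>u\<close> and could replace \<open>e\<close> at a smaller
  total.\<close>

lemma mst_subset_kruskal:
  assumes "\<And>e. e \<in> complete_edges n \<Longrightarrow> 0 < x e" "is_mst n x T"
  shows "T \<subseteq> kruskal x (complete_edges n)"
proof
  fix e assume eT: "e \<in> T"
  have T: "T \<subseteq> complete_edges n" "connected_on {1..n} T"
    using assms(2) unfolding is_mst_def spanning_tree_def by auto
  have finT: "finite T" using T(1) finite_complete_edges finite_subset by blast
  from eT T(1) obtain u v where uv: "e = {u, v}" "u \<in> {1..n}" "v \<in> {1..n}"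
    unfolding complete_edges_eq by (blast elim: edgesE)
  let ?H = "{f \<in> complete_edges n. x f < x e}" and ?T = "T - {e}"
  have T': "insert {u, v} ?T = T" using eT uv by auto
  have nT: "v \<notin> component ?T u"
  proof
    assume "v \<in> component ?T u"
    then have "connected_on {1..n} ?T" using T' T(2) connected_on_insert_same by metis
    then have "sum x T \<le> sum x ?T" using is_mst_le_connected[OF assms(2), of ?T] T(1) assms(1) by blast
    then have "x e \<le> 0" using finT eT by (simp add: sum_diff1)
    then show False using assms(1)[of e] eT T(1) by force
  qed
  have "v \<notin> component ?H u"
  proof
    assume v: "v \<in> component ?H u"
    let ?A = "component ?T u"
    have "\<exists>a b. {a, b} \<in> ?H \<and> a \<in> ?A \<and> b \<notin> ?A"
    proof (rule ccontr)
      assume "\<not> ?thesis"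
      then have "component ?H u \<subseteq> ?A" by (intro closed_component_subset) auto
      then show False using v nT by blast
    qed
    then obtain a b where ab: "{a, b} \<in> ?H" "a \<in> ?A" "b \<notin> ?A" by blast
    let ?G = "insert {a, b} ?T"
    have "b \<in> {1..n}" using ab(1) by (auto simp: complete_edges_eq)
    then have "b \<in> component (insert {u, v} ?T) u" using T(2) uv T' by (simp add: connected_on_iff)
    then have b: "b \<in> component ?T v" using ab(3) by (simp add: component_insert)
    have sub: "component ?T w \<subseteq> component ?G w" for w by (rule component_mono) auto
    have "component ?G a = component ?G b" by (rule edge_component) simp
    then have "v \<in> component ?G u" using sub ab(2) b by (metis component_eq_iff subsetD)
    moreover have "connected_on {1..n} (insert {u, v} ?G)"
      by (rule connected_on_mono[OF T(2)]) (use T' in auto)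
    ultimately have "connected_on {1..n} ?G" using connected_on_insert_same by blast
    then have "sum x T \<le> sum x ?G"
      using is_mst_le_connected[OF assms(2), of ?G] T(1) assms(1) ab(1) by blast
    also have "{a, b} \<notin> ?T" using ab(2,3) edge_component component_eq_iff by metis
    then have "sum x ?G = x {a, b} + (sum x T - x e)"
      using finT eT by (simp add: sum_diff1)
    finally show False using ab(1) by simp
  qed
  then show "e \<in> kruskal x (complete_edges n)"
    using eT T(1) unfolding uv(1) by (auto simp: doubleton_in_kruskal)
qed

lemma mst_eq_kruskal:
  assumes "inj_on x (complete_edges n)" "\<And>e. e \<in> complete_edges n \<Longrightarrow> 0 < x e"
  shows "mst n x = kruskal x (complete_edges n)"
proof
  show "mst n x \<subseteq> kruskal x (complete_edges n)"
    by (rule mst_subset_kruskal[OF _ is_mst_mst]) (rule assms(2))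
  show "kruskal x (complete_edges n) \<subseteq> mst n x"
    by (rule kruskal_subset_mst[OF assms is_mst_mst])
qed

section \<open>Counting forests\<close>

text \<open>Double counting of incidences: \<open>v\<close> lies on exactly
  \<open>card V - card (component F v)\<close> edges leaving its component. Used with
  \<open>h\<close> constant one, with the reciprocal component order, and with tree degrees.\<close>

lemma crosses_edge_sum:
  fixes h :: "nat \<Rightarrow> real"
  assumes "finite V" "F \<subseteq> edges V"
  shows "(\<Sum>e | e \<in> edges V \<and> crosses F e. \<Sum>v\<in>e. h v)
    = (\<Sum>v\<in>V. h v * (real (card V) - card (component F v)))"
proof -
  let ?S = "{e \<in> edges V. crosses F e}"
  have fin: "finite ?S" using assms(1) by simp
  have "(\<Sum>e\<in>?S. \<Sum>v\<in>e. h v) = (\<Sum>e\<in>?S. \<Sum>v | v \<in> V \<and> v \<in> e. h v)"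
    using edges_subset_Pow by (intro sum.cong refl arg_cong2[where f = sum]) auto
  also have "\<dots> = (\<Sum>v\<in>V. \<Sum>e | e \<in> ?S \<and> v \<in> e. h v)"
    by (rule sum.swap_restrict[OF fin assms(1)])
  also have "\<dots> = (\<Sum>v\<in>V. h v * (real (card V) - card (component F v)))"
  proof (rule sum.cong[OF refl])
    fix v assume v: "v \<in> V"
    have "{e. e \<in> ?S \<and> v \<in> e} = (\<lambda>u. {v, u}) ` (V - component F v)"
    proof (intro set_eqI iffI)
      fix e assume e: "e \<in> {e. e \<in> ?S \<and> v \<in> e}"
      then obtain a b where ab: "e = {a, b}" "a \<in> V" "b \<in> V" by (auto elim: edgesE)
      with e obtain u where "e = {v, u}" "u \<in> V" by auto
      with e show "e \<in> (\<lambda>u. {v, u}) ` (V - component F v)" by (auto simp: crosses_doubleton)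
    next
      fix e assume "e \<in> (\<lambda>u. {v, u}) ` (V - component F v)"
      then obtain u where u: "e = {v, u}" "u \<in> V" "u \<notin> component F v" by blast
      then have "u \<noteq> v" by (metis component_refl)
      with u v show "e \<in> {e. e \<in> ?S \<and> v \<in> e}" by (auto simp: crosses_doubleton)
    qed
    moreover have "inj_on (\<lambda>u. {v, u}) (V - component F v)"
      by (auto simp: inj_on_def doubleton_eq_iff)
    moreover have "component F v \<subseteq> V" using component_subset[OF assms(2) v] .
    then have "real (card (V - component F v)) = real (card V) - card (component F v)"
      using assms(1) by (simp add: card_Diff_subset card_mono finite_subset of_nat_diff)
    ultimately show "(\<Sum>e | e \<in> ?S \<and> v \<in> e. h v) = h v * (real (card V) - card (component F v))"
      by (simp add: card_image)
  qed
  finally show ?thesis by simp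
qed

text \<open>Both sides are the sum of \<open>card V - card A\<close> over the components
  \<open>A\<close>.\<close>

lemma sum_card_diff_over_card:
  assumes "finite V" "F \<subseteq> edges V"
  shows "(\<Sum>v\<in>V. (real (card V) - card (component F v)) / card (component F v))
    = real (card V) * (real (card (conn_components V F)) - 1)"
proof -
  have "(\<Sum>A\<in>conn_components V F. real (card A)) = card V"
    using sum_card_components[OF assms] by (metis of_nat_sum)
  then show ?thesis
    using sum_inverse_card_component[OF assms, of "\<lambda>A. real (card V) - card A"]
    by (simp add: sum_subtractf algebra_simps)
qed

text \<open>Acyclicity is encoded by counting: \<open>m\<close> edges leave at least
  \<open>card V - m\<close> components, with equality exactly if every edge is needed for connecting
  its ends. For nonempty \<open>V\<close> and \<open>m = card V - 1\<close> these are the trees on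
  \<open>V\<close>.\<close>

definition forests :: "nat set \<Rightarrow> nat \<Rightarrow> nat set set set" where
  "forests V m = {F. F \<subseteq> edges V \<and> card F = m \<and> m + card (conn_components V F) = card V}"

abbreviation labelled_trees :: "nat set \<Rightarrow> nat set set set" where
  "labelled_trees V \<equiv> forests V (card V - 1)"

lemma finite_forests [simp]: "finite V \<Longrightarrow> finite (forests V m)"
  by (rule finite_subset[of _ "Pow (edges V)"]) (auto simp: forests_def)

lemma forests_0 [simp]: "finite V \<Longrightarrow> forests V 0 = {{}}"
  by (auto simp: forests_def dest: finite_subset[OF _ finite_edges])

text \<open>Deleting an edge must gain a component, since otherwise the remaining \<open>m\<close>
  edges would leave fewer than \<open>card V - m\<close> components.\<close>

lemma forest_delete:
  assumes "finite V" "F \<in> forests V (Suc m)" "e \<in> F"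
  shows "F - {e} \<in> forests V m" "crosses (F - {e}) e"
proof -
  let ?F = "F - {e}"
  have F: "F \<subseteq> edges V" "card F = Suc m" "Suc m + card (conn_components V F) = card V" "finite F"
    using assms unfolding forests_def by (auto intro: card_ge_0_finite)
  obtain a b where ab: "e = {a, b}" "a \<in> V" "b \<in> V" using F(1) assms(3) by (blast elim: edgesE)
  have ins: "insert {a, b} ?F = F" using assms(3) ab by auto
  have c: "card ?F = m" using F assms(3) by simp
  have "card V \<le> m + card (conn_components V ?F)"
    using card_le_card_components[OF assms(1), of ?F] F(1) c by auto
  moreover have "card (conn_components V ?F) = card (conn_components V F) + of_bool (b \<notin> component ?F a)"
    using card_components_insert[OF assms(1) ab(2,3), of ?F] ins by simp
  ultimately have "b \<notin> component ?F a" "m + card (conn_components V ?F) = card V"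
    using F(3) by (auto split: if_splits simp: of_bool_def)
  then show "?F \<in> forests V m" "crosses ?F e"
    using F(1) c unfolding ab(1) crosses_doubleton forests_def by auto
qed

lemma forest_insert:
  assumes "finite V" "F \<in> forests V m" "e \<in> edges V" "crosses F e"
  shows "e \<notin> F" "insert e F \<in> forests V (Suc m)"
proof -
  obtain a b where ab: "e = {a, b}" "a \<in> V" "b \<in> V" using assms(3) by (blast elim: edgesE)
  have nb: "b \<notin> component F a" using assms(4) by (simp add: ab crosses_doubleton)
  have F: "F \<subseteq> edges V" "card F = m" "m + card (conn_components V F) = card V"
    using assms(2) unfolding forests_def by auto
  have "finite F" using F(1) assms(1) finite_edges finite_subset by blast
  show e: "e \<notin> F" using nb edge_component[of a b F] component_refl[of b F] by (auto simp: ab)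
  have "card (conn_components V F) = Suc (card (conn_components V (insert e F)))"
    using card_components_insert[OF assms(1) ab(2,3), of F] nb by (simp add: ab)
  then show "insert e F \<in> forests V (Suc m)"
    using F e \<open>finite F\<close> assms(3) unfolding forests_def by simp
qed

text \<open>The number of ways to choose one root in each component, that is, the number of rooted
  forests with edge set \<open>F\<close>.\<close>

definition rootings :: "nat set \<Rightarrow> nat set set \<Rightarrow> real" where
  "rootings V F = (\<Prod>A\<in>conn_components V F. real (card A))"

text \<open>Merging components of orders \<open>p\<close> and \<open>q\<close> replaces the factor
  \<open>p q\<close> by \<open>p + q\<close>, and \<open>(p + q) / (p q) = 1 / p + 1 / q\<close> is
  a sum over the two endpoints, to which \<open>crosses_edge_sum\<close> applies.\<close>

lemma rootings_insert:
  assumes "finite V" "F \<subseteq> edges V" "e \<in> edges V" "crosses F e"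
  shows "rootings V (insert e F) = rootings V F * (\<Sum>v\<in>e. 1 / card (component F v))"
proof -
  obtain a b where ab: "e = {a, b}" "a \<in> V" "b \<in> V" "a \<noteq> b" using assms(3) by (blast elim: edgesE)
  let ?A = "component F a" and ?B = "component F b" and ?C = "conn_components V F"
  have nb: "b \<notin> ?A" using assms(4) by (simp add: ab crosses_doubleton)
  have ne: "?A \<noteq> ?B" using nb component_eq_iff by metis
  have disj: "?A \<inter> ?B = {}" by (rule components_disjoint[of ?A V F ?B]) (simp_all add: ab ne)
  have "?A \<subseteq> V" "?B \<subseteq> V" using component_subset[OF assms(2)] ab by auto
  then have fin: "finite ?A" "finite ?B" using assms(1) finite_subset by auto
  have notin: "?A \<union> ?B \<notin> ?C - {?A, ?B}"
  proof
    assume *: "?A \<union> ?B \<in> ?C - {?A, ?B}"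
    then have "component F a = ?A \<union> ?B" by (intro component_of_mem) auto
    with * show False by auto
  qed
  have "rootings V (insert e F) = real (card (?A \<union> ?B)) * (\<Prod>A\<in>?C - {?A, ?B}. real (card A))"
    unfolding rootings_def ab(1) components_insert[OF ab(2,3) nb]
    by (subst prod.insert) (use notin assms(1) in auto)
  moreover have "rootings V F = real (card ?A) * card ?B * (\<Prod>A\<in>?C - {?A, ?B}. real (card A))"
  proof -
    have "rootings V F = (\<Prod>A\<in>{?A, ?B}. real (card A)) * (\<Prod>A\<in>?C - {?A, ?B}. real (card A))"
      unfolding rootings_def using prod.subset_diff[of "{?A, ?B}" ?C] assms(1) ab by (simp add: mult.commute)
    then show ?thesis using ne by simp
  qed
  moreover have "card ?A > 0" "card ?B > 0" using card_component[OF assms(1,2)] ab by auto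
  moreover have "card (?A \<union> ?B) = card ?A + card ?B" using fin disj by (simp add: card_Un_disjoint)
  ultimately show ?thesis using ab(1,4) by (simp add: field_simps)
qed

text \<open>Pitman's double count of the pairs of a rooted forest and one of its edges, weighting each
  unrooted forest by its number of rootings.\<close>

lemma sum_rootings_Suc:
  assumes "finite V"
  shows "real (Suc m) * (\<Sum>F\<in>forests V (Suc m). rootings V F)
    = card V * (real (card V) - 1 - m) * (\<Sum>F\<in>forests V m. rootings V F)"
proof -
  let ?X = "\<lambda>F. {e \<in> edges V. crosses F e}"
  have fin: "finite F" if "F \<in> forests V k" for F k
    using that assms finite_edges finite_subset unfolding forests_def by blast
  have "real (Suc m) * (\<Sum>F\<in>forests V (Suc m). rootings V F)
      = (\<Sum>F\<in>forests V (Suc m). \<Sum>e\<in>F. rootings V F)"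
    unfolding sum_distrib_left by (rule sum.cong) (auto simp: forests_def)
  also have "\<dots> = (\<Sum>(F, e)\<in>(SIGMA F:forests V (Suc m). F). rootings V F)"
    using assms fin by (subst sum.Sigma) auto
  \<comment> \<open>A forest with a marked edge amounts to a forest with one edge fewer together
    with a crossing edge.\<close>
  also have "\<dots> = (\<Sum>(F, e)\<in>(SIGMA F:forests V m. ?X F). rootings V (insert e F))"
  proof (rule sum.reindex_bij_witness[of _ "\<lambda>(F, e). (insert e F, e)" "\<lambda>(F, e). (F - {e}, e)"])
    fix p assume "p \<in> (SIGMA F:forests V (Suc m). F)"
    then obtain F e where p: "p = (F, e)" "F \<in> forests V (Suc m)" "e \<in> F" by auto
    then show "(case case p of (F, e) \<Rightarrow> (F - {e}, e) of (F, e) \<Rightarrow> (insert e F, e)) = p"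
      and "(case case p of (F, e) \<Rightarrow> (F - {e}, e) of (F, e) \<Rightarrow> rootings V (insert e F))
         = (case p of (F, e) \<Rightarrow> rootings V F)"
      by (auto simp: insert_absorb)
    show "(case p of (F, e) \<Rightarrow> (F - {e}, e)) \<in> (SIGMA F:forests V m. ?X F)"
      using forest_delete[OF assms p(2,3)] p by (auto simp: forests_def)
  next
    fix p assume "p \<in> (SIGMA F:forests V m. ?X F)"
    then obtain F e where p: "p = (F, e)" "F \<in> forests V m" "e \<in> edges V" "crosses F e" by auto
    show "(case case p of (F, e) \<Rightarrow> (insert e F, e) of (F, e) \<Rightarrow> (F - {e}, e)) = p"
      and "(case p of (F, e) \<Rightarrow> (insert e F, e)) \<in> (SIGMA F:forests V (Suc m). F)"
      using forest_insert[OF assms p(2-4)] p by auto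
  qed
  also have "\<dots> = (\<Sum>F\<in>forests V m. \<Sum>e\<in>?X F. rootings V (insert e F))"
    using assms by (subst sum.Sigma) auto
  \<comment> \<open>Relative to the rootings of \<open>F\<close>, the inner sum depends on
    \<open>F\<close> only through \<open>m\<close>; this makes the recursion close up.\<close>
  also have "\<dots> = (\<Sum>F\<in>forests V m. card V * (real (card V) - 1 - m) * rootings V F)"
  proof (rule sum.cong[OF refl])
    fix F assume F: "F \<in> forests V m"
    then have sub: "F \<subseteq> edges V" and c: "real (card (conn_components V F)) = real (card V) - m"
      unfolding forests_def by auto
    have "(\<Sum>e\<in>?X F. rootings V (insert e F))
        = rootings V F * (\<Sum>e\<in>?X F. \<Sum>v\<in>e. 1 / card (component F v))"
      using rootings_insert[OF assms sub] by (simp add: sum_distrib_left)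
    also have "(\<Sum>e\<in>?X F. \<Sum>v\<in>e. 1 / card (component F v)) = card V * (real (card V) - 1 - m)"
      using crosses_edge_sum[OF assms sub, of "\<lambda>v. 1 / card (component F v)"]
        sum_card_diff_over_card[OF assms sub] c by simp
    finally show "(\<Sum>e\<in>?X F. rootings V (insert e F)) = card V * (real (card V) - 1 - m) * rootings V F"
      by simp
  qed
  finally show ?thesis by (simp add: sum_distrib_left)
qed

text \<open>The factor \<open>fact m\<close> accounts for the orders in which the \<open>m\<close>
  edges can be added.\<close>

lemma sum_rootings:
  assumes "finite V" "m < card V"
  shows "fact m * (\<Sum>F\<in>forests V m. rootings V F)
    = real (card V) ^ m * (\<Prod>j<m. real (card V) - 1 - real j)"
  using assms(2)
proof (induction m)
  case 0
  have "rootings V {} = 1"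
    unfolding rootings_def by (rule prod.neutral) (auto simp: components_empty)
  then show ?case using assms(1) by simp
next
  case (Suc m)
  have "fact (Suc m) * (\<Sum>F\<in>forests V (Suc m). rootings V F)
      = fact m * (real (Suc m) * (\<Sum>F\<in>forests V (Suc m). rootings V F))"
    by (simp only: fact_Suc mult_ac)
  also have "\<dots> = card V * (real (card V) - 1 - m) * (fact m * (\<Sum>F\<in>forests V m. rootings V F))"
    unfolding sum_rootings_Suc[OF assms(1)] by (simp only: mult_ac)
  also have "\<dots> = card V * (real (card V) - 1 - m) * (real (card V) ^ m * (\<Prod>j<m. real (card V) - 1 - real j))"
    using Suc by simp
  finally show ?case by (simp add: mult_ac)
qed

text \<open>At \<open>m = card V - 1\<close> every forest is a tree with \<open>card V\<close>
  rootings, which explains the factor on the left, and the falling product is \<open>fact m\<close>,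
  which cancels.\<close>

theorem card_labelled_trees_Cayley:
  assumes "finite V" "V \<noteq> {}"
  shows "real (card V) * card (labelled_trees V) = real (card V) ^ (card V - 1)"
proof -
  let ?m = "card V - 1"
  have n: "card V > 0" using assms by (simp add: card_gt_0_iff)
  have "rootings V F = card V" if "F \<in> labelled_trees V" for F
  proof -
    have F: "F \<subseteq> edges V" "card (conn_components V F) = 1" using that n unfolding forests_def by auto
    then have "conn_components V F = {V}" using components_eq_singleton_iff[OF assms F(1)] by simp
    then show ?thesis by (simp add: rootings_def)
  qed
  then have "(\<Sum>F\<in>labelled_trees V. rootings V F) = card V * card (labelled_trees V)" by simp
  moreover have "(\<Prod>j<?m. real (card V) - 1 - real j) = fact ?m"
  proof -
    have "(\<Prod>j<?m. real (card V) - 1 - real j) = (\<Prod>j<?m. real (?m - j))"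
      by (rule prod.cong) (use n in \<open>auto simp: of_nat_diff\<close>)
    also have "\<dots> = fact ?m" by (simp add: fact_prod_rev atLeast0LessThan)
    finally show ?thesis .
  qed
  ultimately have "fact ?m * (card V * real (card (labelled_trees V))) = real (card V) ^ ?m * fact ?m"
    using sum_rootings[OF assms(1), of ?m] n by simp
  then show ?thesis by simp
qed

section \<open>Spanning forests, and components containing a given tree\<close>

lemma spanning_forest:
  assumes "finite V" "F \<subseteq> edges V"
  obtains F0 m where "F0 \<subseteq> F" "F0 \<in> forests V m" "component F0 = component F"
proof -
  have "finite F" using assms finite_edges finite_subset by blast
  then have "\<exists>F0 m. F0 \<subseteq> F \<and> F0 \<in> forests V m \<and> component F0 = component F"
    using assms(2)
  proof induction
    case empty
    then show ?case using assms(1) by (intro exI[of _ "{}"] exI[of _ 0]) simp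
  next
    case (insert e F)
    then obtain F0 m where F0: "F0 \<subseteq> F" "F0 \<in> forests V m" "component F0 = component F" by auto
    obtain a b where ab: "e = {a, b}" using insert.prems by (blast elim: edgesE)
    show ?case
    proof (cases "b \<in> component F a")
      case True
      then have "component (insert e F) = component F0"
        using component_insert_same[OF True] F0(3) by (simp add: ab)
      moreover have "F0 \<subseteq> insert e F" using F0(1) by auto
      ultimately show ?thesis using F0(2) by (intro exI[of _ F0] exI[of _ m]) simp
    next
      case False
      then have "insert e F0 \<in> forests V (Suc m)"
        using forest_insert[OF assms(1) F0(2), of e] insert.prems F0(3) by (auto simp: ab crosses_doubleton)
      moreover have "component (insert e F0) = component (insert e F)"
        by (rule ext) (simp add: ab component_insert F0(3))
      moreover have "insert e F0 \<subseteq> insert e F" using F0(1) by auto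
      ultimately show ?thesis by (intro exI[of _ "insert e F0"] exI[of _ "Suc m"]) simp
    qed
  qed
  then show ?thesis using that by blast
qed

definition edge_boundary :: "nat set \<Rightarrow> nat set \<Rightarrow> nat set set" where
  "edge_boundary V A = (\<lambda>(u, v). {u, v}) ` (A \<times> (V - A))"

lemma edge_boundary_subset: "A \<subseteq> V \<Longrightarrow> edge_boundary V A \<subseteq> edges V"
  by (auto simp: edge_boundary_def)

lemma edges_Int_edge_boundary: "edges A \<inter> edge_boundary V A = {}"
  by (auto simp: edge_boundary_def)

lemma card_edge_boundary:
  assumes "finite V" "A \<subseteq> V"
  shows "card (edge_boundary V A) = card A * (card V - card A)"
proof -
  have "inj_on (\<lambda>(u, v). {u, v}) (A \<times> (V - A))"
    by (auto simp: inj_on_def doubleton_eq_iff)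
  then show ?thesis using assms
    unfolding edge_boundary_def by (simp add: card_image card_cartesian_product card_Diff_subset finite_subset)
qed

lemma card_edges:
  assumes "finite A"
  shows "card (edges A) = card A choose 2"
proof -
  have "edges A = {e. e \<subseteq> A \<and> card e = 2}"
    by (auto simp: edges_def card_2_iff)
  then show ?thesis using n_subsets[OF assms] by simp
qed

text \<open>A walk in \<open>S\<close> that starts in the component \<open>A\<close> uses only edges
  inside \<open>A\<close>.\<close>

lemma component_Int_edges:
  assumes "S \<subseteq> edges V" "A \<in> conn_components V S" "v \<in> A"
  shows "component (S \<inter> edges A) v = A"
proof
  show "component (S \<inter> edges A) v \<subseteq> A" using component_subset[OF _ assms(3)] by blast
  have A: "component S v = A" using component_of_mem assms(2,3) .
  have "component S v \<subseteq> component (S \<inter> edges A) v"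
  proof (rule closed_component_subset)
    fix a b assume ab: "{a, b} \<in> S" "a \<in> component (S \<inter> edges A) v"
    then have "a \<in> component S v" using component_mono[of "S \<inter> edges A" S] by blast
    moreover have "b \<in> component S a" using edge_component[OF ab(1)] by simp
    ultimately have "a \<in> A" "b \<in> A" using in_component_trans[of a S v b] unfolding A by auto
    moreover have "{a, b} \<in> edges V" using ab(1) assms(1) by blast
    then have "a \<noteq> b" by simp
    ultimately have "{a, b} \<in> S \<inter> edges A" using ab(1) by simp
    then have "b \<in> component (S \<inter> edges A) a" using edge_component[of a b] by simp
    then show "b \<in> component (S \<inter> edges A) v" using ab(2) in_component_trans by blast
  qed simp
  then show "A \<subseteq> component (S \<inter> edges A) v" using A by simp
qed

text \<open>A necessary condition for \<open>A\<close> to be a component in terms of the presence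
  and absence of fixed edges. Several trees may qualify, so it yields upper bounds for
  probabilities.\<close>

lemma component_has_tree:
  assumes "finite V" "S \<subseteq> edges V" "A \<in> conn_components V S"
  shows "\<exists>T\<in>labelled_trees A. T \<subseteq> S \<and> edge_boundary V A \<inter> S = {}"
proof -
  have A: "A \<subseteq> V" "A \<noteq> {}" "finite A"
    using components_subset[OF assms(2,3)] components_nonempty[OF assms(3)] assms(1) finite_subset by auto
  obtain T m where T: "T \<subseteq> S \<inter> edges A" "T \<in> forests A m" "component T = component (S \<inter> edges A)"
    using spanning_forest[of A "S \<inter> edges A"] A by blast
  have "conn_components A T = {A}"
    using component_Int_edges[OF assms(2,3)] A(2) unfolding conn_components_def T(3) by auto
  then have "m = card A - 1" using T(2) unfolding forests_def by auto
  moreover have "edge_boundary V A \<inter> S = {}"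
  proof -
    have False if "{a, b} \<in> S" "a \<in> A" "b \<notin> A" for a b
      using that component_of_mem[OF assms(3) that(2)] edge_component[OF that(1)] component_refl[of b S] by simp
    then show ?thesis by (auto simp: edge_boundary_def)
  qed
  ultimately show ?thesis using T by blast
qed

text \<open>Converse to \<open>component_has_tree\<close>: the tree connects \<open>A\<close> and
  the absent boundary isolates it.\<close>

lemma tree_component:
  assumes "A \<subseteq> V" "finite A" "A \<noteq> {}" "T \<in> labelled_trees A" "T \<subseteq> S" "edge_boundary V A \<inter> S = {}" "S \<subseteq> edges V"
  shows "A \<in> conn_components V S"
proof -
  have "card A > 0" using assms by (simp add: card_gt_0_iff)
  then have T: "T \<subseteq> edges A" "card (conn_components A T) = 1" using assms(4) unfolding forests_def by auto
  then have cT: "conn_components A T = {A}" using components_eq_singleton_iff[OF assms(2,3) T(1)] by simp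
  obtain v where v: "v \<in> A" using assms(3) by blast
  have "component T v = A" using component_of_mem[of A A T v] cT v by simp
  then have "A \<subseteq> component S v" using component_mono[OF assms(5)] by blast
  moreover have "component S v \<subseteq> A"
  proof (rule closed_component_subset[OF v])
    fix a b assume ab: "{a, b} \<in> S" "a \<in> A"
    show "b \<in> A"
    proof (rule ccontr)
      assume "b \<notin> A"
      moreover have "{a, b} \<in> edges V" using ab assms(7) by blast
      ultimately have "{a, b} \<in> edge_boundary V A"
        using ab(2) unfolding edge_boundary_def by (intro image_eqI[of _ _ "(a, b)"]) simp_all
      then show False using ab(1) assms(6) by blast
    qed
  qed
  ultimately have "component S v = A" by simp
  then show ?thesis using v assms(1) component_in_components by blast
qed

section \<open>Independent uniform edge weights\<close>

abbreviation unif :: "real measure" where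
  "unif \<equiv> uniform_measure lborel {0..1}"

abbreviation weights :: "nat set set \<Rightarrow> (nat set \<Rightarrow> real) measure" where
  "weights E \<equiv> PiM E (\<lambda>_. unif)"

text \<open>The inequality is strict so that an edge is still absent at its own arrival, in
  \<open>below E x (x e)\<close>.\<close>

definition below :: "nat set set \<Rightarrow> (nat set \<Rightarrow> real) \<Rightarrow> real \<Rightarrow> nat set set" where
  "below E x t = {e \<in> E. x e < t}"

lemma below_subset: "below E x t \<subseteq> E"
  by (auto simp: below_def)

lemma below_mono: "s \<le> t \<Longrightarrow> below E x s \<subseteq> below E x t"
  by (auto simp: below_def)

lemma prob_space_unif: "prob_space unif"
  by (rule prob_space_uniform_measure) auto

lemma product_prob_space_unif: "product_prob_space (\<lambda>_. unif)"
proof -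
  interpret prob_space unif by (rule prob_space_unif)
  show ?thesis by unfold_locales
qed

lemma prob_space_weights: "prob_space (weights E)"
  by (rule prob_space_PiM) (rule prob_space_unif)

lemma AE_unif: "AE t in unif. 0 < t \<and> t < 1"
proof (rule AE_uniform_measureI)
  have "AE t in lborel. t \<noteq> (0::real)" "AE t in lborel. t \<noteq> (1::real)"
    by (rule AE_lborel_singleton)+
  then show "AE t in lborel. t \<in> {0..1::real} \<longrightarrow> 0 < t \<and> t < 1"
    by eventually_elim auto
qed simp

lemma emeasure_unif_atLeast: "0 \<le> t \<Longrightarrow> t \<le> 1 \<Longrightarrow> emeasure unif {t..} = ennreal (1 - t)"
proof -
  assume "0 \<le> t" "t \<le> 1"
  then have "{0..1} \<inter> {t..} = {t..1}" by auto
  with \<open>t \<le> 1\<close> show ?thesis by (simp add: divide_ennreal_def)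
qed

lemma emeasure_unif_lessThan: "0 \<le> t \<Longrightarrow> t \<le> 1 \<Longrightarrow> emeasure unif {..<t} = ennreal t"
proof -
  assume "0 \<le> t" "t \<le> 1"
  then have "{0..1} \<inter> {..<t} = {0..<t}" by auto
  with \<open>0 \<le> t\<close> show ?thesis by (simp add: divide_ennreal_def)
qed

lemma measurable_unif: "measurable M unif = borel_measurable M"
  by (rule measurable_cong_sets) simp_all

lemma measurable_weights_component: "e \<in> E \<Longrightarrow> (\<lambda>x. x e) \<in> borel_measurable (weights E)"
  using measurable_component_singleton[of e E "\<lambda>_. unif"] unfolding measurable_unif .

text \<open>There are finitely many possible graphs, so measurability reduces to comparing single
  weights with \<open>t\<close>; with a discrete target, every function of the graph is then
  measurable too.\<close>

lemma measurable_below: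
  assumes "finite E"
  shows "(\<lambda>(x, t). below E x t) \<in> measurable (weights E \<Otimes>\<^sub>M unif) (count_space (Pow E))"
proof (rule measurable_count_space_eq2[THEN iffD2, OF finite_Pow_iff[THEN iffD2, OF assms]], intro conjI ballI)
  show "(\<lambda>(x, t). below E x t) \<in> space (weights E \<Otimes>\<^sub>M unif) \<rightarrow> Pow E"
    by (auto simp: below_def)
  fix S assume S: "S \<in> Pow E"
  have meas: "{p \<in> space (weights E \<Otimes>\<^sub>M unif). (fst p e < snd p) = (e \<in> S)} \<in> sets (weights E \<Otimes>\<^sub>M unif)"
    if e: "e \<in> E" for e
  proof -
    have [measurable]: "(\<lambda>p. fst p e) \<in> borel_measurable (weights E \<Otimes>\<^sub>M unif)"
      using measurable_compose[OF measurable_fst measurable_component_singleton[OF e, of "\<lambda>_. unif"], of unif]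
      unfolding measurable_unif .
    have [measurable]: "snd \<in> borel_measurable (weights E \<Otimes>\<^sub>M unif)"
      using measurable_snd[of "weights E" unif] unfolding measurable_unif .
    show ?thesis by measurable
  qed
  have "(\<lambda>(x, t). below E x t) -` {S} \<inter> space (weights E \<Otimes>\<^sub>M unif)
      = {p \<in> space (weights E \<Otimes>\<^sub>M unif). \<forall>e\<in>E. (fst p e < snd p) = (e \<in> S)}"
  proof -
    have "below E x t = S \<longleftrightarrow> (\<forall>e\<in>E. (x e < t) = (e \<in> S))" for x t
      using S unfolding below_def by blast
    then show ?thesis by (simp add: set_eq_iff split_beta conj_commute)
  qed
  also have "\<dots> \<in> sets (weights E \<Otimes>\<^sub>M unif)"
    using assms by (intro sets.sets_Collect_finite_All meas)
  finally show "(\<lambda>(x, t). below E x t) -` {S} \<inter> space (weights E \<Otimes>\<^sub>M unif) \<in> sets (weights E \<Otimes>\<^sub>M unif)" .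
qed

lemma measurable_fun_below:
  assumes "finite E"
  shows "(\<lambda>p. f (below E (fst p) (snd p))) \<in> measurable (weights E \<Otimes>\<^sub>M unif) (count_space UNIV)"
proof -
  have "f \<in> measurable (count_space (Pow E)) (count_space UNIV)" by simp
  from measurable_compose[OF measurable_below[OF assms] this] show ?thesis
    by (simp add: case_prod_beta')
qed

lemma measurable_fun_below1:
  assumes "finite E"
  shows "(\<lambda>x. f (below E x t)) \<in> measurable (weights E) (count_space UNIV)"
proof -
  have "(\<lambda>x. (x, t)) \<in> measurable (weights E) (weights E \<Otimes>\<^sub>M unif)" by (intro measurable_Pair measurable_const) simp_all
  from measurable_compose[OF this measurable_fun_below[OF assms]] show ?thesis by simp
qed

lemma measurable_weights_Pair:
  assumes "e \<in> E"
  shows "(\<lambda>x. (x, x e)) \<in> measurable (weights E) (weights E \<Otimes>\<^sub>M unif)"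
  using measurable_component_singleton[OF assms, of "\<lambda>_. unif"] by (intro measurable_Pair) auto

lemma measurable_fun_below_edge:
  assumes "finite E" "e \<in> E"
  shows "(\<lambda>x. f (below E x (x e))) \<in> measurable (weights E) (count_space UNIV)"
  using measurable_compose[OF measurable_weights_Pair[OF assms(2)] measurable_fun_below[OF assms(1)]] by simp

text \<open>Given that \<open>x e \<ge> t\<close>, an event at time \<open>x e = t\<close> that ignores the edges not yet present has
  the hazard rate \<open>1 / (1 - t)\<close>.\<close>

lemma nn_integral_arrival:
  fixes h :: "(nat set \<Rightarrow> real) \<times> real \<Rightarrow> ennreal"
  assumes "finite E" "e \<in> E"
    and h [measurable]: "h \<in> borel_measurable (weights E \<Otimes>\<^sub>M unif)"
    and zero: "\<And>x t. x e < t \<Longrightarrow> h (x, t) = 0"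
    and indep: "\<And>x y t. t \<le> y \<Longrightarrow> h (x(e := y), t) = h (x(e := t), t)"
  shows "(\<integral>\<^sup>+x. h (x, x e) \<partial>weights E) = (\<integral>\<^sup>+t. ennreal (1 / (1 - t)) * (\<integral>\<^sup>+x. h (x, t) \<partial>weights E) \<partial>unif)"
proof -
  interpret product_prob_space "\<lambda>_. unif" by (rule product_prob_space_unif)
  let ?I = "E - {e}"
  have E: "insert e ?I = E" and I: "finite ?I" "e \<notin> ?I" using assms(1,2) by auto
  have m: "(\<lambda>x. h (x, x e)) \<in> borel_measurable (weights (insert e ?I))"
    using measurable_compose[OF measurable_weights_Pair[OF assms(2)] h] unfolding E .
  have mt: "(\<lambda>x. h (x, t)) \<in> borel_measurable (weights (insert e ?I))" for t
  proof -
    have "(\<lambda>x. (x, t)) \<in> measurable (weights E) (weights E \<Otimes>\<^sub>M unif)" by (intro measurable_Pair measurable_const) simp_all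
    from measurable_compose[OF this h] show ?thesis unfolding E .
  qed
  \<comment> \<open>The weight of \<open>e\<close> is integrated last; its value becomes the time
    \<open>t\<close>.\<close>
  have "(\<integral>\<^sup>+x. h (x, x e) \<partial>weights E) = (\<integral>\<^sup>+t. (\<integral>\<^sup>+x. h (x(e := t), t) \<partial>weights ?I) \<partial>unif)"
    using product_nn_integral_insert_rev[OF I m] by (simp only: E fun_upd_same)
  also have "\<dots> = (\<integral>\<^sup>+t. ennreal (1 / (1 - t)) * (\<integral>\<^sup>+x. h (x, t) \<partial>weights E) \<partial>unif)"
  proof (rule nn_integral_cong_AE)
    show "AE t in unif. (\<integral>\<^sup>+x. h (x(e := t), t) \<partial>weights ?I)
        = ennreal (1 / (1 - t)) * (\<integral>\<^sup>+x. h (x, t) \<partial>weights E)"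
      using AE_unif
    proof eventually_elim
      case (elim t)
      have "(\<integral>\<^sup>+x. h (x, t) \<partial>weights E) = (\<integral>\<^sup>+x. (\<integral>\<^sup>+y. h (x(e := y), t) \<partial>unif) \<partial>weights ?I)"
        using product_nn_integral_insert[OF I mt] by (simp only: E)
      \<comment> \<open>For fixed \<open>t\<close> the integrand vanishes for \<open>y < t\<close>
        and does not depend on \<open>y \<ge> t\<close>, so averaging over \<open>y\<close> gives
        the factor \<open>1 - t\<close>.\<close>
      also have "\<dots> = (\<integral>\<^sup>+x. (\<integral>\<^sup>+y. h (x(e := t), t) * indicator {t..} y \<partial>unif) \<partial>weights ?I)"
      proof (intro nn_integral_cong)
        fix x y
        show "h (x(e := y), t) = h (x(e := t), t) * indicator {t..} y"
          using zero[of "x(e := y)" t] indep[of t y x] by (cases "t \<le> y") auto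
      qed
      also have "\<dots> = (\<integral>\<^sup>+x. h (x(e := t), t) * ennreal (1 - t) \<partial>weights ?I)"
        using elim emeasure_unif_atLeast[of t] by (simp add: nn_integral_cmult)
      also have "\<dots> = (\<integral>\<^sup>+x. h (x(e := t), t) \<partial>weights ?I) * ennreal (1 - t)"
      proof (rule nn_integral_multc)
        have "(\<lambda>x. x(e := t)) \<in> measurable (weights ?I) (weights (insert e ?I))"
          by (rule measurable_fun_upd[where J = ?I]) auto
        from measurable_compose[OF this mt] show "(\<lambda>x. h (x(e := t), t)) \<in> borel_measurable (weights ?I)" .
      qed
      finally have *: "(\<integral>\<^sup>+x. h (x, t) \<partial>weights E) = (\<integral>\<^sup>+x. h (x(e := t), t) \<partial>weights ?I) * ennreal (1 - t)" .
      have "ennreal (1 - t) * ennreal (1 / (1 - t)) = 1"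
        using elim by (simp flip: ennreal_mult)
      then have "ennreal (1 / (1 - t)) * (X * ennreal (1 - t)) = X" for X
        by (simp add: mult.left_commute[of _ X] mult.commute[of "ennreal (1 / (1 - t))"])
      then show ?case unfolding * by simp
    qed
  qed
  finally show ?thesis .
qed

text \<open>The event is a box: \<open>T\<close> forces weights below \<open>t\<close>,
  \<open>D\<close> weights at least \<open>t\<close>, and the other edges are free.\<close>

lemma emeasure_below:
  assumes "finite E" "T \<subseteq> E" "D \<subseteq> E" "T \<inter> D = {}" "0 \<le> t" "t \<le> 1"
  shows "emeasure (weights E) {x \<in> space (weights E). T \<subseteq> below E x t \<and> D \<inter> below E x t = {}}
    = ennreal (t ^ card T * (1 - t) ^ card D)"
proof -
  interpret product_prob_space "\<lambda>_. unif" by (rule product_prob_space_unif)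
  let ?A = "\<lambda>e. if e \<in> T then {..<t} else if e \<in> D then {t..} else UNIV"
  have "{x \<in> space (weights E). T \<subseteq> below E x t \<and> D \<inter> below E x t = {}} = Pi\<^sub>E E ?A"
  proof -
    have "T \<subseteq> below E x t \<and> D \<inter> below E x t = {} \<longleftrightarrow> (\<forall>e\<in>T. x e < t) \<and> (\<forall>e\<in>D. \<not> x e < t)" for x
      using assms(2,3) unfolding below_def by blast
    moreover have "(\<forall>e\<in>T. x e < t) \<and> (\<forall>e\<in>D. \<not> x e < t) \<longleftrightarrow> (\<forall>e\<in>E. x e \<in> ?A e)" for x
    proof
      assume r: "\<forall>e\<in>E. x e \<in> ?A e"
      have "x e < t" if "e \<in> T" for e
        using bspec[OF r, of e] that assms(2) by auto
      moreover have "\<not> x e < t" if "e \<in> D" for e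
      proof -
        have "e \<in> E" "e \<notin> T" using that assms(3,4) by auto
        then show ?thesis using bspec[OF r, of e] that by simp
      qed
      ultimately show "(\<forall>e\<in>T. x e < t) \<and> (\<forall>e\<in>D. \<not> x e < t)" by blast
    qed (simp add: not_less)
    ultimately have *: "T \<subseteq> below E x t \<and> D \<inter> below E x t = {} \<longleftrightarrow> (\<forall>e\<in>E. x e \<in> ?A e)" for x
      by (simp only:)
    show ?thesis unfolding * by (simp add: set_eq_iff space_PiM PiE_iff conj_commute)
  qed
  then have "emeasure (weights E) {x \<in> space (weights E). T \<subseteq> below E x t \<and> D \<inter> below E x t = {}}
      = (\<Prod>e\<in>E. emeasure unif (?A e))"
    using assms(1) by (simp add: emeasure_PiM)
  also have "\<dots> = (\<Prod>e\<in>E. (if e \<in> T then ennreal t else 1) * (if e \<in> D then ennreal (1 - t) else 1))"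
  proof (rule prod.cong[OF refl])
    fix e
    show "emeasure unif (?A e) = (if e \<in> T then ennreal t else 1) * (if e \<in> D then ennreal (1 - t) else 1)"
      using emeasure_unif_atLeast[OF assms(5,6)] emeasure_unif_lessThan[OF assms(5,6)]
        prob_space.emeasure_space_1[OF prob_space_unif] assms(4) by (auto simp del: emeasure_uniform_measure)
  qed
  also have "\<dots> = ennreal t ^ card T * ennreal (1 - t) ^ card D"
  proof -
    have "(\<Prod>e\<in>E. if e \<in> T then ennreal t else 1) = ennreal t ^ card T"
      using assms(1,2) by (simp add: prod.If_cases Int_absorb1)
    moreover have "(\<Prod>e\<in>E. if e \<in> D then ennreal (1 - t) else 1) = ennreal (1 - t) ^ card D"
      using assms(1,3) by (simp add: prod.If_cases Int_absorb1)
    ultimately show ?thesis by (simp add: prod.distrib)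
  qed
  also have "\<dots> = ennreal (t ^ card T * (1 - t) ^ card D)"
    using assms(5,6) by (simp add: ennreal_mult ennreal_power)
  finally show ?thesis .
qed

text \<open>For a tie, fix all weights but one: the remaining one must hit a single point, which has
  measure zero.\<close>

lemma AE_weights_generic:
  assumes "finite E"
  shows "AE x in weights E. inj_on x E \<and> (\<forall>e\<in>E. 0 < x e)"
proof -
  interpret product_prob_space "\<lambda>_. unif" by (rule product_prob_space_unif)
  have "AE x in weights E. 0 < x e" if "e \<in> E" for e
    using that AE_unif by (intro AE_PiM_component[of E "\<lambda>_. unif", OF prob_space_unif]) auto
  then have 1: "AE x in weights E. \<forall>e\<in>E. 0 < x e"
    using assms by (simp add: AE_finite_all)
  have "AE x in weights E. x e \<noteq> x f" if "e \<in> E" "f \<in> E" "e \<noteq> f" for e f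
  proof (rule AE_I')
    let ?N = "{x \<in> space (weights E). x e = x f}"
    have [measurable]: "(\<lambda>x. x e) \<in> borel_measurable (weights E)" "(\<lambda>x. x f) \<in> borel_measurable (weights E)"
      using that measurable_weights_component by auto
    have sets: "?N \<in> sets (weights E)" by measurable
    let ?I = "E - {e}"
    have E: "insert e ?I = E" and I: "finite ?I" "e \<notin> ?I" using assms that by auto
    have "emeasure (weights E) ?N = (\<integral>\<^sup>+x. indicator ?N x \<partial>weights E)"
      using sets by simp
    also have "\<dots> = (\<integral>\<^sup>+x. (\<integral>\<^sup>+y. indicator ?N (x(e := y)) \<partial>unif) \<partial>weights ?I)"
      using product_nn_integral_insert[OF I, of "indicator ?N"] sets unfolding E by (simp only: borel_measurable_indicator)
    also have "\<dots> \<le> (\<integral>\<^sup>+x. 0 \<partial>weights ?I)"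
    proof (rule nn_integral_mono)
      fix x
      have "(\<integral>\<^sup>+y. indicator ?N (x(e := y)) \<partial>unif) \<le> (\<integral>\<^sup>+y. indicator {x f} y \<partial>unif)"
        using that(3) by (intro nn_integral_mono) (auto split: split_indicator)
      also have "\<dots> = emeasure lborel ({0..1} \<inter> {x f})" by (simp add: divide_ennreal_def)
      also have "\<dots> \<le> emeasure lborel {x f}" by (rule emeasure_mono) auto
      finally show "(\<integral>\<^sup>+y. indicator ?N (x(e := y)) \<partial>unif) \<le> 0" by simp
    qed
    finally show "?N \<in> null_sets (weights E)" using sets by (auto simp: null_sets_def)
    show "{x \<in> space (weights E). \<not> x e \<noteq> x f} \<subseteq> ?N" by auto
  qed
  then have "AE x in weights E. \<forall>e\<in>E. \<forall>f\<in>E. e \<noteq> f \<longrightarrow> x e \<noteq> x f"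
    using assms by (intro AE_finite_allI) (auto simp: AE_conj_iff)
  with 1 show ?thesis by eventually_elim (auto simp: inj_on_def)
qed

lemma not_crosses_mem:
  assumes "e \<in> F" "e \<in> edges V"
  shows "\<not> crosses F e"
proof -
  from assms(2) obtain u v where "e = {u, v}" by (blast elim: edgesE)
  then show ?thesis using assms(1) edge_component[of u v F] by (simp add: crosses_doubleton)
qed

lemma sum_degree_in:
  fixes g :: "nat \<Rightarrow> real"
  assumes "finite V" "M \<subseteq> edges V"
  shows "(\<Sum>v\<in>V. g v * degree_in M v) = (\<Sum>e\<in>M. \<Sum>v\<in>e. g v)"
proof -
  have fin: "finite M" using assms finite_edges finite_subset by blast
  have "(\<Sum>e\<in>M. \<Sum>v\<in>e. g v) = (\<Sum>e\<in>M. \<Sum>v | v \<in> V \<and> v \<in> e. g v)"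
    using edges_subset_Pow assms(2) by (intro sum.cong refl arg_cong2[where f = sum]) auto
  also have "\<dots> = (\<Sum>v\<in>V. \<Sum>e | e \<in> M \<and> v \<in> e. g v)"
    by (rule sum.swap_restrict[OF fin assms(1)])
  also have "\<dots> = (\<Sum>v\<in>V. g v * degree_in M v)"
    by (simp add: degree_in_def mult.commute)
  finally show ?thesis ..
qed

lemma sum_card_edges:
  assumes "M \<subseteq> edges V"
  shows "(\<Sum>e\<in>M. real (card e)) = 2 * real (card M)"
proof -
  have "real (card e) = 2" if "e \<in> M" for e
  proof -
    have "e \<in> edges V" using assms that by blast
    then show ?thesis by (auto elim: edgesE)
  qed
  then have "(\<Sum>e\<in>M. real (card e)) = (\<Sum>e\<in>M. 2)" by (rule sum.cong[OF refl])
  then show ?thesis by simp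
qed

text \<open>Handshake count, with the sum of degrees taken from \<open>sum_degree_kruskal\<close>
  for \<open>g\<close> constant one.\<close>

lemma card_kruskal:
  assumes "finite V" "F \<subseteq> edges V" "inj_on x F"
  shows "real (card (kruskal x F)) = real (card V) - card (conn_components V F)"
proof -
  have sub: "kruskal x F \<subseteq> edges V" using kruskal_subset assms(2) by blast
  have "(\<Sum>v\<in>V. real (degree_in (kruskal x F) v)) = 2 * real (card (kruskal x F))"
    using sum_degree_in[OF assms(1) sub, of "\<lambda>_. 1"] sum_card_edges[OF sub] by simp
  moreover have "(\<Sum>v\<in>V. real (degree_in (kruskal x F) v)) = 2 * (\<Sum>v\<in>V. 1 - 1 / card (component F v))"
    using sum_degree_kruskal[OF assms, of "\<lambda>_. 1"] by simp
  moreover have "(\<Sum>v\<in>V. 1 / card (component F v)) = card (conn_components V F)"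
    using sum_inverse_card_component[OF assms(1,2), of "\<lambda>_. 1"] by simp
  ultimately show ?thesis by (simp add: sum_subtractf)
qed


lemma card_components_complete:
  assumes "V \<noteq> {}"
  shows "card (conn_components V (edges V)) = 1"
proof -
  have "conn_components V (edges V) = {V}"
    using assms component_complete unfolding conn_components_def by auto
  then show ?thesis by simp
qed

lemma two_card_crosses:
  assumes "finite V" "F \<subseteq> edges V"
  shows "2 * real (card {e \<in> edges V. crosses F e}) = (\<Sum>v\<in>V. real (card V) - card (component F v))"
  using crosses_edge_sum[OF assms, of "\<lambda>_. 1"] sum_card_edges[of "{e \<in> edges V. crosses F e}" V] by simp

lemma below_kruskal: "{e \<in> kruskal x E. x e < t} = kruskal x (below E x t)"
  unfolding below_def by (rule kruskal_below [symmetric])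

lemma crosses_iff_kruskal: "e \<in> E \<Longrightarrow> crosses (below E x (x e)) e \<longleftrightarrow> e \<in> kruskal x E"
  by (simp add: kruskal_def below_def)

text \<open>Of the \<open>card V - 1\<close> tree edges, those arrived before \<open>s\<close> are
  the Kruskal edges of the graph at \<open>s\<close>, whose number is known.\<close>

lemma card_kruskal_above:
  assumes "finite V" "V \<noteq> {}" "inj_on x (edges V)"
  shows "real (card {e \<in> kruskal x (edges V). s \<le> x e})
    = real (card (conn_components V (below (edges V) x s))) - 1"
proof -
  let ?M = "kruskal x (edges V)"
  have fin: "finite ?M" using kruskal_subset assms(1) finite_edges finite_subset by metis
  have "card ?M = card {e \<in> ?M. s \<le> x e} + card {e \<in> ?M. x e < s}"
    using fin by (subst card_Un_disjoint [symmetric]) (auto intro: arg_cong[where f = card])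
  moreover have "real (card ?M) = real (card V) - 1"
    using card_kruskal[OF assms(1) order_refl assms(3)] card_components_complete[OF assms(2)] by simp
  moreover have "real (card {e \<in> ?M. x e < s}) = real (card V) - card (conn_components V (below (edges V) x s))"
    unfolding below_kruskal
    by (rule card_kruskal[OF assms(1) below_subset inj_on_subset[OF assms(3) below_subset]])
  ultimately show ?thesis by simp
qed

text \<open>The expectation of \<open>\<kappa> - 1\<close> at time \<open>t\<close>, which is also
  the expected number of tree edges still to come.\<close>

definition excess :: "nat set \<Rightarrow> real \<Rightarrow> ennreal" where
  "excess V t = (\<integral>\<^sup>+x. ennreal (real (card (conn_components V (below (edges V) x t))) - 1) \<partial>weights (edges V))"

text \<open>The expected number of ordered pairs of vertices in different components, so twice the
  expected number of edges that would join two components.\<close>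

definition cross_pairs :: "nat set \<Rightarrow> real \<Rightarrow> ennreal" where
  "cross_pairs V t = (\<integral>\<^sup>+x. ennreal (\<Sum>v\<in>V. real (card V) - card (component (below (edges V) x t) v)) \<partial>weights (edges V))"

text \<open>\<open>hazard_integral V 0\<close> is the integral \<open>J\<close>; a positive
  \<open>s\<close> isolates the late times.\<close>

definition hazard_integral :: "nat set \<Rightarrow> real \<Rightarrow> ennreal" where
  "hazard_integral V s = (\<integral>\<^sup>+t. ennreal (1 / (1 - t)) * excess V t * indicator {s..} t \<partial>unif)"

lemma borel_measurable_fun_below:
  fixes f :: "nat set set \<Rightarrow> 'b :: topological_space"
  assumes "finite E"
  shows "(\<lambda>p. f (below E (fst p) (snd p))) \<in> borel_measurable (weights E \<Otimes>\<^sub>M unif)"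
    and "(\<lambda>x. f (below E x t)) \<in> borel_measurable (weights E)"
    and "e \<in> E \<Longrightarrow> (\<lambda>x. f (below E x (x e))) \<in> borel_measurable (weights E)"
  using measurable_compose[OF measurable_fun_below[OF assms, of f], of id borel]
    measurable_compose[OF measurable_fun_below1[OF assms, of f], of id borel]
    measurable_compose[OF measurable_fun_below_edge[OF assms, of e f], of id borel]
  by auto

lemma sigma_finite_weights: "sigma_finite_measure (weights E)"
  using prob_space_weights prob_space_imp_sigma_finite by blast

lemma borel_measurable_excess [measurable]: "finite V \<Longrightarrow> excess V \<in> borel_measurable unif"
proof -
  assume "finite V"
  interpret sigma_finite_measure "weights (edges V)" by (rule sigma_finite_weights)
  have "(\<lambda>p. ennreal (real (card (conn_components V (below (edges V) (snd p) (fst p)))) - 1))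
      \<in> borel_measurable (unif \<Otimes>\<^sub>M weights (edges V))"
    using measurable_compose[OF measurable_pair_swap' borel_measurable_fun_below(1)[of "edges V"
        "\<lambda>S. ennreal (real (card (conn_components V S)) - 1)"]] \<open>finite V\<close>
    by (simp add: case_prod_beta)
  then show ?thesis unfolding excess_def
    by (intro borel_measurable_nn_integral) (simp add: case_prod_beta)
qed

lemma borel_measurable_one_minus: "(\<lambda>t. ennreal (1 / (1 - t))) \<in> borel_measurable unif"
proof -
  have "(\<lambda>t::real. ennreal (1 / (1 - t))) \<in> borel_measurable borel" by measurable
  then show ?thesis by (simp cong: measurable_cong_sets)
qed

lemma nn_integral_sum_arrival:
  fixes h :: "nat set \<Rightarrow> (nat set \<Rightarrow> real) \<times> real \<Rightarrow> ennreal"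
  assumes "finite E"
    and h: "\<And>e. e \<in> E \<Longrightarrow> h e \<in> borel_measurable (weights E \<Otimes>\<^sub>M unif)"
    and zero: "\<And>e x t. e \<in> E \<Longrightarrow> x e < t \<Longrightarrow> h e (x, t) = 0"
    and indep: "\<And>e x y t. e \<in> E \<Longrightarrow> t \<le> y \<Longrightarrow> h e (x(e := y), t) = h e (x(e := t), t)"
  shows "(\<integral>\<^sup>+x. (\<Sum>e\<in>E. h e (x, x e)) \<partial>weights E)
    = (\<integral>\<^sup>+t. ennreal (1 / (1 - t)) * (\<integral>\<^sup>+x. (\<Sum>e\<in>E. h e (x, t)) \<partial>weights E) \<partial>unif)"
proof -
  interpret sigma_finite_measure "weights E" by (rule sigma_finite_weights)
  have m1: "(\<lambda>x. h e (x, x e)) \<in> borel_measurable (weights E)" if "e \<in> E" for e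
    using measurable_compose[OF measurable_weights_Pair[OF that] h[OF that]] .
  have m2: "(\<lambda>x. h e (x, t)) \<in> borel_measurable (weights E)" if "e \<in> E" for e t
  proof -
    have "(\<lambda>x. (x, t)) \<in> measurable (weights E) (weights E \<Otimes>\<^sub>M unif)"
      by (intro measurable_Pair measurable_const) simp_all
    from measurable_compose[OF this h[OF that]] show ?thesis .
  qed
  have m3: "(\<lambda>t. \<integral>\<^sup>+x. h e (x, t) \<partial>weights E) \<in> borel_measurable unif" if "e \<in> E" for e
  proof -
    have "(\<lambda>p. h e (snd p, fst p)) \<in> borel_measurable (unif \<Otimes>\<^sub>M weights E)"
      using measurable_compose[OF measurable_pair_swap' h[OF that]] by (simp add: case_prod_beta)
    then show ?thesis by (intro borel_measurable_nn_integral) (simp add: case_prod_beta)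
  qed
  note [measurable] = borel_measurable_one_minus
  have "(\<integral>\<^sup>+x. (\<Sum>e\<in>E. h e (x, x e)) \<partial>weights E) = (\<Sum>e\<in>E. \<integral>\<^sup>+x. h e (x, x e) \<partial>weights E)"
    by (rule nn_integral_sum) (rule m1)
  also have "\<dots> = (\<Sum>e\<in>E. \<integral>\<^sup>+t. ennreal (1 / (1 - t)) * (\<integral>\<^sup>+x. h e (x, t) \<partial>weights E) \<partial>unif)"
    by (intro sum.cong refl nn_integral_arrival assms)
  also have "\<dots> = (\<integral>\<^sup>+t. (\<Sum>e\<in>E. ennreal (1 / (1 - t)) * (\<integral>\<^sup>+x. h e (x, t) \<partial>weights E)) \<partial>unif)"
    using m3 by (intro nn_integral_sum [symmetric] borel_measurable_times_ennreal) simp_all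
  also have "\<dots> = (\<integral>\<^sup>+t. ennreal (1 / (1 - t)) * (\<integral>\<^sup>+x. (\<Sum>e\<in>E. h e (x, t)) \<partial>weights E) \<partial>unif)"
    by (simp add: sum_distrib_left nn_integral_sum[OF m2])
  finally show ?thesis .
qed

section \<open>The second moment of the degree\<close>

text \<open>Count the tree edges that arrive from time \<open>s\<close> on. Directly there are
  \<open>\<kappa> - 1\<close> of them, with \<open>\<kappa>\<close> taken at \<open>s\<close>; the
  arrival formula gives an integral over joining edges, each of which \<open>cross_pairs\<close>
  counts twice.\<close>

lemma two_excess_eq:
  assumes "finite V" "V \<noteq> {}"
  shows "2 * excess V s = (\<integral>\<^sup>+t. ennreal (1 / (1 - t)) * (cross_pairs V t * indicator {s..} t) \<partial>unif)"
proof -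
  let ?E = "edges V"
  have fin: "finite ?E" using assms(1) by simp
  define h :: "nat set \<Rightarrow> (nat set \<Rightarrow> real) \<times> real \<Rightarrow> ennreal"
    where "h e p = of_bool (crosses (below ?E (fst p) (snd p)) e) * indicator {s..} (snd p)" for e p
  have meas: "h e \<in> borel_measurable (weights ?E \<Otimes>\<^sub>M unif)" for e
  proof -
    have [measurable]: "(\<lambda>p. of_bool (crosses (below ?E (fst p) (snd p)) e) :: ennreal) \<in> borel_measurable (weights ?E \<Otimes>\<^sub>M unif)"
      by (rule borel_measurable_fun_below(1)[OF fin])
    have [measurable]: "(\<lambda>p. indicator {s..} (snd p) :: ennreal) \<in> borel_measurable (weights ?E \<Otimes>\<^sub>M unif)"
      by (rule measurable_compose[OF measurable_snd]) simp
    show ?thesis unfolding h_def by measurable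
  qed
  have zero: "h e (x, t) = 0" if "e \<in> ?E" "x e < t" for e x t
    using not_crosses_mem[of e "below ?E x t" V] that by (simp add: h_def below_def)
  have indep: "h e (x(e := y), t) = h e (x(e := t), t)" if "t \<le> y" for e x y t
  proof -
    have "below ?E (x(e := y)) t = below ?E (x(e := t)) t" using that by (auto simp: below_def)
    then show ?thesis by (simp add: h_def)
  qed
  have lhs: "(\<integral>\<^sup>+x. (\<Sum>e\<in>?E. h e (x, x e)) \<partial>weights ?E) = excess V s"
    unfolding excess_def
  proof (rule nn_integral_cong_AE)
    show "AE x in weights ?E. (\<Sum>e\<in>?E. h e (x, x e))
        = ennreal (real (card (conn_components V (below ?E x s))) - 1)"
      using AE_weights_generic[OF fin]
    proof eventually_elim
      case (elim x)
      have "(\<Sum>e\<in>?E. h e (x, x e)) = (\<Sum>e\<in>?E. of_bool (e \<in> kruskal x ?E \<and> s \<le> x e))"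
        by (rule sum.cong) (auto simp: h_def crosses_iff_kruskal split: split_indicator)
      also have "\<dots> = of_nat (card {e \<in> kruskal x ?E. s \<le> x e})"
        using fin kruskal_subset[of x ?E] by (auto simp: Int_def intro!: arg_cong[where f = card])
      also have "\<dots> = ennreal (card {e \<in> kruskal x ?E. s \<le> x e})" by (simp add: ennreal_of_nat_eq_real_of_nat)
      finally show ?case using card_kruskal_above[OF assms, of x s] elim by simp
    qed
  qed
  have rhs: "2 * (\<integral>\<^sup>+x. (\<Sum>e\<in>?E. h e (x, t)) \<partial>weights ?E) = cross_pairs V t * indicator {s..} t" for t
  proof -
    have "2 * (\<Sum>e\<in>?E. h e (x, t))
        = ennreal (\<Sum>v\<in>V. real (card V) - card (component (below ?E x t) v)) * indicator {s..} t" for x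
    proof -
      have "(\<Sum>e\<in>?E. h e (x, t)) = of_nat (card {e \<in> ?E. crosses (below ?E x t) e}) * indicator {s..} t"
        using fin by (simp add: h_def sum_distrib_right [symmetric] Int_def)
      then have "2 * (\<Sum>e\<in>?E. h e (x, t)) = ennreal (2 * real (card {e \<in> ?E. crosses (below ?E x t) e})) * indicator {s..} t"
        by (simp add: ennreal_mult ennreal_of_nat_eq_real_of_nat mult.assoc)
      then show ?thesis unfolding two_card_crosses[OF assms(1) below_subset] .
    qed
    moreover have "(\<integral>\<^sup>+x. 2 * (\<Sum>e\<in>?E. h e (x, t)) \<partial>weights ?E) = 2 * (\<integral>\<^sup>+x. (\<Sum>e\<in>?E. h e (x, t)) \<partial>weights ?E)"
    proof (rule nn_integral_cmult)
      have "(\<lambda>x. (x, t)) \<in> measurable (weights ?E) (weights ?E \<Otimes>\<^sub>M unif)"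
        by (intro measurable_Pair measurable_const) simp_all
      from measurable_compose[OF this meas] show "(\<lambda>x. \<Sum>e\<in>?E. h e (x, t)) \<in> borel_measurable (weights ?E)"
        by (intro borel_measurable_sum)
    qed
    moreover have "(\<integral>\<^sup>+x. ennreal (\<Sum>v\<in>V. real (card V) - card (component (below ?E x t) v)) * indicator {s..} t \<partial>weights ?E)
       = cross_pairs V t * indicator {s..} t"
      unfolding cross_pairs_def by (rule nn_integral_multc) (rule borel_measurable_fun_below(2)[OF fin])
    ultimately show ?thesis by simp
  qed
  have "2 * excess V s = 2 * (\<integral>\<^sup>+t. ennreal (1 / (1 - t)) * (\<integral>\<^sup>+x. (\<Sum>e\<in>?E. h e (x, t)) \<partial>weights ?E) \<partial>unif)"
    unfolding lhs [symmetric] using nn_integral_sum_arrival[OF fin meas zero indep] by simp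
  also have "\<dots> = (\<integral>\<^sup>+t. 2 * (ennreal (1 / (1 - t)) * (\<integral>\<^sup>+x. (\<Sum>e\<in>?E. h e (x, t)) \<partial>weights ?E)) \<partial>unif)"
  proof (rule nn_integral_cmult [symmetric])
    have "(\<lambda>t. \<integral>\<^sup>+x. (\<Sum>e\<in>?E. h e (x, t)) \<partial>weights ?E) \<in> borel_measurable unif"
    proof -
      interpret sigma_finite_measure "weights ?E" by (rule sigma_finite_weights)
      have "(\<lambda>p. \<Sum>e\<in>?E. h e (snd p, fst p)) \<in> borel_measurable (unif \<Otimes>\<^sub>M weights ?E)"
        using measurable_compose[OF measurable_pair_swap' meas] by (intro borel_measurable_sum) (simp add: case_prod_beta)
      then show ?thesis by (intro borel_measurable_nn_integral) (simp add: case_prod_beta)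
    qed
    then show "(\<lambda>t. ennreal (1 / (1 - t)) * (\<integral>\<^sup>+x. (\<Sum>e\<in>?E. h e (x, t)) \<partial>weights ?E)) \<in> borel_measurable unif"
      by (intro borel_measurable_times_ennreal borel_measurable_one_minus)
  qed
  also have "\<dots> = (\<integral>\<^sup>+t. ennreal (1 / (1 - t)) * (cross_pairs V t * indicator {s..} t) \<partial>unif)"
    unfolding rhs [symmetric] by (simp only: mult_ac)
  finally show ?thesis .
qed

lemma excess_0:
  assumes "finite V" "V \<noteq> {}"
  shows "excess V 0 = ennreal (real (card V) - 1)"
proof -
  interpret prob_space "weights (edges V)" by (rule prob_space_weights)
  have "excess V 0 = (\<integral>\<^sup>+x. ennreal (real (card V) - 1) \<partial>weights (edges V))"
    unfolding excess_def
  proof (rule nn_integral_cong_AE)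
    show "AE x in weights (edges V). ennreal (real (card (conn_components V (below (edges V) x 0))) - 1)
        = ennreal (real (card V) - 1)"
      using AE_weights_generic[OF finite_edges[OF assms(1)]]
    proof eventually_elim
      case (elim x)
      then have "below (edges V) x 0 = {}" by (force simp: below_def)
      then show ?case by simp
    qed
  qed
  then show ?thesis by (simp add: emeasure_space_1)
qed

lemma excess_antimono:
  assumes "finite V" "s \<le> t"
  shows "excess V t \<le> excess V s"
  unfolding excess_def
  using card_components_anti_mono[OF assms(1) below_mono[OF assms(2)]]
  by (intro nn_integral_mono ennreal_leI) simp

text \<open>\<open>card V * (\<kappa> - 1)\<close> is a vertex sum with the component orders as
  divisors; these are at least one, so dropping them only increases the sum.\<close>

lemma excess_le_cross_pairs:
  assumes "finite V"
  shows "of_nat (card V) * excess V t \<le> cross_pairs V t"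
proof -
  have "of_nat (card V) * excess V t = (\<integral>\<^sup>+x. of_nat (card V) * ennreal (real (card (conn_components V (below (edges V) x t))) - 1) \<partial>weights (edges V))"
    unfolding excess_def
    by (rule nn_integral_cmult [symmetric]) (use borel_measurable_fun_below(2)[of "edges V"] assms in simp)
  also have "\<dots> \<le> cross_pairs V t"
    unfolding cross_pairs_def
  proof (rule nn_integral_mono)
    fix x
    let ?F = "below (edges V) x t"
    have "real (card V) * (real (card (conn_components V ?F)) - 1)
        = (\<Sum>v\<in>V. (real (card V) - card (component ?F v)) / card (component ?F v))"
      by (rule sum_card_diff_over_card[OF assms below_subset, symmetric])
    also have "\<dots> \<le> (\<Sum>v\<in>V. real (card V) - card (component ?F v))"
    proof (rule sum_mono)
      fix v assume "v \<in> V"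
      from card_component[OF assms below_subset this, of x t]
      have c: "1 \<le> real (card (component ?F v))" "real (card (component ?F v)) \<le> card V" by auto
      then show "(real (card V) - card (component ?F v)) / card (component ?F v) \<le> real (card V) - card (component ?F v)"
        using mult_left_mono[OF c(1), of "real (card V) - card (component ?F v)"] by (simp add: divide_le_eq)
    qed
    finally show "of_nat (card V) * ennreal (real (card (conn_components V ?F)) - 1)
        \<le> ennreal (\<Sum>v\<in>V. real (card V) - card (component ?F v))"
      by (simp add: ennreal_of_nat_eq_real_of_nat ennreal_mult'' [symmetric] ennreal_mult' [symmetric] ennreal_leI)
  qed
  finally show ?thesis .
qed

lemma hazard_integral_le:
  assumes "finite V" "V \<noteq> {}"
  shows "of_nat (card V) * hazard_integral V s \<le> 2 * excess V s"
proof -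
  note [measurable] = borel_measurable_one_minus
  note [measurable] = borel_measurable_excess[OF assms(1)]
  have "of_nat (card V) * hazard_integral V s
      = (\<integral>\<^sup>+t. of_nat (card V) * (ennreal (1 / (1 - t)) * excess V t * indicator {s..} t) \<partial>unif)"
    unfolding hazard_integral_def by (rule nn_integral_cmult [symmetric]) measurable
  also have "\<dots> \<le> (\<integral>\<^sup>+t. ennreal (1 / (1 - t)) * (cross_pairs V t * indicator {s..} t) \<partial>unif)"
  proof (rule nn_integral_mono)
    fix t
    have "of_nat (card V) * (ennreal (1 / (1 - t)) * excess V t * indicator {s..} t)
        = ennreal (1 / (1 - t)) * ((of_nat (card V) * excess V t) * indicator {s..} t)"
      by (simp only: mult_ac)
    also have "\<dots> \<le> ennreal (1 / (1 - t)) * (cross_pairs V t * indicator {s..} t)"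
      by (intro mult_left_mono mult_right_mono excess_le_cross_pairs assms) simp_all
    finally show "of_nat (card V) * (ennreal (1 / (1 - t)) * excess V t * indicator {s..} t)
      \<le> ennreal (1 / (1 - t)) * (cross_pairs V t * indicator {s..} t)" .
  qed
  finally show ?thesis unfolding two_excess_eq[OF assms] .
qed

text \<open>The excess decreases in time and the hazard rate is at least \<open>1\<close>, so the
  times before \<open>s\<close> alone contribute at least the left-hand side.\<close>

lemma excess_le_hazard_integral:
  assumes "finite V" "0 \<le> s" "s \<le> 1"
  shows "ennreal s * excess V s \<le> hazard_integral V 0"
proof -
  have "ennreal s * excess V s = (\<integral>\<^sup>+t. excess V s * indicator {..<s} t \<partial>unif)"
    using emeasure_unif_lessThan[OF assms(2,3)] by (subst nn_integral_cmult) (simp_all add: mult.commute)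
  also have "\<dots> \<le> hazard_integral V 0"
    unfolding hazard_integral_def
  proof (rule nn_integral_mono_AE)
    show "AE t in unif. excess V s * indicator {..<s} t \<le> ennreal (1 / (1 - t)) * excess V t * indicator {0..} t"
      using AE_unif
    proof eventually_elim
      case (elim t)
      show ?case
      proof (cases "t < s")
        case True
        have "1 * excess V s \<le> ennreal (1 / (1 - t)) * excess V t"
          using elim excess_antimono[OF assms(1), of t s] True
          by (intro mult_mono) (auto simp: ennreal_1 [symmetric] simp del: ennreal_1 intro!: ennreal_leI)
        then show ?thesis using elim True by simp
      qed simp
    qed
  qed
  finally show ?thesis .
qed

text \<open>Both factors in \<open>4 / (n s)\<close> come from the hazard rate: it is at least proportional to the
  remaining number of components.\<close>

lemma hazard_integral_tail:
  assumes "finite V" "V \<noteq> {}" "0 < s" "s \<le> 1"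
  shows "hazard_integral V s \<le> ennreal (4 / (real (card V) * s))" "hazard_integral V 0 \<le> 2"
proof -
  let ?n = "real (card V)"
  have n: "?n \<ge> 1" using assms by (simp add: Suc_le_eq card_gt_0_iff)
  have c: "ennreal ?n * hazard_integral V u \<le> 2 * excess V u" for u
    using hazard_integral_le[OF assms(1,2)] by (simp add: ennreal_of_nat_eq_real_of_nat)
  have inv: "X \<le> ennreal (1 / a) * Y" if "ennreal a * X \<le> Y" "a > 0" for a X Y
  proof -
    have "X = ennreal (1 / a) * (ennreal a * X)"
      using that(2) by (simp add: mult.assoc [symmetric] ennreal_mult [symmetric])
    also have "\<dots> \<le> ennreal (1 / a) * Y" using that(1) by (rule mult_left_mono) simp
    finally show ?thesis .
  qed
  \<comment> \<open>At time zero the excess is \<open>n - 1\<close>, which gives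
    \<open>J \<le> 2 (n - 1) / n\<close>.\<close>
  have "hazard_integral V 0 \<le> ennreal (1 / ?n) * (2 * excess V 0)"
    using inv[OF c] n by simp
  also have "\<dots> = ennreal (2 * (?n - 1) / ?n)"
    using n unfolding excess_0[OF assms(1,2)] by (simp add: ennreal_mult'' [symmetric] ennreal_mult' [symmetric] flip: ennreal_numeral)
  also have "\<dots> \<le> ennreal 2" using n by (intro ennreal_leI) (simp add: field_simps)
  finally show 2: "hazard_integral V 0 \<le> 2" by simp
  \<comment> \<open>Now \<open>s * excess V s \<le> J \<le> 2\<close> bounds the excess at
    \<open>s\<close> by \<open>2 / s\<close>; a second use of \<open>c\<close>, at \<open>s\<close>
    instead of zero, adds the factor \<open>2 / n\<close>.\<close>
  have "excess V s \<le> ennreal (1 / s) * 2"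
    using inv[OF order_trans[OF excess_le_hazard_integral 2]] assms by simp
  then have "2 * excess V s \<le> ennreal (4 / s)"
    using mult_left_mono[of "excess V s" "ennreal (1 / s) * 2" 2] assms(3)
    by (simp add: ennreal_mult'' [symmetric] ennreal_mult' [symmetric] flip: ennreal_numeral)
  then have "ennreal ?n * hazard_integral V s \<le> ennreal (4 / s)" using c order_trans by blast
  then have "hazard_integral V s \<le> ennreal (1 / ?n) * ennreal (4 / s)" using inv n by simp
  also have "\<dots> = ennreal (4 / (?n * s))" using n assms(3) by (simp add: ennreal_mult [symmetric])
  finally show "hazard_integral V s \<le> ennreal (4 / (?n * s))" .
qed

lemma kruskal_cong:
  assumes "\<And>e. e \<in> F \<Longrightarrow> x e = y e"
  shows "kruskal x F = kruskal y F"
proof -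
  have "{f \<in> F. x f < x e} = {f \<in> F. y f < y e}" if "e \<in> F" for e
    using assms that by auto
  then show ?thesis unfolding kruskal_def by auto
qed

lemma degree_in_eq_sum:
  assumes "finite M" "F \<subseteq> M"
  shows "degree_in F v = (\<Sum>e | e \<in> M \<and> v \<in> e. of_bool (e \<in> F))"
proof -
  have "{e \<in> F. v \<in> e} = {e \<in> M. v \<in> e} \<inter> F" using assms(2) by auto
  then show ?thesis using assms(1) by (simp add: degree_in_def Int_commute)
qed

text \<open>\<open>card V - card (component F v)\<close> is constant on components, so
  \<open>sum_degree_kruskal\<close> applies with it as the weight and the tree shape disappears. The
  negative term stands on the left because expectations are later taken in
  \<open>ennreal\<close>.\<close>

lemma sum_degree_crosses:
  fixes t :: real
  assumes "finite V" "inj_on x (edges V)"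
  defines "F \<equiv> below (edges V) x t"
  shows "(\<Sum>e | e \<in> edges V \<and> crosses F e. \<Sum>v\<in>e. real (degree_in (kruskal x F) v))
    + 2 * (real (card V) * (real (card (conn_components V F)) - 1))
    = 2 * (\<Sum>v\<in>V. real (card V) - card (component F v))"
proof -
  have sub: "F \<subseteq> edges V" unfolding F_def by (rule below_subset)
  let ?g = "\<lambda>v. real (card V) - card (component F v)"
  have "(\<Sum>e | e \<in> edges V \<and> crosses F e. \<Sum>v\<in>e. real (degree_in (kruskal x F) v))
      = (\<Sum>v\<in>V. ?g v * degree_in (kruskal x F) v)"
    unfolding crosses_edge_sum[OF assms(1) sub] by (simp only: mult.commute)
  also have "\<dots> = 2 * (\<Sum>v\<in>V. ?g v * (1 - 1 / card (component F v)))"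
    by (rule sum_degree_kruskal[OF assms(1) sub inj_on_subset[OF assms(2) sub]])
       (simp add: edge_component)
  also have "\<dots> = 2 * (\<Sum>v\<in>V. ?g v) - 2 * (\<Sum>v\<in>V. ?g v / card (component F v))"
    by (simp add: right_diff_distrib sum_subtractf)
  finally show ?thesis unfolding sum_card_diff_over_card[OF assms(1) sub] by simp
qed

text \<open>The degree is a sum over edges of products of two indicators, each a function of the
  graph: at the arrival of that edge, and at time \<open>t\<close>.\<close>

lemma borel_measurable_degree:
  assumes "finite E"
  shows "(\<lambda>p. real (degree_in {f \<in> kruskal (fst p) E. fst p f < snd p} v)) \<in> borel_measurable (weights E \<Otimes>\<^sub>M unif)"
proof -
  have eq: "real (degree_in {f \<in> kruskal x E. x f < t} v)
      = (\<Sum>f | f \<in> E \<and> v \<in> f. of_bool (crosses (below E x (x f)) f) * of_bool (f \<in> below E x t))" for x t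
  proof -
    have "{f \<in> kruskal x E. x f < t} \<subseteq> E" using kruskal_subset by auto
    then have "real (degree_in {f \<in> kruskal x E. x f < t} v)
        = (\<Sum>f | f \<in> E \<and> v \<in> f. of_bool (f \<in> {f \<in> kruskal x E. x f < t}))"
      using degree_in_eq_sum[OF assms, of "{f \<in> kruskal x E. x f < t}" v] by simp
    also have "\<dots> = (\<Sum>f | f \<in> E \<and> v \<in> f. of_bool (crosses (below E x (x f)) f) * of_bool (f \<in> below E x t))"
      by (rule sum.cong) (auto simp: kruskal_def below_def)
    finally show ?thesis .
  qed
  show ?thesis unfolding eq
  proof (intro borel_measurable_sum borel_measurable_times)
    fix f assume f: "f \<in> {f. f \<in> E \<and> v \<in> f}"
    show "(\<lambda>p. of_bool (crosses (below E (fst p) (fst p f)) f) :: real) \<in> borel_measurable (weights E \<Otimes>\<^sub>M unif)"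
      using measurable_compose[OF measurable_fst borel_measurable_fun_below(3)[OF assms, of f "\<lambda>S. of_bool (crosses S f)"]] f
      by simp
    show "(\<lambda>p. of_bool (f \<in> below E (fst p) (snd p)) :: real) \<in> borel_measurable (weights E \<Otimes>\<^sub>M unif)"
      by (rule borel_measurable_fun_below(1)[OF assms])
  qed
qed

text \<open>The expected number of pairs of tree edges sharing a vertex, each pair counted at its
  heavier member.\<close>

definition path_pairs :: "nat set \<Rightarrow> ennreal" where
  "path_pairs V = (\<integral>\<^sup>+x. ennreal (\<Sum>e\<in>kruskal x (edges V). \<Sum>v\<in>e.
     real (degree_in {f \<in> kruskal x (edges V). x f < x e} v)) \<partial>weights (edges V))"

text \<open>The arrival formula, applied to joining edges weighted by the tree degrees of their
  endpoints. Integrating \<open>sum_degree_crosses\<close> against the hazard rate turns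
  \<open>cross_pairs\<close> into \<open>2 * excess V 0\<close> by
  \<open>two_excess_eq\<close>.\<close>

lemma path_pairs_eq:
  assumes "finite V" "V \<noteq> {}"
  shows "path_pairs V + 2 * of_nat (card V) * hazard_integral V 0 = 4 * excess V 0"
proof -
  let ?E = "edges V"
  have fin: "finite ?E" using assms(1) by simp
  define d where "d x t v = real (degree_in {f \<in> kruskal x ?E. x f < t} v)" for x t v
  define h :: "nat set \<Rightarrow> (nat set \<Rightarrow> real) \<times> real \<Rightarrow> ennreal"
    where "h e p = ennreal (of_bool (crosses (below ?E (fst p) (snd p)) e) * (\<Sum>v\<in>e. d (fst p) (snd p) v))" for e p
  have meas: "h e \<in> borel_measurable (weights ?E \<Otimes>\<^sub>M unif)" for e
    unfolding h_def d_def
    by (intro measurable_compose[OF _ measurable_ennreal] borel_measurable_times borel_measurable_sum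
        borel_measurable_fun_below(1)[OF fin] borel_measurable_degree fin)
  have zero: "h e (x, t) = 0" if "e \<in> ?E" "x e < t" for e x t
    using not_crosses_mem[of e "below ?E x t" V] that by (simp add: h_def below_def)
  have indep: "h e (x(e := y), t) = h e (x(e := t), t)" if "t \<le> y" for e x y t
  proof -
    \<comment> \<open>A weight of \<open>e\<close> that is at least \<open>t\<close> is invisible to
      the graph at time \<open>t\<close> and hence to its Kruskal edges.\<close>
    have b: "below ?E (x(e := y)) t = below ?E (x(e := t)) t" using that by (auto simp: below_def)
    have "kruskal (x(e := y)) (below ?E (x(e := t)) t) = kruskal (x(e := t)) (below ?E (x(e := t)) t)"
      by (rule kruskal_cong) (auto simp: below_def)
    then have "d (x(e := y)) t v = d (x(e := t)) t v" for v
      unfolding d_def below_kruskal b by simp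
    then show ?thesis by (simp add: h_def b)
  qed
  have d0: "d x t v \<ge> 0" for x t v by (simp add: d_def)
  have lhs: "(\<integral>\<^sup>+x. (\<Sum>e\<in>?E. h e (x, x e)) \<partial>weights ?E) = path_pairs V"
    unfolding path_pairs_def
  proof (rule nn_integral_cong)
    fix x
    have "(\<Sum>e\<in>?E. h e (x, x e)) = (\<Sum>e\<in>kruskal x ?E. ennreal (\<Sum>v\<in>e. d x (x e) v))"
      using fin kruskal_subset[of x ?E]
      by (intro sum.mono_neutral_cong_right) (auto simp: h_def crosses_iff_kruskal)
    also have "\<dots> = ennreal (\<Sum>e\<in>kruskal x ?E. \<Sum>v\<in>e. d x (x e) v)"
      by (intro sum_ennreal sum_nonneg d0)
    finally show "(\<Sum>e\<in>?E. h e (x, x e)) = ennreal (\<Sum>e\<in>kruskal x ?E. \<Sum>v\<in>e.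
        real (degree_in {f \<in> kruskal x ?E. x f < x e} v))" by (simp add: d_def)
  qed
  have rhs: "(\<integral>\<^sup>+x. (\<Sum>e\<in>?E. h e (x, t)) \<partial>weights ?E) + 2 * of_nat (card V) * excess V t = 2 * cross_pairs V t" for t
  proof -
    have m1: "(\<lambda>x. \<Sum>e\<in>?E. h e (x, t)) \<in> borel_measurable (weights ?E)"
    proof -
      have "(\<lambda>x. (x, t)) \<in> measurable (weights ?E) (weights ?E \<Otimes>\<^sub>M unif)"
        by (intro measurable_Pair measurable_const) simp_all
      from measurable_compose[OF this meas] show ?thesis by (intro borel_measurable_sum)
    qed
    let ?k = "\<lambda>x. ennreal (real (card (conn_components V (below ?E x t))) - 1)"
    let ?z = "\<lambda>x. ennreal (\<Sum>v\<in>V. real (card V) - card (component (below ?E x t) v))"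
    have m2: "?k \<in> borel_measurable (weights ?E)" "?z \<in> borel_measurable (weights ?E)"
      by (rule borel_measurable_fun_below(2)[OF fin])+
    have "(\<integral>\<^sup>+x. (\<Sum>e\<in>?E. h e (x, t)) \<partial>weights ?E) + 2 * of_nat (card V) * excess V t
        = (\<integral>\<^sup>+x. (\<Sum>e\<in>?E. h e (x, t)) + 2 * of_nat (card V) * ?k x \<partial>weights ?E)"
      unfolding excess_def using m1 m2 by (simp add: nn_integral_add nn_integral_cmult)
    also have "\<dots> = (\<integral>\<^sup>+x. 2 * ?z x \<partial>weights ?E)"
    proof (rule nn_integral_cong_AE)
      show "AE x in weights ?E. (\<Sum>e\<in>?E. h e (x, t)) + 2 * of_nat (card V) * ?k x = 2 * ?z x"
        using AE_weights_generic[OF fin]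
      proof eventually_elim
        case (elim x)
        let ?F = "below ?E x t"
        have k1: "real (card (conn_components V ?F)) \<ge> 1"
        proof -
          have "conn_components V ?F \<noteq> {}" using assms(2) by (simp add: conn_components_def)
          then show ?thesis using assms(1) by (simp add: Suc_le_eq card_gt_0_iff)
        qed
        have "(\<Sum>e\<in>?E. h e (x, t)) = (\<Sum>e | e \<in> ?E \<and> crosses ?F e. ennreal (\<Sum>v\<in>e. d x t v))"
          using fin by (intro sum.mono_neutral_cong_right) (auto simp: h_def)
        also have "\<dots> = ennreal (\<Sum>e | e \<in> ?E \<and> crosses ?F e. \<Sum>v\<in>e. d x t v)"
          by (intro sum_ennreal sum_nonneg d0)
        finally have 1: "(\<Sum>e\<in>?E. h e (x, t)) = ennreal (\<Sum>e | e \<in> ?E \<and> crosses ?F e. \<Sum>v\<in>e. d x t v)" .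
        have "2 * of_nat (card V) * ?k x = ennreal (2 * (real (card V) * (real (card (conn_components V ?F)) - 1)))"
          using k1 by (simp add: ennreal_of_nat_eq_real_of_nat ennreal_mult mult.assoc)
        then have "(\<Sum>e\<in>?E. h e (x, t)) + 2 * of_nat (card V) * ?k x
          = ennreal ((\<Sum>e | e \<in> ?E \<and> crosses ?F e. \<Sum>v\<in>e. d x t v)
             + 2 * (real (card V) * (real (card (conn_components V ?F)) - 1)))"
          unfolding 1 using k1 by (subst ennreal_plus) (auto intro!: sum_nonneg d0)
        also have "\<dots> = ennreal (2 * (\<Sum>v\<in>V. real (card V) - card (component ?F v)))"
          using sum_degree_crosses[OF assms(1), of x t] elim by (simp add: d_def below_kruskal)
        also have "\<dots> = 2 * ?z x" by (simp add: ennreal_mult')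
        finally show ?case .
      qed
    qed
    also have "\<dots> = 2 * cross_pairs V t"
      unfolding cross_pairs_def by (rule nn_integral_cmult) (rule m2)
    finally show ?thesis .
  qed
  have m3: "(\<lambda>t. \<integral>\<^sup>+x. (\<Sum>e\<in>?E. h e (x, t)) \<partial>weights ?E) \<in> borel_measurable unif"
  proof -
    interpret sigma_finite_measure "weights ?E" by (rule sigma_finite_weights)
    have "(\<lambda>p. \<Sum>e\<in>?E. h e (snd p, fst p)) \<in> borel_measurable (unif \<Otimes>\<^sub>M weights ?E)"
      using measurable_compose[OF measurable_pair_swap' meas] by (intro borel_measurable_sum) (simp add: case_prod_beta)
    then show ?thesis by (intro borel_measurable_nn_integral) (simp add: case_prod_beta)
  qed
  have m4: "(\<lambda>t. ennreal (1 / (1 - t)) * excess V t) \<in> borel_measurable unif"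
    by (intro borel_measurable_times_ennreal borel_measurable_one_minus borel_measurable_excess assms)
  have AE0: "AE t in unif. (indicator {0..} t :: ennreal) = 1"
    using AE_unif by eventually_elim simp
  have hz: "hazard_integral V 0 = (\<integral>\<^sup>+t. ennreal (1 / (1 - t)) * excess V t \<partial>unif)"
    unfolding hazard_integral_def
    by (rule nn_integral_cong_AE, use AE0 in eventually_elim) simp
  have ex: "2 * excess V 0 = (\<integral>\<^sup>+t. ennreal (1 / (1 - t)) * cross_pairs V t \<partial>unif)"
    unfolding two_excess_eq[OF assms]
    by (rule nn_integral_cong_AE, use AE0 in eventually_elim) simp
  have "path_pairs V + 2 * of_nat (card V) * hazard_integral V 0
      = (\<integral>\<^sup>+t. ennreal (1 / (1 - t)) * (\<integral>\<^sup>+x. (\<Sum>e\<in>?E. h e (x, t)) \<partial>weights ?E) \<partial>unif)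
        + (\<integral>\<^sup>+t. 2 * of_nat (card V) * (ennreal (1 / (1 - t)) * excess V t) \<partial>unif)"
    unfolding lhs [symmetric] hz nn_integral_cmult[OF m4]
    using nn_integral_sum_arrival[of ?E h, OF fin meas zero indep] by simp
  also have "\<dots> = (\<integral>\<^sup>+t. ennreal (1 / (1 - t)) * (\<integral>\<^sup>+x. (\<Sum>e\<in>?E. h e (x, t)) \<partial>weights ?E)
        + 2 * of_nat (card V) * (ennreal (1 / (1 - t)) * excess V t) \<partial>unif)"
    by (intro nn_integral_add [symmetric] borel_measurable_times_ennreal borel_measurable_one_minus m3
        borel_measurable_const borel_measurable_excess assms)
  also have "\<dots> = (\<integral>\<^sup>+t. ennreal (1 / (1 - t)) * (2 * cross_pairs V t) \<partial>unif)"
    unfolding rhs [symmetric] by (simp only: distrib_left mult_ac)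
  also have "\<dots> = (\<integral>\<^sup>+t. 2 * (ennreal (1 / (1 - t)) * cross_pairs V t) \<partial>unif)"
    by (simp only: mult_ac)
  also have "\<dots> = 2 * (\<integral>\<^sup>+t. ennreal (1 / (1 - t)) * cross_pairs V t \<partial>unif)"
  proof (intro nn_integral_cmult borel_measurable_times_ennreal borel_measurable_one_minus)
    interpret sigma_finite_measure "weights ?E" by (rule sigma_finite_weights)
    have "(\<lambda>p. ennreal (\<Sum>v\<in>V. real (card V) - card (component (below ?E (snd p) (fst p)) v)))
        \<in> borel_measurable (unif \<Otimes>\<^sub>M weights ?E)"
      using measurable_compose[OF measurable_pair_swap' borel_measurable_fun_below(1)[OF fin,
          of "\<lambda>S. ennreal (\<Sum>v\<in>V. real (card V) - card (component S v))"]]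
      by (simp add: case_prod_beta)
    then show "cross_pairs V \<in> borel_measurable unif" unfolding cross_pairs_def
      by (intro borel_measurable_nn_integral) (simp add: case_prod_beta)
  qed
  finally show ?thesis unfolding ex [symmetric] by (simp add: mult.assoc [symmetric])
qed

text \<open>Ordered pairs of distinct elements come in two kinds, by which entry is heavier, and
  swapping the entries shows that both kinds are equally many.\<close>

lemma card_squared_ranking:
  fixes x :: "'a \<Rightarrow> real"
  assumes "finite S" "inj_on x S"
  shows "(real (card S))\<^sup>2 = card S + 2 * (\<Sum>e\<in>S. real (card {f \<in> S. x f < x e}))"
proof -
  let ?l = "\<lambda>e. {f \<in> S. x f < x e}" and ?g = "\<lambda>e. {f \<in> S. x e < x f}"
  have "real (card S) = 1 + real (card (?l e)) + real (card (?g e))" if "e \<in> S" for e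
  proof -
    have "S = insert e (?l e \<union> ?g e)" using that assms(2) by (force simp: inj_on_def)
    also have "card \<dots> = Suc (card (?l e \<union> ?g e))" using assms(1) by (intro card_insert_disjoint) auto
    also have "card (?l e \<union> ?g e) = card (?l e) + card (?g e)" using assms(1) by (intro card_Un_disjoint) auto
    finally show ?thesis by simp
  qed
  then have "(\<Sum>e\<in>S. real (card S)) = (\<Sum>e\<in>S. 1 + real (card (?l e)) + real (card (?g e)))"
    by (rule sum.cong[OF refl])
  also have "\<dots> = card S + (\<Sum>e\<in>S. real (card (?l e))) + (\<Sum>e\<in>S. real (card (?g e)))"
    by (simp add: sum.distrib)
  also have "(\<Sum>e\<in>S. real (card (?g e))) = (\<Sum>e\<in>S. real (card (?l e)))"
    using sum.swap_restrict[OF assms(1) assms(1), of "\<lambda>_ _. 1 :: real" "\<lambda>e f. x e < x f"] by simp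
  finally show ?thesis by (simp add: power2_eq_square)
qed

text \<open>\<open>card_squared_ranking\<close> for the edges at each vertex: incident pairs are
  counted at the heavier edge, in the form that \<open>path_pairs\<close> uses.\<close>

lemma sum_degree_squares:
  fixes x :: "nat set \<Rightarrow> real"
  assumes "finite V" "M \<subseteq> edges V" "inj_on x M"
  shows "(\<Sum>v\<in>V. (real (degree_in M v))\<^sup>2)
    = 2 * real (card M) + 2 * (\<Sum>e\<in>M. \<Sum>v\<in>e. real (degree_in {f \<in> M. x f < x e} v))"
proof -
  have fin: "finite M" using assms(1,2) finite_edges finite_subset by blast
  have "(real (degree_in M v))\<^sup>2 = real (degree_in M v)
      + 2 * (\<Sum>e | e \<in> M \<and> v \<in> e. real (degree_in {f \<in> M. x f < x e} v))" for v
  proof -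
    have "{f \<in> {e \<in> M. v \<in> e}. x f < x e} = {f \<in> {f \<in> M. x f < x e}. v \<in> f}" for e by auto
    then show ?thesis
      using card_squared_ranking[of "{e \<in> M. v \<in> e}" x] fin inj_on_subset[OF assms(3), of "{e \<in> M. v \<in> e}"]
      by (simp add: degree_in_def)
  qed
  then have "(\<Sum>v\<in>V. (real (degree_in M v))\<^sup>2) = (\<Sum>v\<in>V. real (degree_in M v))
      + 2 * (\<Sum>v\<in>V. \<Sum>e | e \<in> M \<and> v \<in> e. real (degree_in {f \<in> M. x f < x e} v))"
    by (simp add: sum.distrib sum_distrib_left)
  also have "(\<Sum>v\<in>V. real (degree_in M v)) = 2 * real (card M)"
    using sum_degree_in[OF assms(1,2), of "\<lambda>_. 1"] sum_card_edges[OF assms(2)] by simp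
  also have "(\<Sum>v\<in>V. \<Sum>e | e \<in> M \<and> v \<in> e. real (degree_in {f \<in> M. x f < x e} v))
      = (\<Sum>e\<in>M. \<Sum>v | v \<in> V \<and> v \<in> e. real (degree_in {f \<in> M. x f < x e} v))"
    by (rule sum.swap_restrict[OF assms(1) fin])
  also have "\<dots> = (\<Sum>e\<in>M. \<Sum>v\<in>e. real (degree_in {f \<in> M. x f < x e} v))"
    using edges_subset_Pow assms(2) by (intro sum.cong refl arg_cong2[where f = sum]) auto
  finally show ?thesis .
qed

lemma borel_measurable_degree_kruskal:
  assumes "finite E"
  shows "(\<lambda>x. real (degree_in (kruskal x E) v)) \<in> borel_measurable (weights E)"
proof -
  have "real (degree_in (kruskal x E) v) = (\<Sum>f | f \<in> E \<and> v \<in> f. of_bool (crosses (below E x (x f)) f))" for x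
    using degree_in_eq_sum[OF assms kruskal_subset, of x v] crosses_iff_kruskal by simp
  then show ?thesis
    by (simp only:) (intro borel_measurable_sum borel_measurable_fun_below(3)[OF assms]; simp)
qed

text \<open>The diagonal contributes \<open>2 (n - 1)\<close> and the pairs twice
  \<open>4 (n - 1) - 2 n J\<close>; this is the origin of the constants \<open>10\<close> and
  \<open>4\<close>.\<close>

lemma nn_integral_sum_degree_squares:
  assumes "finite V" "V \<noteq> {}"
  shows "(\<integral>\<^sup>+x. ennreal (\<Sum>v\<in>V. (real (degree_in (kruskal x (edges V)) v))\<^sup>2) \<partial>weights (edges V))
    + 4 * of_nat (card V) * hazard_integral V 0 = ennreal (10 * (real (card V) - 1))"
proof -
  let ?E = "edges V" and ?n = "real (card V)"
  have fin: "finite ?E" using assms(1) by simp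
  have n: "?n \<ge> 1" using assms by (simp add: Suc_le_eq card_gt_0_iff)
  interpret prob_space "weights ?E" by (rule prob_space_weights)
  define p where "p x = (\<Sum>e\<in>kruskal x ?E. \<Sum>v\<in>e. real (degree_in {f \<in> kruskal x ?E. x f < x e} v))" for x
  have p0: "p x \<ge> 0" for x unfolding p_def by (intro sum_nonneg) simp
  have "p = (\<lambda>x. \<Sum>e\<in>?E. of_bool (crosses (below ?E x (x e)) e) * (\<Sum>v\<in>e. real (degree_in {f \<in> kruskal x ?E. x f < x e} v)))"
    unfolding p_def using fin
    by (intro ext sum.mono_neutral_cong_left)
       (auto simp: kruskal_def below_def)
  moreover have "(\<lambda>x. real (degree_in {f \<in> kruskal x ?E. x f < x e} v)) \<in> borel_measurable (weights ?E)" if "e \<in> ?E" for e v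
    using measurable_compose[OF measurable_weights_Pair[OF that] borel_measurable_degree[OF fin]] by simp
  ultimately have pm: "p \<in> borel_measurable (weights ?E)"
    by (simp only:) (intro borel_measurable_sum borel_measurable_times borel_measurable_fun_below(3)[OF fin]; simp)
  have "(\<integral>\<^sup>+x. ennreal (\<Sum>v\<in>V. (real (degree_in (kruskal x ?E) v))\<^sup>2) \<partial>weights ?E)
      = (\<integral>\<^sup>+x. ennreal (2 * (?n - 1)) + 2 * ennreal (p x) \<partial>weights ?E)"
  proof (rule nn_integral_cong_AE)
    show "AE x in weights ?E. ennreal (\<Sum>v\<in>V. (real (degree_in (kruskal x ?E) v))\<^sup>2)
        = ennreal (2 * (?n - 1)) + 2 * ennreal (p x)"
      using AE_weights_generic[OF fin]
    proof eventually_elim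
      case (elim x)
      have "(\<Sum>v\<in>V. (real (degree_in (kruskal x ?E) v))\<^sup>2) = 2 * real (card (kruskal x ?E)) + 2 * p x"
        unfolding p_def using elim inj_on_subset kruskal_subset
        by (intro sum_degree_squares assms(1)) blast+
      also have "real (card (kruskal x ?E)) = ?n - 1"
        using card_kruskal[OF assms(1) order_refl] card_components_complete[OF assms(2)] elim by simp
      finally have "ennreal (\<Sum>v\<in>V. (real (degree_in (kruskal x ?E) v))\<^sup>2)
          = ennreal (2 * (?n - 1)) + ennreal (2 * p x)"
        using n p0[of x] by (simp add: ennreal_plus [symmetric] del: ennreal_plus)
      then show ?case by (simp add: ennreal_mult')
    qed
  qed
  also have "\<dots> = ennreal (2 * (?n - 1)) + 2 * (\<integral>\<^sup>+x. ennreal (p x) \<partial>weights ?E)"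
    using pm by (simp add: nn_integral_add nn_integral_cmult emeasure_space_1)
  also have "(\<integral>\<^sup>+x. ennreal (p x) \<partial>weights ?E) = path_pairs V"
    unfolding path_pairs_def p_def ..
  finally have "(\<integral>\<^sup>+x. ennreal (\<Sum>v\<in>V. (real (degree_in (kruskal x ?E) v))\<^sup>2) \<partial>weights ?E)
      + 4 * of_nat (card V) * hazard_integral V 0
      = ennreal (2 * (?n - 1)) + 2 * (path_pairs V + 2 * of_nat (card V) * hazard_integral V 0)"
    by (simp add: distrib_left mult.assoc [symmetric] add.assoc)
  also have "\<dots> = ennreal (2 * (?n - 1)) + ennreal (8 * (?n - 1))"
  proof -
    have "2 * (4 * ennreal y) = ennreal (8 * y)" for y
      by (simp add: ennreal_mult' mult.assoc [symmetric])
    then show ?thesis unfolding path_pairs_eq[OF assms] excess_0[OF assms] by (simp only:)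
  qed
  also have "\<dots> = ennreal (10 * (?n - 1))"
    using n by (simp add: ennreal_plus [symmetric] del: ennreal_plus)
  finally show ?thesis .
qed

section \<open>Exchangeability of the vertices\<close>

lemma component_image_mono:
  assumes "u \<in> component F v"
  shows "\<pi> u \<in> component ((`) \<pi> ` F) (\<pi> v)"
proof -
  have "component F v \<subseteq> {u. \<pi> u \<in> component ((`) \<pi> ` F) (\<pi> v)}"
  proof (rule closed_component_subset)
    fix a b assume "{a, b} \<in> F" and a: "a \<in> {u. \<pi> u \<in> component ((`) \<pi> ` F) (\<pi> v)}"
    then have "{\<pi> a, \<pi> b} \<in> (`) \<pi> ` F" by (force intro: image_eqI[of _ _ "{a, b}"])
    then have "\<pi> b \<in> component ((`) \<pi> ` F) (\<pi> a)" using edge_component[of "\<pi> a" "\<pi> b"] by simp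
    then show "b \<in> {u. \<pi> u \<in> component ((`) \<pi> ` F) (\<pi> v)}" using a in_component_trans by blast
  qed simp
  then show ?thesis using assms by blast
qed

text \<open>The one-sided inclusion, applied to the image graph, gives the converse because
  \<open>\<pi>\<close> undoes itself.\<close>

lemma component_image_involution:
  assumes "\<And>v. \<pi> (\<pi> v) = v"
  shows "\<pi> u \<in> component ((`) \<pi> ` F) (\<pi> v) \<longleftrightarrow> u \<in> component F v"
proof
  assume "\<pi> u \<in> component ((`) \<pi> ` F) (\<pi> v)"
  from component_image_mono[OF this, of \<pi>] show "u \<in> component F v"
    by (simp add: assms image_image)
qed (rule component_image_mono)

text \<open>Kruskal's rule commutes with relabelling. An involution serves as its own inverse, and
  the restriction to \<open>edges V\<close> keeps the relabelled weights in the product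
  space.\<close>

lemma degree_kruskal_involution:
  assumes inv: "\<And>v. \<pi> (\<pi> v) = v" and V: "\<And>v. v \<in> V \<Longrightarrow> \<pi> v \<in> V"
  shows "degree_in (kruskal (\<lambda>e\<in>edges V. x (\<pi> ` e)) (edges V)) v = degree_in (kruskal x (edges V)) (\<pi> v)"
proof -
  let ?E = "edges V" and ?y = "\<lambda>e\<in>edges V. x (\<pi> ` e)"
  have inj: "\<pi> u = \<pi> v \<Longrightarrow> u = v" for u v using inv by metis
  have mem: "\<pi> ` e \<in> ?E" if "e \<in> ?E" for e
  proof -
    from that obtain u v where "e = {u, v}" "u \<in> V" "v \<in> V" "u \<noteq> v" by (blast elim: edgesE)
    then show ?thesis using V inj by auto
  qed
  have inv': "\<pi> ` \<pi> ` e = e" for e by (simp add: image_image inv)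
  have img: "(`) \<pi> ` {f \<in> ?E. ?y f < c} = {f \<in> ?E. x f < c}" for c
  proof (intro set_eqI iffI)
    fix f assume "f \<in> {f \<in> ?E. x f < c}"
    then have "\<pi> ` f \<in> {f \<in> ?E. ?y f < c}" using mem by (simp add: inv')
    then show "f \<in> (`) \<pi> ` {f \<in> ?E. ?y f < c}" using inv' by (metis image_eqI)
  qed (use mem in auto)
  have iff: "e \<in> kruskal ?y ?E \<longleftrightarrow> \<pi> ` e \<in> kruskal x ?E" if "e \<in> ?E" for e
  proof -
    from that obtain u v where e: "e = {u, v}" by (blast elim: edgesE)
    have pe: "\<pi> ` e = {\<pi> u, \<pi> v}" using e by simp
    have "e \<in> kruskal ?y ?E \<longleftrightarrow> v \<notin> component {f \<in> ?E. ?y f < x (\<pi> ` e)} u"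
      using that by (simp add: kruskal_def) (simp add: e crosses_doubleton)
    also have "\<dots> \<longleftrightarrow> \<pi> v \<notin> component {f \<in> ?E. x f < x (\<pi> ` e)} (\<pi> u)"
      using component_image_involution[OF inv, of v "{f \<in> ?E. ?y f < x (\<pi> ` e)}" u] unfolding img by simp
    also have "\<dots> \<longleftrightarrow> \<pi> ` e \<in> kruskal x ?E"
      using mem[OF that] unfolding pe doubleton_in_kruskal by simp
    finally show ?thesis .
  qed
  have "bij_betw ((`) \<pi>) {e \<in> kruskal ?y ?E. v \<in> e} {e \<in> kruskal x ?E. \<pi> v \<in> e}"
  proof (rule bij_betw_byWitness[where f' = "(`) \<pi>"])
    have k: "e \<in> ?E" if "e \<in> kruskal z ?E" for e z using that kruskal_subset by blast
    show "(`) \<pi> ` {e \<in> kruskal ?y ?E. v \<in> e} \<subseteq> {e \<in> kruskal x ?E. \<pi> v \<in> e}"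
      using iff k by blast
    show "(`) \<pi> ` {e \<in> kruskal x ?E. \<pi> v \<in> e} \<subseteq> {e \<in> kruskal ?y ?E. v \<in> e}"
    proof clarify
      fix e assume e: "e \<in> kruskal x ?E" "\<pi> v \<in> e"
      have "v \<in> \<pi> ` e" using e(2) inv by (metis image_eqI)
      moreover have "\<pi> ` e \<in> kruskal ?y ?E" using iff[OF mem[OF k[OF e(1)]]] e(1) by (simp add: inv')
      ultimately show "\<pi> ` e \<in> kruskal ?y ?E \<and> v \<in> \<pi> ` e" by simp
    qed
  qed (simp_all add: inv')
  then show ?thesis unfolding degree_in_def by (rule bij_betw_same_card)
qed

text \<open>The transposition of \<open>u\<close> and \<open>v\<close> permutes the coordinates of
  the product measure, which is invariant, and exchanges the two degrees.\<close>

lemma nn_integral_degree_exchangeable: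
  fixes f :: "real \<Rightarrow> ennreal"
  assumes "finite V" "u \<in> V" "v \<in> V" "f \<in> borel_measurable borel"
  shows "(\<integral>\<^sup>+x. f (degree_in (kruskal x (edges V)) u) \<partial>weights (edges V))
    = (\<integral>\<^sup>+x. f (degree_in (kruskal x (edges V)) v) \<partial>weights (edges V))"
proof -
  let ?E = "edges V"
  define \<pi> where "\<pi> = Transposition.transpose u v"
  have inv: "\<pi> (\<pi> w) = w" for w by (simp add: \<pi>_def)
  have V: "\<pi> w \<in> V" if "w \<in> V" for w using that assms(2,3) by (auto simp: \<pi>_def Transposition.transpose_def)
  have inj: "a = b" if "\<pi> a = \<pi> b" for a b using inv that by metis
  have mem: "\<pi> ` e \<in> ?E" if "e \<in> ?E" for e
  proof -
    from that obtain a b where "e = {a, b}" "a \<in> V" "b \<in> V" "a \<noteq> b" by (blast elim: edgesE)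
    then show ?thesis using V inj by auto
  qed
  let ?\<Phi> = "\<lambda>x. \<lambda>e\<in>?E. x (\<pi> ` e)"
  have distr: "distr (weights ?E) (weights ?E) ?\<Phi> = weights ?E"
  proof (rule distr_PiM_reindex[of ?E "\<lambda>_. unif" "(`) \<pi>" ?E])
    show "inj_on ((`) \<pi>) ?E" by (rule inj_on_inverseI[where g = "(`) \<pi>"]) (simp add: image_image inv)
    show "(`) \<pi> \<in> ?E \<rightarrow> ?E" using mem by blast
  qed (rule prob_space_unif)
  have \<Phi>: "?\<Phi> \<in> measurable (weights ?E) (weights ?E)"
    by (intro measurable_restrict measurable_component_singleton mem)
  have m: "(\<lambda>x. f (degree_in (kruskal x ?E) v)) \<in> borel_measurable (weights ?E)"
    using measurable_compose[OF borel_measurable_degree_kruskal assms(4)] assms(1) by simp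
  have "(\<integral>\<^sup>+x. f (degree_in (kruskal x ?E) v) \<partial>weights ?E)
      = (\<integral>\<^sup>+x. f (degree_in (kruskal x ?E) v) \<partial>distr (weights ?E) (weights ?E) ?\<Phi>)"
    unfolding distr ..
  also have "\<dots> = (\<integral>\<^sup>+x. f (degree_in (kruskal (?\<Phi> x) ?E) v) \<partial>weights ?E)"
    using m by (intro nn_integral_distr[OF \<Phi>]) (simp add: distr)
  also have "\<dots> = (\<integral>\<^sup>+x. f (degree_in (kruskal x ?E) (\<pi> v)) \<partial>weights ?E)"
    by (intro nn_integral_cong arg_cong[where f = f] arg_cong[where f = real]
        degree_kruskal_involution inv V)
  finally show ?thesis by (simp add: \<pi>_def)
qed

lemma degree_le_card:
  assumes "finite V"
  shows "real (degree_in (kruskal x (edges V)) v) \<le> card (edges V)"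
  using assms kruskal_subset[of x "edges V"] unfolding degree_in_def by (auto intro: card_mono)

lemma expectation_degree:
  assumes "finite V" "v \<in> V"
  shows "card V * (\<integral>x. real (degree_in (kruskal x (edges V)) v) \<partial>weights (edges V)) = 2 * (real (card V) - 1)"
    and "card V * (\<integral>x. (real (degree_in (kruskal x (edges V)) v))\<^sup>2 \<partial>weights (edges V))
      = 10 * (real (card V) - 1) - 4 * card V * enn2real (hazard_integral V 0)"
proof -
  let ?E = "edges V" and ?n = "real (card V)"
  have fin: "finite ?E" and ne: "V \<noteq> {}" using assms by auto
  have n: "?n \<ge> 1" using assms(1) ne by (simp add: Suc_le_eq card_gt_0_iff)
  interpret prob_space "weights ?E" by (rule prob_space_weights)
  let ?d = "\<lambda>x v. real (degree_in (kruskal x ?E) v)"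
  note m = borel_measurable_degree_kruskal[OF fin]
  \<comment> \<open>Exchangeability trades \<open>n\<close> times one vertex for the sum over all
    vertices, whose expectation is known exactly.\<close>
  have exch: "?n * (\<integral>x. f (?d x v) \<partial>weights ?E) = enn2real (\<integral>\<^sup>+x. ennreal (\<Sum>u\<in>V. f (?d x u)) \<partial>weights ?E)"
    if f: "f \<in> borel_measurable borel" "\<And>y. 0 \<le> f y" for f :: "real \<Rightarrow> real"
  proof -
    have fm: "(\<lambda>x. f (?d x u)) \<in> borel_measurable (weights ?E)" for u
      by (rule measurable_compose[OF m f(1)])
    have "(\<integral>\<^sup>+x. ennreal (\<Sum>u\<in>V. f (?d x u)) \<partial>weights ?E) = (\<integral>\<^sup>+x. (\<Sum>u\<in>V. ennreal (f (?d x u))) \<partial>weights ?E)"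
      using f(2) by simp
    also have "\<dots> = (\<Sum>u\<in>V. \<integral>\<^sup>+x. ennreal (f (?d x u)) \<partial>weights ?E)"
      using fm by (intro nn_integral_sum) simp
    also have "\<dots> = (\<Sum>u\<in>V. \<integral>\<^sup>+x. ennreal (f (?d x v)) \<partial>weights ?E)"
      using f(1) by (intro sum.cong refl nn_integral_degree_exchangeable[where f = "\<lambda>y. ennreal (f y)"] assms) auto
    also have "\<dots> = ennreal ?n * (\<integral>\<^sup>+x. ennreal (f (?d x v)) \<partial>weights ?E)"
      by (simp add: ennreal_of_nat_eq_real_of_nat)
    finally have "enn2real (\<integral>\<^sup>+x. ennreal (\<Sum>u\<in>V. f (?d x u)) \<partial>weights ?E)
        = ?n * enn2real (\<integral>\<^sup>+x. ennreal (f (?d x v)) \<partial>weights ?E)"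
      by (simp add: enn2real_mult)
    moreover have "(\<integral>x. f (?d x v) \<partial>weights ?E) = enn2real (\<integral>\<^sup>+x. ennreal (f (?d x v)) \<partial>weights ?E)"
      using f(2) fm by (intro integral_eq_nn_integral) auto
    ultimately show ?thesis by simp
  qed
  \<comment> \<open>\<open>exch\<close> asks for a function that is nonnegative on all reals, so the
    degree enters through its absolute value.\<close>
  have "(\<integral>\<^sup>+x. ennreal (\<Sum>u\<in>V. \<bar>?d x u\<bar>) \<partial>weights ?E) = (\<integral>\<^sup>+x. ennreal (2 * (?n - 1)) \<partial>weights ?E)"
  proof (rule nn_integral_cong_AE)
    show "AE x in weights ?E. ennreal (\<Sum>u\<in>V. \<bar>?d x u\<bar>) = ennreal (2 * (?n - 1))"
      using AE_weights_generic[OF fin]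
    proof eventually_elim
      case (elim x)
      have "(\<Sum>u\<in>V. ?d x u) = 2 * card (kruskal x ?E)"
        using sum_degree_in[OF assms(1) kruskal_subset, of "\<lambda>_. 1" x] sum_card_edges[OF kruskal_subset, of x] by simp
      then show ?case
        using card_kruskal[OF assms(1) order_refl] card_components_complete[OF ne] elim by simp
    qed
  qed
  then show "card V * (\<integral>x. ?d x v \<partial>weights ?E) = 2 * (?n - 1)"
    using exch[of abs] n by (simp add: emeasure_space_1)
  have "hazard_integral V 0 \<le> 2" using hazard_integral_tail(2)[OF assms(1) ne, of 1] by simp
  then obtain j where j: "hazard_integral V 0 = ennreal j" "j \<ge> 0"
    by (cases "hazard_integral V 0") (auto simp: top_unique)
  let ?S = "\<integral>\<^sup>+x. ennreal (\<Sum>u\<in>V. (?d x u)\<^sup>2) \<partial>weights ?E"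
  have S: "?S + ennreal (4 * ?n * j) = ennreal (10 * (?n - 1))"
    using nn_integral_sum_degree_squares[OF assms(1) ne] j
    by (simp add: ennreal_of_nat_eq_real_of_nat ennreal_mult' ennreal_mult'')
  then obtain s where s: "?S = ennreal s" "s \<ge> 0"
    by (cases ?S) auto
  with S j have "s + 4 * ?n * j = 10 * (?n - 1)"
    using n by (simp add: ennreal_plus [symmetric] del: ennreal_plus)
  then show "card V * (\<integral>x. (?d x v)\<^sup>2 \<partial>weights ?E) = 10 * (?n - 1) - 4 * card V * enn2real (hazard_integral V 0)"
    using exch[of "\<lambda>y. y\<^sup>2"] s j by simp
qed

lemma variance_degree:
  assumes "finite V" "v \<in> V"
  shows "prob_space.variance (weights (edges V)) (\<lambda>x. real (degree_in (kruskal x (edges V)) v))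
    = 10 * (1 - 1 / card V) - 4 * enn2real (hazard_integral V 0) - (2 * (1 - 1 / card V))\<^sup>2"
proof -
  let ?E = "edges V" and ?n = "real (card V)"
  have fin: "finite ?E" using assms by auto
  have n: "?n \<ge> 1" using assms by (auto simp: Suc_le_eq card_gt_0_iff)
  interpret prob_space "weights ?E" by (rule prob_space_weights)
  let ?d = "\<lambda>x. real (degree_in (kruskal x ?E) v)"
  note m [measurable] = borel_measurable_degree_kruskal[OF fin, of v]
  have "integrable (weights ?E) ?d"
    by (rule integrable_const_bound[where B = "card ?E"]) (use degree_le_card[OF assms(1)] in auto)
  moreover have "integrable (weights ?E) (\<lambda>x. (?d x)\<^sup>2)"
    by (rule integrable_const_bound[where B = "(card ?E)\<^sup>2"])
       (use power_mono[OF degree_le_card[OF assms(1)], of _ _ 2] in auto)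
  ultimately have "variance ?d = expectation (\<lambda>x. (?d x)\<^sup>2) - (expectation ?d)\<^sup>2"
    by (rule variance_eq)
  moreover have "expectation ?d = 2 * (1 - 1 / ?n)"
    using expectation_degree(1)[OF assms] n by (simp add: field_simps)
  moreover have "expectation (\<lambda>x. (?d x)\<^sup>2) = 10 * (1 - 1 / ?n) - 4 * enn2real (hazard_integral V 0)"
    using expectation_degree(2)[OF assms] n by (simp add: field_simps)
  ultimately show ?thesis by simp
qed

section \<open>Components of a given order\<close>

definition num_components :: "nat set \<Rightarrow> nat set set \<Rightarrow> nat \<Rightarrow> nat" where
  "num_components V S k = card {A \<in> conn_components V S. card A = k}"

text \<open>Cayley's number \<open>k ^ (k - 2)\<close>, in the form that dividing
  \<open>card_labelled_trees_Cayley\<close> by \<open>k\<close> produces.\<close>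

definition num_trees :: "nat \<Rightarrow> real" where
  "num_trees k = real k ^ (k - 1) / real k"

lemma card_labelled_trees:
  assumes "finite A" "A \<noteq> {}"
  shows "real (card (labelled_trees A)) = num_trees (card A)"
proof -
  have "card A > 0" using assms by (simp add: card_gt_0_iff)
  then show ?thesis using card_labelled_trees_Cayley[OF assms] by (simp add: num_trees_def field_simps)
qed

lemma num_components_eq_sum:
  assumes "finite V" "S \<subseteq> edges V"
  shows "num_components V S k = (\<Sum>A | A \<subseteq> V \<and> card A = k. of_bool (A \<in> conn_components V S))"
proof -
  have "{A \<in> conn_components V S. card A = k} = {A. A \<subseteq> V \<and> card A = k} \<inter> {A. A \<in> conn_components V S}"
    using components_subset[OF assms(2)] by auto
  then show ?thesis using assms(1) by (simp add: num_components_def)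
qed

text \<open>Components with more than \<open>K\<close> vertices number at most
  \<open>card V / K\<close>, since their orders add up to at most \<open>card V\<close>.\<close>

lemma card_components_le_small:
  assumes "finite V" "S \<subseteq> edges V" "0 < K"
  shows "real (card (conn_components V S)) \<le> (\<Sum>k=1..K. real (num_components V S k)) + card V / K"
proof -
  let ?C = "conn_components V S"
  let ?small = "{A \<in> ?C. card A \<le> K}" and ?large = "{A \<in> ?C. K < card A}"
  have fin: "finite ?C" using assms(1) by simp
  have pos: "0 < card A" if "A \<in> ?C" for A
    using that components_nonempty components_subset[OF assms(2)] assms(1) finite_subset card_gt_0_iff by metis
  have "card ?C = card (?small \<union> ?large)" by (intro arg_cong[where f = card]) auto
  also have "\<dots> = card ?small + card ?large" using fin by (intro card_Un_disjoint) auto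
  finally have "real (card ?C) = real (card ?small) + card ?large" by simp
  moreover have "card ?small = (\<Sum>k\<in>{1..K}. num_components V S k)"
  proof -
    have "?small = (\<Union>k\<in>{1..K}. {A \<in> ?C. card A = k})" using pos by (force simp: Suc_le_eq)
    also have "card \<dots> = (\<Sum>k\<in>{1..K}. card {A \<in> ?C. card A = k})"
      using fin by (intro card_UN_disjoint) auto
    finally show ?thesis by (simp add: num_components_def)
  qed
  moreover have "real (card ?large) * K \<le> card V"
  proof -
    have "card ?large * K = (\<Sum>A\<in>?large. K)" by simp
    also have "\<dots> \<le> (\<Sum>A\<in>?large. card A)" by (intro sum_mono) auto
    also have "\<dots> \<le> (\<Sum>A\<in>?C. card A)" using fin by (intro sum_mono2) auto
    also have "\<dots> = card V" by (rule sum_card_components[OF assms(1,2)])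
    finally show ?thesis by (metis of_nat_le_iff of_nat_mult)
  qed
  ultimately show ?thesis using assms(3) by (simp add: field_simps)
qed

text \<open>The right-hand side is the sum of \<open>card V - card A\<close> over all components;
  its terms are nonnegative, so the large components may be dropped. This form keeps the
  \<open>- 1\<close> inside nonnegative terms: split off, it would not be integrable against
  \<open>1 / (1 - t)\<close>.\<close>

lemma card_components_ge_small:
  assumes "finite V" "S \<subseteq> edges V"
  shows "(\<Sum>k=1..K. (real (card V) - k) * num_components V S k)
    \<le> real (card V) * (real (card (conn_components V S)) - 1)"
proof -
  let ?C = "conn_components V S"
  have fin: "finite ?C" using assms(1) by simp
  have le: "card A \<le> card V" if "A \<in> ?C" for A
    using that components_subset[OF assms(2)] assms(1) card_mono by blast
  have "(\<Sum>k=1..K. (real (card V) - k) * num_components V S k)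
      = (\<Sum>k\<in>{1..K}. \<Sum>A\<in>{A \<in> ?C. card A = k}. real (card V) - card A)"
    by (intro sum.cong refl) (simp add: num_components_def)
  also have "\<dots> = (\<Sum>A\<in>(\<Union>k\<in>{1..K}. {A \<in> ?C. card A = k}). real (card V) - card A)"
    using fin by (intro sum.UNION_disjoint [symmetric]) auto
  also have "\<dots> \<le> (\<Sum>A\<in>?C. real (card V) - card A)"
    using fin le by (intro sum_mono2) auto
  also have "(\<Sum>A\<in>?C. real (card A)) = card V"
    using sum_card_components[OF assms] by (metis of_nat_sum)
  then have "(\<Sum>A\<in>?C. real (card V) - card A) = real (card V) * (real (card ?C) - 1)"
    by (simp add: sum_subtractf algebra_simps)
  finally show ?thesis .
qed

lemma sets_below_event:
  assumes "finite E"
  shows "{x \<in> space (weights E). T \<subseteq> below E x t \<and> D \<inter> below E x t = {}} \<in> sets (weights E)"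
  using measurable_sets[OF measurable_fun_below1[OF assms, of "\<lambda>S. T \<subseteq> S \<and> D \<inter> S = {}"], of "{True}"]
  by (simp add: vimage_def Int_def conj_commute)

text \<open>The computation common to both bounds: \<open>card V choose k\<close> sets,
  \<open>num_trees k\<close> trees on each, and the same probability for every event.
  \<open>D A T\<close> holds the edges required to be absent.\<close>

lemma sum_trees_events:
  assumes "finite V" "1 \<le> k" "k \<le> card V" "0 \<le> t" "t \<le> 1"
    and D: "\<And>A T. A \<subseteq> V \<Longrightarrow> card A = k \<Longrightarrow> T \<in> labelled_trees A \<Longrightarrow>
      D A T \<subseteq> edges V \<and> T \<inter> D A T = {} \<and> card (D A T) = d"
  shows "(\<integral>\<^sup>+x. (\<Sum>A | A \<subseteq> V \<and> card A = k. \<Sum>T\<in>labelled_trees A.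
      indicator {x \<in> space (weights (edges V)). T \<subseteq> below (edges V) x t \<and> D A T \<inter> below (edges V) x t = {}} x)
      \<partial>weights (edges V))
    = ennreal (real (card V choose k) * num_trees k * (t ^ (k - 1) * (1 - t) ^ d))"
proof -
  let ?E = "edges V" and ?S = "{A. A \<subseteq> V \<and> card A = k}"
  let ?ev = "\<lambda>A T. {x \<in> space (weights ?E). T \<subseteq> below ?E x t \<and> D A T \<inter> below ?E x t = {}}"
  let ?c = "t ^ (k - 1) * (1 - t) ^ d"
  have fin: "finite ?E" "finite ?S" using assms(1) by auto
  have A: "finite A" "A \<noteq> {}" if "A \<in> ?S" for A
    using that assms(1,2) finite_subset by auto
  have em: "emeasure (weights ?E) (?ev A T) = ennreal ?c" if "A \<in> ?S" "T \<in> labelled_trees A" for A T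
  proof -
    have T: "T \<subseteq> edges A" "card T = k - 1" using that unfolding forests_def by auto
    then have "T \<subseteq> ?E" using that(1) edges_mono by blast
    then show ?thesis using emeasure_below[OF fin(1), of T "D A T" t] D[of A T] that T(2) assms(4,5) by simp
  qed
  have m: "?ev A T \<in> sets (weights ?E)" for A T by (rule sets_below_event[OF fin(1)])
  have "(\<integral>\<^sup>+x. (\<Sum>A\<in>?S. \<Sum>T\<in>labelled_trees A. indicator (?ev A T) x) \<partial>weights ?E)
      = (\<Sum>A\<in>?S. \<Sum>T\<in>labelled_trees A. \<integral>\<^sup>+x. indicator (?ev A T) x \<partial>weights ?E)"
    using m by (subst nn_integral_sum) (auto simp: nn_integral_sum borel_measurable_sum)
  also have "\<dots> = (\<Sum>A\<in>?S. \<Sum>T\<in>labelled_trees A. ennreal ?c)"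
    using em m by (intro sum.cong refl) simp
  also have "\<dots> = (\<Sum>A\<in>?S. ennreal (num_trees k * ?c))"
  proof (rule sum.cong[OF refl])
    fix A assume "A \<in> ?S"
    then show "(\<Sum>T\<in>labelled_trees A. ennreal ?c) = ennreal (num_trees k * ?c)"
      using card_labelled_trees[OF A] assms(4,5)
      by (simp add: ennreal_of_nat_eq_real_of_nat ennreal_mult'' [symmetric])
  qed
  also have "\<dots> = ennreal (real (card V choose k) * num_trees k * ?c)"
    using n_subsets[OF assms(1), of k] by (simp add: ennreal_of_nat_eq_real_of_nat ennreal_mult' [symmetric] mult.assoc)
  finally show ?thesis .
qed

text \<open>Union bound over the trees that may span the component, with only the boundary edges
  required to be absent.\<close>

lemma expectation_num_components_le:
  assumes "finite V" "1 \<le> k" "k \<le> card V" "0 \<le> t" "t \<le> 1"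
  shows "(\<integral>\<^sup>+x. of_nat (num_components V (below (edges V) x t) k) \<partial>weights (edges V))
    \<le> ennreal (real (card V choose k) * num_trees k * (t ^ (k - 1) * (1 - t) ^ (k * (card V - k))))"
proof -
  let ?E = "edges V" and ?S = "{A. A \<subseteq> V \<and> card A = k}"
  have D: "edge_boundary V A \<subseteq> ?E \<and> T \<inter> edge_boundary V A = {} \<and> card (edge_boundary V A) = k * (card V - k)"
    if "A \<subseteq> V" "card A = k" "T \<in> labelled_trees A" for A T
  proof -
    have "T \<subseteq> edges A" using that unfolding forests_def by auto
    then show ?thesis using that edge_boundary_subset edges_Int_edge_boundary[of A V] card_edge_boundary[OF assms(1)] by auto
  qed
  have "(\<integral>\<^sup>+x. of_nat (num_components V (below ?E x t) k) \<partial>weights ?E)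
    \<le> (\<integral>\<^sup>+x. (\<Sum>A\<in>?S. \<Sum>T\<in>labelled_trees A.
        indicator {x \<in> space (weights ?E). T \<subseteq> below ?E x t \<and> edge_boundary V A \<inter> below ?E x t = {}} x) \<partial>weights ?E)"
  proof (rule nn_integral_mono)
    fix x assume x: "x \<in> space (weights ?E)"
    have "(of_bool (A \<in> conn_components V (below ?E x t)) :: ennreal)
      \<le> (\<Sum>T\<in>labelled_trees A. indicator {x \<in> space (weights ?E). T \<subseteq> below ?E x t \<and> edge_boundary V A \<inter> below ?E x t = {}} x)"
      if "A \<in> ?S" for A
    proof (cases "A \<in> conn_components V (below ?E x t)")
      case True
      then obtain T where T: "T \<in> labelled_trees A" "T \<subseteq> below ?E x t" "edge_boundary V A \<inter> below ?E x t = {}"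
        using component_has_tree[OF assms(1) below_subset] by blast
      have "finite A" using that assms(1) finite_subset by blast
      then have "finite (labelled_trees A)" by simp
      then have "indicator {x \<in> space (weights ?E). T \<subseteq> below ?E x t \<and> edge_boundary V A \<inter> below ?E x t = {}} x
        \<le> (\<Sum>T\<in>labelled_trees A. indicator {x \<in> space (weights ?E). T \<subseteq> below ?E x t \<and> edge_boundary V A \<inter> below ?E x t = {}} x :: ennreal)"
        using T(1) by (intro member_le_sum) auto
      then show ?thesis using True T x by simp
    qed simp
    then show "of_nat (num_components V (below ?E x t) k)
      \<le> (\<Sum>A\<in>?S. \<Sum>T\<in>labelled_trees A.
        indicator {x \<in> space (weights ?E). T \<subseteq> below ?E x t \<and> edge_boundary V A \<inter> below ?E x t = {}} x :: ennreal)"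
      unfolding num_components_eq_sum[OF assms(1) below_subset] of_nat_sum of_nat_of_bool
      by (rule sum_mono)
  qed
  also have "\<dots> = ennreal (real (card V choose k) * num_trees k * (t ^ (k - 1) * (1 - t) ^ (k * (card V - k))))"
    by (rule sum_trees_events[OF assms D])
  finally show ?thesis .
qed

text \<open>Requiring also that the other edges inside \<open>A\<close> are absent makes the events
  for different trees disjoint, so each component that is a tree is counted exactly once. Inside
  \<open>A\<close> there are \<open>k choose 2\<close> edges, of which the tree uses
  \<open>k - 1\<close>.\<close>

lemma expectation_num_components_ge:
  assumes "finite V" "1 \<le> k" "k \<le> card V" "0 \<le> t" "t \<le> 1"
  shows "ennreal (real (card V choose k) * num_trees k
      * (t ^ (k - 1) * (1 - t) ^ (k * (card V - k) + ((k choose 2) - (k - 1)))))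
    \<le> (\<integral>\<^sup>+x. of_nat (num_components V (below (edges V) x t) k) \<partial>weights (edges V))"
proof -
  let ?E = "edges V" and ?S = "{A. A \<subseteq> V \<and> card A = k}"
  let ?D = "\<lambda>A T. edge_boundary V A \<union> (edges A - T)"
  let ?ev = "\<lambda>A T. {x \<in> space (weights ?E). T \<subseteq> below ?E x t \<and> ?D A T \<inter> below ?E x t = {}}"
  have D: "?D A T \<subseteq> ?E \<and> T \<inter> ?D A T = {} \<and> card (?D A T) = k * (card V - k) + ((k choose 2) - (k - 1))"
    if A: "A \<subseteq> V" "card A = k" "T \<in> labelled_trees A" for A T
  proof -
    have fA: "finite A" using A(1) assms(1) finite_subset by blast
    have T: "T \<subseteq> edges A" "card T = k - 1" using A unfolding forests_def by auto
    have "finite (edges A)" using fA by simp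
    moreover have "finite (edge_boundary V A)" using edge_boundary_subset[OF A(1)] assms(1) finite_edges finite_subset by blast
    ultimately have "card (?D A T) = card (edge_boundary V A) + card (edges A - T)"
      using edges_Int_edge_boundary[of A V] by (intro card_Un_disjoint) auto
    also have "card (edges A - T) = (k choose 2) - (k - 1)"
      using T fA card_edges[OF fA] A(2) by (subst card_Diff_subset) (auto intro: finite_subset)
    finally show ?thesis
      using T edge_boundary_subset[OF A(1)] edges_Int_edge_boundary[of A V] card_edge_boundary[OF assms(1) A(1)] A(2) edges_mono[OF A(1)] by auto
  qed
  have "ennreal (real (card V choose k) * num_trees k
      * (t ^ (k - 1) * (1 - t) ^ (k * (card V - k) + ((k choose 2) - (k - 1)))))
    = (\<integral>\<^sup>+x. (\<Sum>A\<in>?S. \<Sum>T\<in>labelled_trees A. indicator (?ev A T) x) \<partial>weights ?E)"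
    by (rule sum_trees_events[OF assms D, symmetric])
  also have "\<dots> \<le> (\<integral>\<^sup>+x. of_nat (num_components V (below ?E x t) k) \<partial>weights ?E)"
  proof (rule nn_integral_mono)
    fix x assume x: "x \<in> space (weights ?E)"
    let ?B = "below ?E x t"
    have "(\<Sum>T\<in>labelled_trees A. indicator (?ev A T) x) \<le> (of_bool (A \<in> conn_components V ?B) :: ennreal)"
      if "A \<in> ?S" for A
    proof (cases "\<exists>T\<in>labelled_trees A. x \<in> ?ev A T")
      case False
      then show ?thesis by (simp add: sum.neutral)
    next
      case True
      then obtain T where T: "T \<in> labelled_trees A" "T \<subseteq> ?B" "?D A T \<inter> ?B = {}" by auto
      have A: "A \<subseteq> V" "finite A" "A \<noteq> {}" using that assms(1,2) finite_subset by auto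
      have mem: "A \<in> conn_components V ?B"
        by (rule tree_component[OF A(1-3) T(1,2) _ below_subset]) (use T(3) in blast)
      \<comment> \<open>The tree is determined by the weights: it consists of all edges present
        inside \<open>A\<close>.\<close>
      have uniq: "T' = edges A \<inter> ?B" if "T' \<in> labelled_trees A" "x \<in> ?ev A T'" for T'
      proof -
        have "T' \<subseteq> edges A" using that(1) unfolding forests_def by auto
        then show ?thesis using that(2) by auto
      qed
      have "(\<Sum>T\<in>labelled_trees A. indicator (?ev A T) x) \<le> (\<Sum>T\<in>labelled_trees A. of_bool (T = edges A \<inter> ?B) :: ennreal)"
      proof (rule sum_mono)
        fix T assume T': "T \<in> labelled_trees A"
        show "indicator (?ev A T) x \<le> (of_bool (T = edges A \<inter> ?B) :: ennreal)"
        proof (cases "T = edges A \<inter> ?B")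
          case True
          show ?thesis unfolding of_bool_def if_P[OF True] by (simp only: indicator_def of_bool_def) simp
        next
          case False
          then have "x \<notin> ?ev A T" using uniq T' by blast
          then have "indicator (?ev A T) x = (0 :: ennreal)" by (rule indicator_simps(2))
          then show ?thesis by (simp only: zero_le)
        qed
      qed
      also have "\<dots> \<le> 1" using A(2) by (simp add: of_bool_def)
      finally show ?thesis using mem by simp
    qed
    then show "(\<Sum>A\<in>?S. \<Sum>T\<in>labelled_trees A. indicator (?ev A T) x) \<le> (of_nat (num_components V ?B k) :: ennreal)"
      unfolding num_components_eq_sum[OF assms(1) below_subset] of_nat_sum of_nat_of_bool
      by (rule sum_mono)
  qed
  finally show ?thesis .
qed

section \<open>Frieze's theorem\<close>

lemma nn_integral_unif_beta:
  "(\<integral>\<^sup>+t. ennreal (t ^ a * (1 - t) ^ b) \<partial>unif) = ennreal (fact a * fact b / fact (a + b + 1))"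
proof -
  have "((\<lambda>t. t powr (real a + 1 - 1) * (1 - t) powr (real b + 1 - 1)) has_integral Beta (real a + 1) (real b + 1)) {0..1}"
    by (rule has_integral_Beta_real) auto
  moreover have "Beta (real a + 1) (real b + 1) = fact a * fact b / fact (a + b + 1)"
  proof -
    have "Gamma (real a + 1) = fact a" "Gamma (real b + 1) = fact b"
      using Gamma_fact[of a, where ?'a = real] Gamma_fact[of b, where ?'a = real] by (simp_all add: add.commute)
    moreover have "real a + 1 + (real b + 1) = 1 + real (a + b + 1)" by simp
    then have "Gamma (real a + 1 + (real b + 1)) = fact (a + b + 1)"
      using Gamma_fact[of "a + b + 1", where ?'a = real] by metis
    ultimately show ?thesis unfolding Beta_def by simp
  qed
  ultimately have "((\<lambda>t. t powr real a * (1 - t) powr real b) has_integral fact a * fact b / fact (a + b + 1)) {0..1}"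
    by simp
  \<comment> \<open>\<open>powr\<close> and natural powers disagree at base zero with exponent zero,
    so the two end points are excepted.\<close>
  then have I: "((\<lambda>t. t ^ a * (1 - t) ^ b) has_integral fact a * fact b / fact (a + b + 1)) {0..1::real}"
    by (rule has_integral_spike_finite[of "{0, 1}", rotated 2]) (auto simp: powr_realpow)
  have "(\<integral>\<^sup>+t. ennreal (indicator {0..1} t * (t ^ a * (1 - t) ^ b)) \<partial>lborel) = ennreal (fact a * fact b / fact (a + b + 1))"
    by (rule nn_integral_has_integral_lebesgue[OF _ I]) auto
  moreover have "ennreal (indicator {0..1} t * (t ^ a * (1 - t) ^ b)) = ennreal (t ^ a * (1 - t) ^ b) * indicator {0..1} t" for t :: real
    by (auto split: split_indicator)
  ultimately show ?thesis
    by (subst nn_integral_uniform_measure) (simp_all add: divide_ennreal_def)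
qed

text \<open>The integral against \<open>dt / (1 - t)\<close> of the expected number of components of order \<open>k\<close> of the random graph
  on \<open>n\<close> vertices, computed as if each of them were a tree; \<open>d\<close> is the number of further edges inside
  the component that are required to be absent.\<close>

definition size_integral :: "nat \<Rightarrow> nat \<Rightarrow> nat \<Rightarrow> real" where
  "size_integral n k d = real (n choose k) * num_trees k
     * (fact (k - 1) * fact (k * (n - k) + d - 1) / fact (k * (n - k) + d + k - 1))"

lemma num_trees_nonneg: "num_trees k \<ge> 0"
  by (simp add: num_trees_def)

lemma size_integral_nonneg: "size_integral n k d \<ge> 0"
  by (simp add: size_integral_def num_trees_nonneg)

text \<open>The hazard rate lowers the exponent of \<open>1 - t\<close> by one and leaves a beta
  integral. The condition \<open>k < n\<close> makes that exponent at least one; for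
  \<open>k = n\<close> and \<open>d = 0\<close> the integral would diverge.\<close>

lemma nn_integral_size:
  assumes "1 \<le> k" "k < n"
  shows "(\<integral>\<^sup>+t. ennreal (1 / (1 - t)) * ennreal (real (n choose k) * num_trees k
      * (t ^ (k - 1) * (1 - t) ^ (k * (n - k) + d))) \<partial>unif) = ennreal (size_integral n k d)"
proof -
  let ?b = "k * (n - k) + d"
  have b: "Suc (?b - 1) = ?b" using assms by (cases ?b) auto
  have "(\<integral>\<^sup>+t. ennreal (1 / (1 - t)) * ennreal (real (n choose k) * num_trees k
      * (t ^ (k - 1) * (1 - t) ^ ?b)) \<partial>unif)
    = (\<integral>\<^sup>+t. ennreal (real (n choose k) * num_trees k) * ennreal (t ^ (k - 1) * (1 - t) ^ (?b - 1)) \<partial>unif)"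
  proof (rule nn_integral_cong_AE)
    show "AE t in unif. ennreal (1 / (1 - t)) * ennreal (real (n choose k) * num_trees k
      * (t ^ (k - 1) * (1 - t) ^ ?b))
      = ennreal (real (n choose k) * num_trees k) * ennreal (t ^ (k - 1) * (1 - t) ^ (?b - 1))"
      using AE_unif
    proof eventually_elim
      case (elim t)
      have "(1 - t) ^ ?b = (1 - t) * (1 - t) ^ (?b - 1)" using b by (metis power_Suc)
      then have "1 / (1 - t) * (real (n choose k) * num_trees k * (t ^ (k - 1) * (1 - t) ^ ?b))
        = real (n choose k) * num_trees k * (t ^ (k - 1) * (1 - t) ^ (?b - 1))"
        using elim by simp
      moreover have "0 \<le> 1 / (1 - t)" "0 \<le> real (n choose k) * num_trees k"
        using elim num_trees_nonneg[of k] by simp_all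
      ultimately show ?case by (simp only: ennreal_mult' [symmetric])
    qed
  qed
  also have "\<dots> = ennreal (real (n choose k) * num_trees k) * (\<integral>\<^sup>+t. ennreal (t ^ (k - 1) * (1 - t) ^ (?b - 1)) \<partial>unif)"
  proof (rule nn_integral_cmult)
    have "(\<lambda>t::real. ennreal (t ^ (k - 1) * (1 - t) ^ (?b - 1))) \<in> borel_measurable borel" by measurable
    then show "(\<lambda>t. ennreal (t ^ (k - 1) * (1 - t) ^ (?b - 1))) \<in> borel_measurable unif"
      by (simp cong: measurable_cong_sets)
  qed
  also have "\<dots> = ennreal (size_integral n k d)"
  proof -
    have e: "k - 1 + (?b - 1) + 1 = ?b + k - 1" using b assms(1) by linarith
    show ?thesis unfolding nn_integral_unif_beta e size_integral_def
      by (rule ennreal_mult' [symmetric]) (simp add: num_trees_nonneg)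
  qed
  finally show ?thesis .
qed

text \<open>The \<open>- 1\<close> is discarded and large components are bounded by
  \<open>card V / K\<close>. Against the hazard rate both losses are affordable only up to a time
  \<open>s < 1\<close>, where the bound is used.\<close>

lemma excess_le_sizes:
  assumes "finite V" "0 < K" "K \<le> card V" "0 \<le> t" "t \<le> 1"
  shows "excess V t \<le> (\<Sum>k=1..K. ennreal (real (card V choose k) * num_trees k
      * (t ^ (k - 1) * (1 - t) ^ (k * (card V - k))))) + ennreal (card V / K)"
proof -
  let ?E = "edges V"
  interpret prob_space "weights ?E" by (rule prob_space_weights)
  have fin: "finite ?E" using assms(1) by simp
  have m: "(\<lambda>x. of_nat (num_components V (below ?E x t) k) :: ennreal) \<in> borel_measurable (weights ?E)" for k
    by (rule borel_measurable_fun_below(2)[OF fin])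
  have "excess V t \<le> (\<integral>\<^sup>+x. (\<Sum>k=1..K. of_nat (num_components V (below ?E x t) k)) + ennreal (card V / K) \<partial>weights ?E)"
    unfolding excess_def
  proof (rule nn_integral_mono)
    fix x
    have "ennreal (real (card (conn_components V (below ?E x t))) - 1)
      \<le> ennreal ((\<Sum>k=1..K. real (num_components V (below ?E x t) k)) + card V / K)"
      using card_components_le_small[OF assms(1) below_subset[of "edges V" x t] assms(2)] by (intro ennreal_leI) linarith
    also have "\<dots> = ennreal (\<Sum>k=1..K. real (num_components V (below ?E x t) k)) + ennreal (card V / K)"
      by (rule ennreal_plus) (simp_all add: sum_nonneg)
    also have "ennreal (\<Sum>k=1..K. real (num_components V (below ?E x t) k)) = (\<Sum>k=1..K. of_nat (num_components V (below ?E x t) k))"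
      by (simp only: ennreal_of_nat_eq_real_of_nat) (rule sum_ennreal [symmetric], simp)
    finally show "ennreal (real (card (conn_components V (below ?E x t))) - 1)
      \<le> (\<Sum>k=1..K. of_nat (num_components V (below ?E x t) k)) + ennreal (card V / K)" .
  qed
  also have "\<dots> = (\<Sum>k=1..K. \<integral>\<^sup>+x. of_nat (num_components V (below ?E x t) k) \<partial>weights ?E) + ennreal (card V / K)"
    using m by (simp add: nn_integral_add nn_integral_sum emeasure_space_1)
  also have "\<dots> \<le> (\<Sum>k=1..K. ennreal (real (card V choose k) * num_trees k
      * (t ^ (k - 1) * (1 - t) ^ (k * (card V - k))))) + ennreal (card V / K)"
  proof (rule add_right_mono, rule sum_mono)
    fix k assume "k \<in> {1..K}"
    then show "(\<integral>\<^sup>+x. of_nat (num_components V (below ?E x t) k) \<partial>weights ?E)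
      \<le> ennreal (real (card V choose k) * num_trees k * (t ^ (k - 1) * (1 - t) ^ (k * (card V - k))))"
      using assms by (intro expectation_num_components_le) auto
  qed
  finally show ?thesis .
qed

text \<open>\<open>card_components_ge_small\<close> divided by \<open>card V\<close>, whence the
  weights \<open>1 - k / card V\<close>, which tend to one.\<close>

lemma excess_ge_sizes:
  assumes "finite V" "V \<noteq> {}" "K \<le> card V" "0 \<le> t" "t \<le> 1"
  shows "(\<Sum>k=1..K. ennreal (1 - real k / card V) * ennreal (real (card V choose k) * num_trees k
      * (t ^ (k - 1) * (1 - t) ^ (k * (card V - k) + ((k choose 2) - (k - 1)))))) \<le> excess V t"
proof -
  let ?E = "edges V"
  have n: "card V > 0" using assms by (simp add: card_gt_0_iff)
  have fin: "finite ?E" using assms(1) by simp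
  have m: "(\<lambda>x. of_nat (num_components V (below ?E x t) k) :: ennreal) \<in> borel_measurable (weights ?E)" for k
    by (rule borel_measurable_fun_below(2)[OF fin])
  have "(\<Sum>k=1..K. ennreal (1 - real k / card V) * ennreal (real (card V choose k) * num_trees k
      * (t ^ (k - 1) * (1 - t) ^ (k * (card V - k) + ((k choose 2) - (k - 1))))))
    \<le> (\<Sum>k=1..K. ennreal (1 - real k / card V) * (\<integral>\<^sup>+x. of_nat (num_components V (below ?E x t) k) \<partial>weights ?E))"
  proof (rule sum_mono, rule mult_left_mono)
    fix k assume "k \<in> {1..K}"
    then show "ennreal (real (card V choose k) * num_trees k
        * (t ^ (k - 1) * (1 - t) ^ (k * (card V - k) + ((k choose 2) - (k - 1)))))
      \<le> (\<integral>\<^sup>+x. of_nat (num_components V (below ?E x t) k) \<partial>weights ?E)"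
      using assms by (intro expectation_num_components_ge) auto
  qed simp
  also have "\<dots> = (\<integral>\<^sup>+x. (\<Sum>k=1..K. ennreal (1 - real k / card V) * of_nat (num_components V (below ?E x t) k)) \<partial>weights ?E)"
    by (subst nn_integral_sum)
       (auto intro!: borel_measurable_times_ennreal m sum.cong nn_integral_cmult [symmetric])
  also have "\<dots> \<le> excess V t"
    unfolding excess_def
  proof (rule nn_integral_mono)
    fix x
    let ?N = "\<lambda>k. real (num_components V (below ?E x t) k)"
    have nn: "0 \<le> 1 - real k / card V" if "k \<in> {1..K}" for k using that assms(3) n by simp
    have "(\<Sum>k=1..K. ennreal (1 - real k / card V) * of_nat (num_components V (below ?E x t) k))
      = (\<Sum>k=1..K. ennreal ((1 - real k / card V) * ?N k))"
      by (intro sum.cong refl) (simp only: ennreal_of_nat_eq_real_of_nat, rule ennreal_mult'' [symmetric], simp)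
    also have "\<dots> = ennreal (\<Sum>k=1..K. (1 - real k / card V) * ?N k)"
      using nn by (intro sum_ennreal mult_nonneg_nonneg) auto
    also have "(\<Sum>k=1..K. (1 - real k / card V) * ?N k) = (\<Sum>k=1..K. (real (card V) - k) * ?N k) / card V"
      unfolding sum_divide_distrib using n by (intro sum.cong refl) (simp add: field_simps)
    also have "ennreal \<dots> \<le> ennreal (real (card (conn_components V (below ?E x t))) - 1)"
      using card_components_ge_small[OF assms(1) below_subset[of "edges V" x t], of K] n
      by (intro ennreal_leI) (simp add: divide_le_eq mult.commute)
    finally show "(\<Sum>k=1..K. ennreal (1 - real k / card V) * of_nat (num_components V (below ?E x t) k))
      \<le> ennreal (real (card (conn_components V (below ?E x t))) - 1)" .
  qed
  finally show ?thesis .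
qed

lemma borel_measurable_size [measurable]:
  "(\<lambda>t. ennreal (1 / (1 - t)) * ennreal (c * (t ^ a * (1 - t) ^ b))) \<in> borel_measurable unif"
proof -
  have "(\<lambda>t::real. ennreal (1 / (1 - t)) * ennreal (c * (t ^ a * (1 - t) ^ b))) \<in> borel_measurable borel"
    by measurable
  then show ?thesis by (simp cong: measurable_cong_sets)
qed

text \<open>Split at \<open>s\<close>, with \<open>excess_le_sizes\<close> before and
  \<open>hazard_integral_tail\<close> after. The tree terms may be integrated over the whole
  interval, whereas the constant \<open>card V / K\<close> has to stop at \<open>s\<close>.\<close>

lemma hazard_integral_upper:
  fixes s :: real
  assumes "finite V" "0 < K" "K < card V" "0 < s" "s < 1"
  shows "hazard_integral V 0
    \<le> ennreal ((\<Sum>k=1..K. size_integral (card V) k 0) + card V / K * (s / (1 - s)) + 4 / (card V * s))"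
proof -
  let ?n = "card V"
  have ne: "V \<noteq> {}" using assms by auto
  let ?h = "\<lambda>t. ennreal (1 / (1 - t)) * excess V t"
  let ?b = "\<lambda>k t. ennreal (1 / (1 - t)) * ennreal (real (?n choose k) * num_trees k
      * (t ^ (k - 1) * (1 - t) ^ (k * (?n - k) + 0)))"
  let ?c = "ennreal (?n / K / (1 - s))"
  have hm: "?h \<in> borel_measurable unif"
    by (intro borel_measurable_times_ennreal borel_measurable_one_minus borel_measurable_excess assms)
  have "hazard_integral V 0 = (\<integral>\<^sup>+t. ?h t * indicator {..<s} t + ?h t * indicator {s..} t \<partial>unif)"
    unfolding hazard_integral_def
    by (rule nn_integral_cong_AE, use AE_unif in eventually_elim) (auto split: split_indicator)
  also have "\<dots> = (\<integral>\<^sup>+t. ?h t * indicator {..<s} t \<partial>unif) + hazard_integral V s"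
    unfolding hazard_integral_def using hm by (intro nn_integral_add) auto
  finally have split: "hazard_integral V 0 = (\<integral>\<^sup>+t. ?h t * indicator {..<s} t \<partial>unif) + hazard_integral V s" .
  have "(\<integral>\<^sup>+t. ?h t * indicator {..<s} t \<partial>unif) \<le> (\<integral>\<^sup>+t. (\<Sum>k=1..K. ?b k t) + ?c * indicator {..<s} t \<partial>unif)"
  proof (rule nn_integral_mono_AE)
    show "AE t in unif. ?h t * indicator {..<s} t \<le> (\<Sum>k=1..K. ?b k t) + ?c * indicator {..<s} t"
      using AE_unif
    proof eventually_elim
      case (elim t)
      show ?case
      proof (cases "t < s")
        case True
        have "?h t \<le> ennreal (1 / (1 - t)) * ((\<Sum>k=1..K. ennreal (real (?n choose k) * num_trees k
            * (t ^ (k - 1) * (1 - t) ^ (k * (?n - k))))) + ennreal (?n / K))"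
          using assms elim by (intro mult_left_mono excess_le_sizes) auto
        also have "\<dots> = (\<Sum>k=1..K. ?b k t) + ennreal (1 / (1 - t)) * ennreal (?n / K)"
          by (simp only: distrib_left sum_distrib_left add_0_right)
        finally have "?h t \<le> (\<Sum>k=1..K. ?b k t) + ennreal (1 / (1 - t)) * ennreal (?n / K)" .
        moreover have "ennreal (1 / (1 - t)) * ennreal (?n / K) \<le> ?c"
        proof -
          have "1 / (1 - t) * (?n / K) \<le> ?n / K / (1 - s)"
            using True assms elim by (simp add: frac_le)
          then show ?thesis using elim by (subst ennreal_mult [symmetric]) (auto intro!: ennreal_leI)
        qed
        ultimately have "?h t \<le> (\<Sum>k=1..K. ?b k t) + ?c"
          by (rule order_trans[OF _ add_left_mono])
        then show ?thesis using True by simp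
      qed simp
    qed
  qed
  also have "(\<integral>\<^sup>+t. (\<Sum>k=1..K. ?b k t) + ?c * indicator {..<s} t \<partial>unif)
      = (\<Sum>k=1..K. \<integral>\<^sup>+t. ?b k t \<partial>unif) + ?c * ennreal s"
  proof -
    have "(\<integral>\<^sup>+t. ?c * indicator {..<s} t \<partial>unif) = ?c * ennreal s"
      using assms emeasure_unif_lessThan[of s] by (subst nn_integral_cmult_indicator) auto
    moreover have "(\<integral>\<^sup>+t. (\<Sum>k=1..K. ?b k t) \<partial>unif) = (\<Sum>k=1..K. \<integral>\<^sup>+t. ?b k t \<partial>unif)"
      by (rule nn_integral_sum) (rule borel_measurable_size)
    ultimately show ?thesis
      by (subst nn_integral_add) (auto intro!: borel_measurable_sum borel_measurable_size)
  qed
  also have "\<dots> = ennreal (\<Sum>k=1..K. size_integral ?n k 0) + ennreal (?n / K * (s / (1 - s)))"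
  proof (rule arg_cong2[where f = "(+)"])
    have "(\<Sum>k=1..K. \<integral>\<^sup>+t. ?b k t \<partial>unif) = (\<Sum>k=1..K. ennreal (size_integral ?n k 0))"
      by (rule sum.cong[OF refl], rule nn_integral_size) (use assms in auto)
    then show "(\<Sum>k=1..K. \<integral>\<^sup>+t. ?b k t \<partial>unif) = ennreal (\<Sum>k=1..K. size_integral ?n k 0)"
      by (simp only: sum_ennreal size_integral_nonneg)
    show "?c * ennreal s = ennreal (?n / K * (s / (1 - s)))"
      using assms by (subst ennreal_mult [symmetric]) auto
  qed
  finally have early: "(\<integral>\<^sup>+t. ?h t * indicator {..<s} t \<partial>unif)
    \<le> ennreal (\<Sum>k=1..K. size_integral ?n k 0) + ennreal (?n / K * (s / (1 - s)))" .
  have late: "hazard_integral V s \<le> ennreal (4 / (?n * s))"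
    using hazard_integral_tail(1)[OF assms(1) ne] assms by simp
  have "0 \<le> (\<Sum>k=1..K. size_integral ?n k 0)" "0 \<le> ?n / K * (s / (1 - s))" "0 \<le> 4 / (?n * s)"
    using assms by (simp_all add: sum_nonneg size_integral_nonneg)
  then have "ennreal ((\<Sum>k=1..K. size_integral ?n k 0) + ?n / K * (s / (1 - s)) + 4 / (?n * s))
      = ennreal (\<Sum>k=1..K. size_integral ?n k 0) + ennreal (?n / K * (s / (1 - s))) + ennreal (4 / (?n * s))"
    by (simp only: ennreal_plus add_nonneg_nonneg)
  then show ?thesis unfolding split using add_mono[OF early late] by (simp only:)
qed

lemma hazard_integral_lower:
  assumes "finite V" "K < card V"
  shows "ennreal (\<Sum>k=1..K. (1 - real k / card V) * size_integral (card V) k ((k choose 2) - (k - 1))) \<le> hazard_integral V 0"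
proof -
  let ?n = "card V" and ?d = "\<lambda>k. (k choose 2) - (k - 1)"
  have ne: "V \<noteq> {}" using assms by auto
  let ?b = "\<lambda>k t. ennreal (1 / (1 - t)) * ennreal (real (?n choose k) * num_trees k
      * (t ^ (k - 1) * (1 - t) ^ (k * (?n - k) + ?d k)))"
  have nn: "0 \<le> 1 - real k / ?n" if "k \<in> {1..K}" for k using that assms(2) by simp
  have "ennreal (\<Sum>k=1..K. (1 - real k / ?n) * size_integral ?n k (?d k))
      = (\<Sum>k=1..K. ennreal (1 - real k / ?n) * ennreal (size_integral ?n k (?d k)))"
    using nn by (subst sum_ennreal [symmetric])
      (auto simp: size_integral_nonneg ennreal_mult'' intro!: mult_nonneg_nonneg)
  also have "\<dots> = (\<Sum>k=1..K. ennreal (1 - real k / ?n) * (\<integral>\<^sup>+t. ?b k t \<partial>unif))"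
    using assms by (intro sum.cong refl arg_cong2[where f = "(*)"] nn_integral_size [symmetric]) auto
  also have "\<dots> = (\<integral>\<^sup>+t. (\<Sum>k=1..K. ennreal (1 - real k / ?n) * ?b k t) \<partial>unif)"
    by (subst nn_integral_sum)
       (auto intro!: borel_measurable_times_ennreal borel_measurable_size sum.cong nn_integral_cmult [symmetric])
  also have "\<dots> \<le> hazard_integral V 0"
    unfolding hazard_integral_def
  proof (rule nn_integral_mono_AE)
    show "AE t in unif. (\<Sum>k=1..K. ennreal (1 - real k / ?n) * ?b k t)
      \<le> ennreal (1 / (1 - t)) * excess V t * indicator {0..} t"
      using AE_unif
    proof eventually_elim
      case (elim t)
      have "(\<Sum>k=1..K. ennreal (1 - real k / ?n) * ?b k t)
        = ennreal (1 / (1 - t)) * (\<Sum>k=1..K. ennreal (1 - real k / ?n) * ennreal (real (?n choose k) * num_trees k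
      * (t ^ (k - 1) * (1 - t) ^ (k * (?n - k) + ?d k))))"
        unfolding sum_distrib_left by (intro sum.cong refl) (simp only: mult_ac)
      also have "\<dots> \<le> ennreal (1 / (1 - t)) * excess V t"
        using assms elim ne by (intro mult_left_mono excess_ge_sizes) auto
      finally show ?case using elim by simp
    qed
  qed
  finally show ?thesis .
qed

section \<open>Asymptotics of the size integrals\<close>

lemma fact_add_eq_prod: "(fact (m + k) :: real) = fact m * (\<Prod>i<k. real m + 1 + real i)"
  by (induction k) (simp_all add: algebra_simps)

text \<open>The factorials are cancelled until \<open>k\<close> factors remain above and below, a
  number independent of \<open>n\<close>, so that the limit can be taken factor by factor.\<close>

lemma size_integral_eq_prod:
  assumes "1 \<le> k" "k < n"
  shows "size_integral n k d
    = num_trees k / k * (\<Prod>i<k. (real n - real i) / (real k * (real n - real k) + real d + real i))"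
proof -
  let ?m = "k * (n - k) + d - 1"
  have m: "real ?m = real k * (real n - real k) + real d - 1"
    using assms by (simp add: of_nat_diff Suc_le_eq)
  have f: "fact (k * (n - k) + d + k - 1) = (fact ?m * (\<Prod>i<k. real k * (real n - real k) + real d + real i) :: real)"
  proof -
    have "k * (n - k) + d + k - 1 = ?m + k" using assms by (cases "k * (n - k)") auto
    then show ?thesis using m by (simp only: fact_add_eq_prod) simp
  qed
  have c: "real (n choose k) * fact (k - 1) = (\<Prod>i<k. real n - real i) / k"
  proof -
    have "fact k * real (n choose k) = (\<Prod>i<k. real n - real i)"
      using gbinomial_mult_fact[of k "real n"] by (simp add: binomial_gbinomial atLeast0LessThan)
    moreover have "(fact k :: real) = k * fact (k - 1)" using assms by (simp add: fact_reduce)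
    ultimately show ?thesis using assms by (simp add: field_simps)
  qed
  have "size_integral n k d = num_trees k * (real (n choose k) * fact (k - 1))
      * (fact ?m / fact (k * (n - k) + d + k - 1))"
    by (simp add: size_integral_def)
  also have "fact ?m / fact (k * (n - k) + d + k - 1)
      = 1 / (\<Prod>i<k. real k * (real n - real k) + real d + real i)"
    unfolding f by simp
  finally show ?thesis unfolding c by (simp add: prod_dividef)
qed

text \<open>Each of the \<open>k\<close> factors tends to \<open>1 / k\<close>, and
  \<open>k ^ (k - 2) / k / k ^ k = 1 / k ^ 3\<close>. The limit does not see \<open>d\<close>, so
  the upper and the lower bound agree asymptotically.\<close>

lemma size_integral_tendsto:
  assumes "1 \<le> k"
  shows "(\<lambda>n. size_integral n k d) \<longlonglongrightarrow> 1 / real k ^ 3"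
proof -
  have "(\<lambda>n. (real n - real i) / (real k * (real n - real k) + real d + real i)) \<longlonglongrightarrow> inverse (real k)" for i
  proof -
    have "(\<lambda>n. (1 - real i / real n) / (real k * (1 - real k / real n) + (real d + real i) / real n))
        \<longlonglongrightarrow> (1 - 0) / (real k * (1 - 0) + 0)"
      using assms by (intro tendsto_intros lim_const_over_n) simp
    moreover have "eventually (\<lambda>n. (1 - real i / real n) / (real k * (1 - real k / real n) + (real d + real i) / real n)
        = (real n - real i) / (real k * (real n - real k) + real d + real i)) sequentially"
      using eventually_gt_at_top[of 0]
    proof eventually_elim
      case (elim n)
      have "(1 - real i / real n) = (real n - real i) / n"
        "real k * (1 - real k / real n) + (real d + real i) / real n = (real k * (real n - real k) + real d + real i) / n"
        using elim by (simp_all add: field_simps)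
      then show ?case using elim by simp
    qed
    ultimately show ?thesis by (auto simp: inverse_eq_divide intro: Lim_transform_eventually)
  qed
  then have "(\<lambda>n. num_trees k / k * (\<Prod>i<k. (real n - real i) / (real k * (real n - real k) + real d + real i)))
      \<longlonglongrightarrow> num_trees k / k * (\<Prod>i<k. inverse (real k))"
    by (intro tendsto_mult tendsto_const tendsto_prod)
  moreover have "eventually (\<lambda>n. num_trees k / k * (\<Prod>i<k. (real n - real i) / (real k * (real n - real k) + real d + real i))
      = size_integral n k d) sequentially"
    using eventually_gt_at_top[of k] by eventually_elim (simp add: size_integral_eq_prod[OF assms])
  ultimately have "(\<lambda>n. size_integral n k d) \<longlonglongrightarrow> num_trees k / k * (\<Prod>i<k. inverse (real k))"
    by (rule Lim_transform_eventually)
  moreover have "num_trees k / k * (\<Prod>i<k. inverse (real k)) = 1 / real k ^ 3"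
  proof -
    have "q ^ j / q / q * inverse q ^ Suc j = 1 / q ^ 3" if "q > 0" for q :: real and j
      using that by (simp add: field_simps power3_eq_cube)
    moreover obtain j where "k = Suc j" using assms by (cases k) auto
    ultimately show ?thesis by (simp only: num_trees_def prod_constant card_lessThan diff_Suc_1)
  qed
  ultimately show ?thesis by simp
qed

section \<open>The series for zeta(3) and the limit of the hazard integral\<close>

lemma riemann_zeta_3_sums: "(\<lambda>k. 1 / real (Suc k) ^ 3) sums riemann_zeta 3"
proof -
  have "summable (\<lambda>k. 1 / real k ^ 3)"
    using inverse_power_summable[of 3, where ?'a = real] by (simp add: inverse_eq_divide)
  then have "summable (\<lambda>k. 1 / real (Suc k) ^ 3)" by (subst summable_Suc_iff)
  moreover have "real (Suc k) powr 3 = real (Suc k) ^ 3" for k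
    by (subst powr_numeral [symmetric]) simp_all
  ultimately show ?thesis unfolding riemann_zeta_def by (simp only: summable_sums)
qed

lemma sum_inverse_cubes_tendsto: "(\<lambda>K. \<Sum>k=1..K. 1 / real k ^ 3) \<longlonglongrightarrow> riemann_zeta 3"
proof -
  have "(\<Sum>k=1..K. 1 / real k ^ 3) = (\<Sum>k<K. 1 / real (Suc k) ^ 3)" for K
    by (rule sum.reindex_bij_witness[of _ Suc "\<lambda>k. k - 1"]) auto
  then show ?thesis using riemann_zeta_3_sums by (simp add: sums_def)
qed

lemma sum_inverse_cubes_le: "(\<Sum>k=1..K. 1 / real k ^ 3) \<le> riemann_zeta 3"
proof (rule incseq_le[OF _ sum_inverse_cubes_tendsto])
  show "incseq (\<lambda>K. \<Sum>k=1..K. 1 / real k ^ 3)"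
    by (rule incseq_SucI) simp
qed

text \<open>Time is cut at \<open>t = A / n\<close> and component orders at \<open>A\<^sup>2\<close>: up to that time the larger
  components contribute at most about \<open>1 / A\<close>, and all of them at most \<open>4 / A\<close> afterwards.\<close>

lemma hazard_integral_tendsto:
  "(\<lambda>n. enn2real (hazard_integral {1..n} 0)) \<longlonglongrightarrow> riemann_zeta 3"
proof (rule order_tendstoI)
  let ?S = "\<lambda>K. \<Sum>k=1..K. 1 / real k ^ 3"
  fix y assume y: "y < riemann_zeta 3"
  \<comment> \<open>A partial sum already exceeds \<open>y\<close>, so finitely many component
    orders suffice for the lower bound.\<close>
  obtain K where K: "y < ?S K"
    using eventually_happens[OF order_tendstoD(1)[OF sum_inverse_cubes_tendsto y]] by auto
  let ?L = "\<lambda>n. \<Sum>k=1..K. (1 - real k / n) * size_integral n k ((k choose 2) - (k - 1))"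
  have "?L \<longlonglongrightarrow> (\<Sum>k=1..K. (1 - 0) * (1 / real k ^ 3))"
    by (intro tendsto_sum tendsto_mult tendsto_diff tendsto_const lim_const_over_n size_integral_tendsto) auto
  then have "eventually (\<lambda>n. y < ?L n) sequentially" using K by (intro order_tendstoD(1)) auto
  then show "eventually (\<lambda>n. y < enn2real (hazard_integral {1..n} 0)) sequentially"
    using eventually_gt_at_top[of K]
  proof eventually_elim
    case (elim n)
    \<comment> \<open>Finiteness matters because \<open>enn2real\<close> sends infinity to
      zero.\<close>
    have fin: "hazard_integral {1..n} 0 < \<top>"
      using hazard_integral_tail(2)[of "{1..n}" 1] elim by (auto intro: le_less_trans)
    have "0 \<le> ?L n"
      using elim by (intro sum_nonneg mult_nonneg_nonneg size_integral_nonneg) auto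
    moreover have "ennreal (?L n) \<le> hazard_integral {1..n} 0"
      using hazard_integral_lower[of "{1..n}" K] elim by simp
    ultimately have "?L n \<le> enn2real (hazard_integral {1..n} 0)"
      using enn2real_mono[OF _ fin] by fastforce
    with elim show ?case by simp
  qed
next
  let ?S = "\<lambda>K. \<Sum>k=1..K. 1 / real k ^ 3"
  fix y assume y: "riemann_zeta 3 < y"
  \<comment> \<open>In the limit the errors are \<open>1 / A\<close> from large components and
    \<open>4 / A\<close> from late times, together \<open>5 / A\<close>.\<close>
  obtain A :: nat where A: "5 / (y - riemann_zeta 3) < A" using reals_Archimedean2 by blast
  have "0 < 5 / (y - riemann_zeta 3)" using y by simp
  with A have A0: "0 < real A" by linarith
  then have A1: "5 / A < y - riemann_zeta 3" using A y by (simp add: field_simps)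
  define K where "K = A\<^sup>2"
  have K: "0 < K" using A0 by (simp add: K_def)
  let ?U = "\<lambda>n. (\<Sum>k=1..K. size_integral n k 0) + 1 / A * (1 / (1 - A / real n)) + 4 / A"
  have "?U \<longlonglongrightarrow> ?S K + 1 / A * (1 / (1 - 0)) + 4 / A"
    by (intro tendsto_sum tendsto_mult tendsto_diff tendsto_divide tendsto_add tendsto_const lim_const_over_n size_integral_tendsto) auto
  moreover have "?S K + 1 / A * (1 / (1 - 0)) + 4 / A < y"
    using sum_inverse_cubes_le[of K] A1 by (simp add: field_simps)
  ultimately have "eventually (\<lambda>n. ?U n < y) sequentially" by (rule order_tendstoD(2))
  then show "eventually (\<lambda>n. enn2real (hazard_integral {1..n} 0) < y) sequentially"
    using eventually_gt_at_top[of "max K A"]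
  proof eventually_elim
    case (elim n)
    then have n: "K < n" "A < n" by auto
    let ?s = "real A / real n"
    have s: "0 < ?s" "?s < 1" using A0 n by auto
    have "hazard_integral {1..n} 0
      \<le> ennreal ((\<Sum>k=1..K. size_integral n k 0) + n / K * (?s / (1 - ?s)) + 4 / (n * ?s))"
      using hazard_integral_upper[of "{1..n}" K ?s] K n s by simp
    moreover have "n / K * (?s / (1 - ?s)) = 1 / A * (1 / (1 - ?s))"
      using A0 n by (simp add: K_def power2_eq_square)
    moreover have "4 / (n * ?s) = 4 / A" using n by simp
    ultimately have "hazard_integral {1..n} 0 \<le> ennreal (?U n)" by simp
    moreover have "0 \<le> ?U n" using s A0 by (intro add_nonneg_nonneg sum_nonneg size_integral_nonneg) auto
    ultimately have "enn2real (hazard_integral {1..n} 0) \<le> ?U n" by (rule enn2real_leI[rotated])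
    with elim show ?case by simp
  qed
qed

text \<open>Euler--Maclaurin approximations of \<open>\<Sum>k\<ge>m. 1 / k\<^sup>3\<close>, which telescope.\<close>

lemma inverse_cube_telescope:
  fixes x :: real
  defines "g \<equiv> \<lambda>x::real. 1 / (2 * x ^ 2) + 1 / (2 * x ^ 3) + 1 / (4 * x ^ 4)"
  assumes x: "x > 0"
  shows "1 / x ^ 3 \<le> g x - g (x + 1)"
    and "(g x - 1 / (12 * x ^ 6)) - (g (x + 1) - 1 / (12 * (x + 1) ^ 6)) \<le> 1 / x ^ 3"
proof -
  \<comment> \<open>The terms of \<open>g\<close> are the integral of \<open>1 / y ^ 3\<close> from
    \<open>x\<close> on, half the first summand, and the first derivative correction. The next
    correction is \<open>- 1 / (12 * x ^ 6)\<close>.\<close>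
  have g: "g y = (2 * y ^ 2 + 2 * y + 1) / (4 * y ^ 4)" if "y > 0" for y
    using that unfolding g_def by (simp add: field_simps eval_nat_numeral)
  have "g x - g (x + 1) - 1 / x ^ 3
    = ((2 * x ^ 2 + 2 * x + 1) * (x + 1) ^ 4 - (2 * (x + 1) ^ 2 + 2 * (x + 1) + 1) * x ^ 4
        - 4 * x * (x + 1) ^ 4) / (4 * x ^ 4 * (x + 1) ^ 4)"
  proof -
    have "4 * x ^ 4 * (x + 1) ^ 4 = x ^ 3 * (4 * x * (x + 1) ^ 4)" by algebra
    then have "1 / x ^ 3 = 4 * x * (x + 1) ^ 4 / (4 * x ^ 4 * (x + 1) ^ 4)" using x by simp
    moreover have "g x = (2 * x ^ 2 + 2 * x + 1) * (x + 1) ^ 4 / (4 * x ^ 4 * (x + 1) ^ 4)"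
      using x by (simp add: g)
    moreover have "g (x + 1) = (2 * (x + 1) ^ 2 + 2 * (x + 1) + 1) * x ^ 4 / (4 * x ^ 4 * (x + 1) ^ 4)"
      using x by (simp add: g)
    ultimately show ?thesis by (simp add: diff_divide_distrib)
  qed
  also have "(2 * x ^ 2 + 2 * x + 1) * (x + 1) ^ 4 - (2 * (x + 1) ^ 2 + 2 * (x + 1) + 1) * x ^ 4
      - 4 * x * (x + 1) ^ 4 = 2 * x + 1"
    by algebra
  finally have diff: "g x - g (x + 1) - 1 / x ^ 3 = (2 * x + 1) / (4 * x ^ 4 * (x + 1) ^ 4)" .
  moreover have "0 \<le> (2 * x + 1) / (4 * x ^ 4 * (x + 1) ^ 4)" using x by simp
  ultimately show "1 / x ^ 3 \<le> g x - g (x + 1)" by linarith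
  have "1 / (12 * x ^ 6) - 1 / (12 * (x + 1) ^ 6) - (2 * x + 1) / (4 * x ^ 4 * (x + 1) ^ 4)
     = ((x + 1) ^ 6 - x ^ 6 - 3 * (2 * x + 1) * x ^ 2 * (x + 1) ^ 2) / (12 * x ^ 6 * (x + 1) ^ 6)"
  proof -
    have "1 / (12 * x ^ 6) = (x + 1) ^ 6 / (12 * x ^ 6 * (x + 1) ^ 6)"
      "1 / (12 * (x + 1) ^ 6) = x ^ 6 / (12 * x ^ 6 * (x + 1) ^ 6)"
      using x by simp_all
    moreover have "(2 * x + 1) / (4 * x ^ 4 * (x + 1) ^ 4)
        = 3 * (2 * x + 1) * x ^ 2 * (x + 1) ^ 2 / (12 * x ^ 6 * (x + 1) ^ 6)"
    proof -
      have "3 * x ^ 2 * (x + 1) ^ 2 \<noteq> 0" using x by simp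
      from mult_divide_mult_cancel_left[OF this, of "2 * x + 1" "4 * x ^ 4 * (x + 1) ^ 4"]
      have "(2 * x + 1) / (4 * x ^ 4 * (x + 1) ^ 4)
        = (3 * x ^ 2 * (x + 1) ^ 2 * (2 * x + 1)) / (3 * x ^ 2 * (x + 1) ^ 2 * (4 * x ^ 4 * (x + 1) ^ 4))" ..
      also have "3 * x ^ 2 * (x + 1) ^ 2 * (4 * x ^ 4 * (x + 1) ^ 4) = 12 * x ^ 6 * (x + 1) ^ 6"
        by algebra
      also have "3 * x ^ 2 * (x + 1) ^ 2 * (2 * x + 1) = 3 * (2 * x + 1) * x ^ 2 * (x + 1) ^ 2"
        by algebra
      finally show ?thesis .
    qed
    ultimately show ?thesis by (simp add: diff_divide_distrib)
  qed
  \<comment> \<open>With \<open>a = x ^ 2\<close> and \<open>b = (x + 1) ^ 2\<close> this is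
    \<open>b ^ 3 - a ^ 3 - 3 a b (b - a) = (b - a) ^ 3\<close>, where
    \<open>b - a = 2 x + 1\<close>.\<close>
  also have "(x + 1) ^ 6 - x ^ 6 - 3 * (2 * x + 1) * x ^ 2 * (x + 1) ^ 2 = (2 * x + 1) * ((x + 1) ^ 2 - x ^ 2) ^ 2"
    by algebra
  also have "0 \<le> \<dots> / (12 * x ^ 6 * (x + 1) ^ 6)" using x by simp
  finally show "(g x - 1 / (12 * x ^ 6)) - (g (x + 1) - 1 / (12 * (x + 1) ^ 6)) \<le> 1 / x ^ 3"
    using diff by linarith
qed

text \<open>The two bounds are exactly what the decimals \<open>1.1917724\<close> and
  \<open>1.1917723\<close> demand of zeta(3). Fifteen terms are summed exactly and the tail from
  \<open>16\<close> is enclosed with width \<open>1 / (12 * 16 ^ 6)\<close>, about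
  \<open>5 * 10 ^ (-9)\<close>, which is small enough.\<close>

lemma riemann_zeta_3_bounds: "1.2020569 < riemann_zeta 3" "riemann_zeta 3 < 1.202056925"
proof -
  define g where "g x = 1 / (2 * x ^ 2) + 1 / (2 * x ^ 3) + 1 / (4 * x ^ 4)" for x :: real
  define h where "h x = g x - 1 / (12 * x ^ 6)" for x :: real
  note tel = inverse_cube_telescope[folded g_def]
  have inv0: "(\<lambda>k. c / (d * (16 + real k) ^ Suc j)) \<longlonglongrightarrow> 0" for c d j
  proof -
    have "filterlim (\<lambda>k. 16 + real k) at_infinity sequentially"
      by (intro tendsto_add_filterlim_at_infinity[OF tendsto_const] tendsto_of_nat)
    then have "(\<lambda>k. inverse (16 + real k)) \<longlonglongrightarrow> 0" by (rule tendsto_inverse_0[THEN filterlim_compose])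
    then have "(\<lambda>k. c / d * inverse (16 + real k) ^ Suc j) \<longlonglongrightarrow> c / d * 0 ^ Suc j"
      by (intro tendsto_intros)
    then show ?thesis by (simp add: field_simps)
  qed
  have g0: "(\<lambda>k. g (16 + real k)) \<longlonglongrightarrow> 0 + 0 + 0"
    unfolding g_def using inv0[of 1 2 1] inv0[of 1 2 2] inv0[of 1 4 3]
    by (intro tendsto_add) (simp_all add: eval_nat_numeral)
  have h0: "(\<lambda>k. h (16 + real k)) \<longlonglongrightarrow> 0 + 0 + 0 - 0"
    unfolding h_def using g0 inv0[of 1 12 5] by (intro tendsto_diff) (simp_all add: eval_nat_numeral)
  have tail: "(\<lambda>k. 1 / (16 + real k) ^ 3) sums (riemann_zeta 3 - (\<Sum>k<15. 1 / real (Suc k) ^ 3))"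
    using sums_iff_shift'[of "\<lambda>k. 1 / real (Suc k) ^ 3" 15 "riemann_zeta 3"] riemann_zeta_3_sums
    by (simp add: add_ac)
  have "(\<lambda>k. g (16 + real k) - g (16 + real (Suc k))) sums (g 16 - 0)"
    using telescope_sums'[OF g0] by simp
  then have up: "riemann_zeta 3 - (\<Sum>k<15. 1 / real (Suc k) ^ 3) \<le> g 16 - 0"
  proof (rule sums_le[OF _ tail, rotated])
    show "1 / (16 + real k) ^ 3 \<le> g (16 + real k) - g (16 + real (Suc k))" for k
      using tel(1)[of "16 + real k"] by (simp add: add_ac)
  qed
  moreover have "(\<lambda>k. h (16 + real k) - h (16 + real (Suc k))) sums (h 16 - 0)"
    using telescope_sums'[OF h0] by simp
  then have "h 16 - 0 \<le> riemann_zeta 3 - (\<Sum>k<15. 1 / real (Suc k) ^ 3)"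
  proof (rule sums_le[OF _ _ tail, rotated])
    show "h (16 + real k) - h (16 + real (Suc k)) \<le> 1 / (16 + real k) ^ 3" for k
      using tel(2)[of "16 + real k"] by (simp add: h_def add_ac)
  qed
  moreover have "(\<Sum>k<15. 1 / real (Suc k) ^ 3) = 1 + 1/8 + 1/27 + 1/64 + 1/125 + 1/216 + 1/343 + 1/512
      + 1/729 + 1/1000 + 1/1331 + 1/1728 + 1/2197 + 1/2744 + 1/3375"
    by (simp add: eval_nat_numeral)
  ultimately show "1.2020569 < riemann_zeta 3" "riemann_zeta 3 < 1.202056925"
    unfolding h_def g_def by simp_all
qed

section \<open>Transfer to arbitrary i.i.d. weights\<close>

lemma is_mst_cong:
  assumes "\<And>e. e \<in> complete_edges n \<Longrightarrow> x e = y e"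
  shows "is_mst n x = is_mst n y"
proof -
  have "sum x T = sum y T" if "spanning_tree n T" for T
    using that assms unfolding spanning_tree_def by (intro sum.cong) auto
  then show ?thesis unfolding is_mst_def by auto
qed

text \<open>Weights that agree on the edges have the same minimisers, so the choice operator returns
  the same tree even if there are ties.\<close>

lemma mst_cong:
  assumes "\<And>e. e \<in> complete_edges n \<Longrightarrow> x e = y e"
  shows "mst n x = mst n y"
proof -
  have "is_mst n x = is_mst n y" by (rule is_mst_cong) (rule assms)
  then show ?thesis by (simp add: mst_def)
qed

lemma measurable_mst: "mst n \<in> measurable (weights (complete_edges n)) (count_space UNIV)"
proof -
  let ?E = "complete_edges n"
  have sets_is_mst: "{x \<in> space (weights ?E). is_mst n x T} \<in> sets (weights ?E)" for T
  proof (cases "spanning_tree n T")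
    case True
    have [measurable]: "(\<lambda>x. sum x T') \<in> borel_measurable (weights ?E)" if "spanning_tree n T'" for T'
      using that unfolding spanning_tree_def
      by (intro borel_measurable_sum measurable_weights_component) auto
    have "{x \<in> space (weights ?E). \<forall>T'\<in>{T'. spanning_tree n T'}. sum x T \<le> sum x T'} \<in> sets (weights ?E)"
    proof (rule sets.sets_Collect_finite_All[OF _ finite_spanning_trees])
      fix T' assume "T' \<in> {T'. spanning_tree n T'}"
      then have [measurable]: "(\<lambda>x. sum x T') \<in> borel_measurable (weights ?E)" "(\<lambda>x. sum x T) \<in> borel_measurable (weights ?E)"
        using True \<open>\<And>T'. spanning_tree n T' \<Longrightarrow> (\<lambda>x. sum x T') \<in> borel_measurable (weights ?E)\<close> by auto
      show "{x \<in> space (weights ?E). sum x T \<le> sum x T'} \<in> sets (weights ?E)" by measurable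
    qed
    then show ?thesis using True by (simp add: is_mst_def)
  qed (simp add: is_mst_def)
  have "(\<lambda>x. {T. is_mst n x T}) \<in> measurable (weights ?E) (count_space (Pow {T. spanning_tree n T}))"
  proof (rule measurable_count_space_eq2[THEN iffD2], use finite_spanning_trees in simp, intro conjI ballI)
    show "(\<lambda>x. {T. is_mst n x T}) \<in> space (weights ?E) \<rightarrow> Pow {T. spanning_tree n T}"
      by (auto simp: is_mst_def)
    fix S assume S: "S \<in> Pow {T. spanning_tree n T}"
    have "{x \<in> space (weights ?E). \<forall>T\<in>{T. spanning_tree n T}. is_mst n x T = (T \<in> S)} \<in> sets (weights ?E)"
    proof (rule sets.sets_Collect_finite_All[OF _ finite_spanning_trees])
      fix T
      show "{x \<in> space (weights ?E). is_mst n x T = (T \<in> S)} \<in> sets (weights ?E)"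
        using sets_is_mst[of T] sets.sets_Collect_neg[OF sets_is_mst[of T]] by (cases "T \<in> S") simp_all
    qed
    moreover have "{T. is_mst n x T} = S \<longleftrightarrow> (\<forall>T\<in>{T. spanning_tree n T}. is_mst n x T = (T \<in> S))" for x
    proof -
      have "is_mst n x T \<or> T \<in> S \<Longrightarrow> spanning_tree n T" for T
        using S unfolding is_mst_def by blast
      then show ?thesis unfolding set_eq_iff mem_Collect_eq by blast
    qed
    then have "(\<lambda>x. {T. is_mst n x T}) -` {S} \<inter> space (weights ?E)
        = {x \<in> space (weights ?E). \<forall>T\<in>{T. spanning_tree n T}. is_mst n x T = (T \<in> S)}"
      by (intro set_eqI) (simp only: vimage_eq Int_iff mem_Collect_eq singleton_iff conj_commute)
    ultimately show "(\<lambda>x. {T. is_mst n x T}) -` {S} \<inter> space (weights ?E) \<in> sets (weights ?E)" by (simp only:)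
  qed
  \<comment> \<open>Choosing a minimiser is a function on a finite discrete space, hence measurable
    whatever it selects.\<close>
  moreover have "(\<lambda>S. SOME T. T \<in> S) \<in> measurable (count_space (Pow {T. spanning_tree n T})) (count_space UNIV)"
    by simp
  ultimately have "(\<lambda>x. SOME T. T \<in> {T. is_mst n x T}) \<in> measurable (weights ?E) (count_space UNIV)"
    by (rule measurable_compose)
  then show ?thesis by (simp add: mst_def [abs_def])
qed

text \<open>The joint law of the given weights is the product measure, so what is computed on
  \<open>weights\<close> carries over to \<open>P\<close>.\<close>

lemma distr_weights:
  assumes "iid_uniform_weights n P w"
  shows "(\<lambda>\<omega>. \<lambda>e\<in>complete_edges n. w e \<omega>) \<in> measurable P (weights (complete_edges n))"
    and "distr P (weights (complete_edges n)) (\<lambda>\<omega>. \<lambda>e\<in>complete_edges n. w e \<omega>) = weights (complete_edges n)"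
proof -
  let ?E = "complete_edges n" and ?X = "\<lambda>\<omega>. \<lambda>e\<in>complete_edges n. w e \<omega>"
  interpret prob_space P using assms by (simp add: iid_uniform_weights_def)
  have indep: "indep_vars (\<lambda>_. borel) w ?E" and d: "\<And>e. e \<in> ?E \<Longrightarrow> distr P borel (w e) = unif"
    using assms by (auto simp: iid_uniform_weights_def)
  have rv: "w e \<in> borel_measurable P" if "e \<in> ?E" for e
    using indep that by (simp add: indep_vars_def)
  show X: "?X \<in> measurable P (weights ?E)"
    using rv by (intro measurable_restrict) (simp add: measurable_unif)
  show "distr P (weights ?E) ?X = weights ?E"
  proof (cases "?E = {}")
    \<comment> \<open>Without edges, that is for \<open>n \<le> 1\<close>, the characterisation of
      independence by product measures does not apply; the product space is then a single
      point.\<close>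
    case True
    interpret D: prob_space "distr P (weights ?E) ?X" by (rule prob_space_distr[OF X])
    interpret W: prob_space "weights ?E" by (rule prob_space_weights)
    show ?thesis
    proof (rule measure_eqI)
      fix A assume "A \<in> sets (distr P (weights ?E) ?X)"
      then have "A \<in> sets (weights ?E)" by (simp only: sets_distr)
      then have "A \<in> {{}, {\<lambda>_. undefined}}" unfolding True sets_PiM_empty .
      moreover have "space (weights ?E) = {\<lambda>_. undefined}" unfolding True by (rule space_PiM_empty)
      ultimately consider "A = {}" | "A = space (weights ?E)" by blast
      then show "emeasure (distr P (weights ?E) ?X) A = emeasure (weights ?E) A"
        using D.emeasure_space_1 W.emeasure_space_1 by cases (simp_all only: space_distr emeasure_empty)
    qed (rule sets_distr)
  next
    case False
    have "distr P (weights ?E) ?X = distr P (PiM ?E (\<lambda>_. borel)) ?X"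
      by (rule distr_cong) (auto intro!: sets_PiM_cong)
    also have "\<dots> = PiM ?E (\<lambda>e. distr P borel (w e))"
      by (rule indep_vars_iff_distr_eq_PiM'[THEN iffD1, OF False rv indep])
    also have "\<dots> = weights ?E" using d by (intro PiM_cong) auto
    finally show ?thesis .
  qed
qed

text \<open>Ties and nonpositive weights have probability zero, so the Kruskal edges may replace the
  tree inside every expectation.\<close>

lemma variance_degree_mst:
  assumes "iid_uniform_weights n P w" "v \<in> {1..n}"
  shows "prob_space.variance P (\<lambda>\<omega>. real (degree_in (mst n (\<lambda>e. w e \<omega>)) v))
    = 10 * (1 - 1 / n) - 4 * enn2real (hazard_integral {1..n} 0) - (2 * (1 - 1 / n))\<^sup>2"
proof -
  let ?E = "complete_edges n" and ?X = "\<lambda>\<omega>. \<lambda>e\<in>complete_edges n. w e \<omega>"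
  let ?f = "\<lambda>x. real (degree_in (mst n x) v)" and ?g = "\<lambda>x. real (degree_in (kruskal x (complete_edges n)) v)"
  note X = distr_weights[OF assms(1)]
  have f [measurable]: "?f \<in> borel_measurable (weights ?E)"
    using measurable_compose[OF measurable_mst[of n], of "\<lambda>T. real (degree_in T v)" borel] by simp
  have g [measurable]: "?g \<in> borel_measurable (weights ?E)"
    by (rule borel_measurable_degree_kruskal) simp
  have fg: "AE x in weights ?E. ?f x = ?g x"
    using AE_weights_generic[OF finite_complete_edges, of n]
    by eventually_elim (simp add: mst_eq_kruskal)
  have mX: "mst n (\<lambda>e. w e \<omega>) = mst n (?X \<omega>)" for \<omega> by (rule mst_cong) simp
  have int: "(\<integral>\<omega>. F (?f (?X \<omega>)) \<partial>P) = (\<integral>x. F (?g x) \<partial>weights ?E)"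
    if F: "F \<in> borel_measurable borel" for F :: "real \<Rightarrow> real"
  proof -
    have Ff: "(\<lambda>x. F (?f x)) \<in> borel_measurable (weights ?E)" "(\<lambda>x. F (?g x)) \<in> borel_measurable (weights ?E)"
      using measurable_compose[OF f F] measurable_compose[OF g F] by auto
    have "(\<integral>\<omega>. F (?f (?X \<omega>)) \<partial>P) = (\<integral>x. F (?f x) \<partial>distr P (weights ?E) ?X)"
      by (rule integral_distr [symmetric]) (rule X(1) Ff(1))+
    also have "\<dots> = (\<integral>x. F (?f x) \<partial>weights ?E)" unfolding X(2) ..
    also have "\<dots> = (\<integral>x. F (?g x) \<partial>weights ?E)"
      using Ff fg by (intro integral_cong_AE) auto
    finally show ?thesis .
  qed
  \<comment> \<open>With the identity, \<open>int\<close> transfers the mean; with the square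
    centred at that mean it transfers the variance.\<close>
  have "prob_space.variance P (\<lambda>\<omega>. ?f (?X \<omega>)) = prob_space.variance (weights ?E) ?g"
    using int[of "\<lambda>y. y"] int[of "\<lambda>y. (y - (\<integral>x. ?g x \<partial>weights ?E))\<^sup>2"] by simp
  also have "\<dots> = 10 * (1 - 1 / n) - 4 * enn2real (hazard_integral {1..n} 0) - (2 * (1 - 1 / n))\<^sup>2"
    using variance_degree[OF _ assms(2)] unfolding complete_edges_eq by simp
  finally show ?thesis unfolding mX .
qed

theorem corollary1p4:
  fixes P :: "nat \<Rightarrow> 'a measure"
    and w :: "nat \<Rightarrow> nat set \<Rightarrow> 'a \<Rightarrow> real"
    and v :: nat
  assumes "\<And>n. iid_uniform_weights n (P n) (w n)"
    and "v \<ge> 1"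
  shows "(\<lambda>n. prob_space.variance (P n)
             (\<lambda>\<omega>. real (degree_in (mst n (\<lambda>e. w n e \<omega>)) v)))
           \<longlonglongrightarrow> 6 - 4 * riemann_zeta 3
         \<and> 1.1917723 < 6 - 4 * riemann_zeta 3 \<and> 6 - 4 * riemann_zeta 3 < 1.1917724"
proof (intro conjI)
  have "(\<lambda>n. 10 * (1 - 1 / real n) - 4 * enn2real (hazard_integral {1..n} 0) - (2 * (1 - 1 / real n))\<^sup>2)
      \<longlonglongrightarrow> 10 * (1 - 0) - 4 * riemann_zeta 3 - (2 * (1 - 0))\<^sup>2"
    by (intro tendsto_intros lim_const_over_n hazard_integral_tendsto)
  \<comment> \<open>\<open>variance_degree_mst\<close> asks for \<open>v\<close> in
    \<open>{1..n}\<close>, which holds from \<open>n = v\<close> on.\<close>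
  moreover have "eventually (\<lambda>n. 10 * (1 - 1 / real n) - 4 * enn2real (hazard_integral {1..n} 0) - (2 * (1 - 1 / real n))\<^sup>2
      = prob_space.variance (P n) (\<lambda>\<omega>. real (degree_in (mst n (\<lambda>e. w n e \<omega>)) v))) sequentially"
    using eventually_ge_at_top[of v]
  proof eventually_elim
    case (elim n)
    then have "v \<in> {1..n}" using assms(2) by simp
    from variance_degree_mst[OF assms(1) this] show ?case by simp
  qed
  ultimately have "(\<lambda>n. prob_space.variance (P n) (\<lambda>\<omega>. real (degree_in (mst n (\<lambda>e. w n e \<omega>)) v)))
      \<longlonglongrightarrow> 10 * (1 - 0) - 4 * riemann_zeta 3 - (2 * (1 - 0))\<^sup>2"
    by (rule Lim_transform_eventually)
  then show "(\<lambda>n. prob_space.variance (P n) (\<lambda>\<omega>. real (degree_in (mst n (\<lambda>e. w n e \<omega>)) v)))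
      \<longlonglongrightarrow> 6 - 4 * riemann_zeta 3" by simp
  show "1.1917723 < 6 - 4 * riemann_zeta 3" "6 - 4 * riemann_zeta 3 < 1.1917724"
    using riemann_zeta_3_bounds by simp_all
qed

end
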